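(* Let $X$ be a finite $r$-dimensional simplicial complex ($r\ge1$), and let $q\ge1$ be an integer, such that one of the following holds: (1) $X$ is a $q$-thick spherical building admitting a strongly transitive action; (2) the universal covering of $X$ is a $q$-thick affine building of dimension $\geq2$ admitting a strongly transitive action, and the labeling of its vertices (by the vertices of its Coxeter diagram) descends to $X$. In both cases, $X$ has the structure of a pure $(r+1)$-partite simplicial complex. Let $w$ denote the canonical weight function of $X$, let $T$ denote the Coxeter diagram of the building mentioned in (1) or (2), and put $m=m(T)$. Then $(X,w)$ is an $(r+1)$-partite $[-r\lambda,\lambda]$-expander for $$\lambda=\frac{\sqrt{m-2}}{\sqrt q-(r-1)\sqrt{m-2}},$$ provided $q\geq r^2(m-2)$. Furthermore, $m\leq8$ when (1) holds, and $m\leq6$ when (2) holds.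
   Context: Buildings (as in Abramenko--Brown, "Buildings"): a building is a (possibly infinite) simplicial complex $X$ that is the union of a collection $\mathcal{E}$ of subcomplexes, called apartments, each a Coxeter complex, such that any two faces lie in a common apartment and any two apartments containing given faces $x,y$ are isomorphic via an isomorphism fixing $x$ and $y$ pointwise. All apartments are isomorphic to one Coxeter complex, encoded by a Coxeter diagram $T=T(X)$, a finite graph whose edges are labelled by elements of $\{3,4,5,\dots\}\cup\{\infty\}$ (unlabelled edges have label $3$). The vertices of $X$ are labelled by the vertices of $T$, making $X$ a pure $(r+1)$-partite complex with $r=\dim X=|V(T)|-1$ (parts = vertices of a given label). The labeling of a universal covering of $X$ descends to $X$ if vertices of the covering with the same image in $X$ have the same label. Let $B$ be the real $V(T)\times V(T)$ matrix with $B_{u,u}=1$, $B_{u,v}=-\cos(\pi/k)$ if $\{u,v\}$ is an edge of $T$ labelled $k$, and $B_{u,v}=0$ otherwise. $X$ is spherical if $B$ is positive definite (equivalently, apartments are finite), and affine if $B$ is positive semidefinite of rank $|V(T)|-1$. A building of dimension $r$ is $q$-thick if every $(r-1)$-face is contained in at least $q$ $r$-faces. $X$ admits a strongly transitive action if there is a group $G$ acting on $X$ by type-preserving (label-preserving) simplicial automorphisms that takes apartments to apartments and acts transitively on the pairs $(A,x)$ with $A\in\mathcal{E}$ and $x$ an $r$-face of $A$. Put $m(T)=\max(\{2\}\cup\{n: T\text{ has an edge labelled }n\})$. Simplicial complexes contain the empty face; $X(i)$ is the set of faces of dimension $i$ (cardinality $i+1$). The canonical weight function of a pure $r$-dimensional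 finite complex $X$ is $w(x)=\binom{r+1}{\dim x+1}^{-1}\frac{|\{y\in X(r):y\supseteq x\}|}{|X(r)|}$ for $x\in X$. Partite expansion: let $V_0,\dots,V_r$ be the parts of the $(r+1)$-partite complex $X$ (each face has at most one vertex in each part) and let $X_{\{i\}}$ be the set of $0$-faces with vertex in $V_i$. On functions $f:X(0)\to\mathbb{R}$ with inner product $\langle f,g\rangle=\sum_{v}w(v)f(v)g(v)$, let $(\mathcal{A}f)(v)=\sum_{e\in X(1),\,e\supseteq v}\frac{w(e)}{2w(v)}f(e-v)$, where $e-v$ is the other vertex of $e$. $\mathcal{A}$ is self-adjoint and preserves the span $L$ of the indicator functions $1_{X_{\{0\}}},\dots,1_{X_{\{r\}}}$, hence also $C^0_\diamond(X,\mathbb{R}):=L^\perp$. $(X,w)$ is an $(r+1)$-partite $[\mu,\lambda]$-expander if all eigenvalues of $\mathcal{A}$ on $C^0_\diamond(X,\mathbb{R})$ lie in $[\mu,\lambda]$.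
   Formalization: The clause "m ≤ 8 when (1) holds" is stated only when q ≥ 3 or q ≥ r²(m−2); without such a condition it is false, e.g. the 18-gon with its dihedral action is a 2-thick spherical building with m = 9. *)

theory Defs
  imports "HOL-Analysis.Analysis" "HOL-Algebra.Bij" "HOL-Library.Extended_Nat"
begin

section \<open>Simplicial complexes\<close>

text \<open>A complex is the set of its faces, the empty face included; its vertex set is
  \<^term>\<open>\<Union>X\<close>.\<close>

definition abstract_complex :: "'a set set \<Rightarrow> bool" where
  "abstract_complex X \<longleftrightarrow> {} \<in> X \<and> (\<forall>x\<in>X. finite x) \<and> (\<forall>x\<in>X. \<forall>y. y \<subseteq> x \<longrightarrow> y \<in> X)"

definition faces :: "'a set set \<Rightarrow> nat \<Rightarrow> 'a set set" where
  "faces X i = {x \<in> X. card x = i + 1}"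

text \<open>Meaningful for nonempty complexes whose faces have bounded cardinality and which have
  at least one vertex.\<close>

definition dimension :: "'a set set \<Rightarrow> nat" where
  "dimension X = Max (card ` X) - 1"

definition pure_complex :: "'a set set \<Rightarrow> bool" where
  "pure_complex X \<longleftrightarrow> (\<forall>x\<in>X. \<exists>y\<in>faces X (dimension X). x \<subseteq> y)"

definition complex_iso :: "('a \<Rightarrow> 'b) \<Rightarrow> 'a set set \<Rightarrow> 'b set set \<Rightarrow> bool" where
  "complex_iso f X Y \<longleftrightarrow> bij_betw f (\<Union>X) (\<Union>Y) \<and> (\<lambda>x. f ` x) ` X = Y"

text \<open>A partite structure is given by a map \<open>\<tau>\<close> from vertices to a finite index type whose fibres
  are the parts; the number of parts is the cardinality of that type.\<close>

definition partite_complex :: "nat \<Rightarrow> 'a set set \<Rightarrow> ('a \<Rightarrow> 't::finite) \<Rightarrow> bool" where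
  "partite_complex n X \<tau> \<longleftrightarrow> CARD('t) = n \<and> (\<forall>x\<in>X. inj_on \<tau> x)"


section \<open>Universal coverings\<close>

text \<open>Points of the realization are barycentric coordinates. It carries the topology of pointwise
  convergence (the function-space topology of \<open>HOL-Analysis\<close>), which agrees with the weak topology
  when the complex is locally finite, hence for every covering of a finite complex.\<close>

definition realization :: "'a set set \<Rightarrow> ('a \<Rightarrow> real) set" where
  "realization X =
     {f. (\<forall>v. 0 \<le> f v) \<and> {v. f v \<noteq> 0} \<in> X \<and> (\<Sum>v | f v \<noteq> 0. f v) = 1}"

text \<open>The star of the empty face is the whole complex, so it is exempted from the bijectivity
  condition.\<close>

definition simplicial_covering :: "('b \<Rightarrow> 'a) \<Rightarrow> 'b set set \<Rightarrow> 'a set set \<Rightarrow> bool" where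
  "simplicial_covering p Y X \<longleftrightarrow>
     abstract_complex Y \<and> abstract_complex X \<and> (\<lambda>y. p ` y) ` Y = X \<and>
     (\<forall>y\<in>Y. y \<noteq> {} \<longrightarrow>
        bij_betw (\<lambda>z. p ` z) {z \<in> Y. y \<subseteq> z} {x \<in> X. p ` y \<subseteq> x})"

definition universal_covering :: "('b \<Rightarrow> 'a) \<Rightarrow> 'b set set \<Rightarrow> 'a set set \<Rightarrow> bool" where
  "universal_covering p Y X \<longleftrightarrow> simplicial_covering p Y X \<and> simply_connected (realization Y)"


section \<open>Coxeter diagrams\<close>

text \<open>The vertex set of a diagram is its type of vertices \<open>'t\<close>. Values of \<open>label\<close> outside of
  \<open>edges\<close> are irrelevant.\<close>

record 't diagram =
  edges :: "'t set set"
  label :: "'t set \<Rightarrow> enat"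

definition coxeter_diagram :: "'t::finite diagram \<Rightarrow> bool" where
  "coxeter_diagram T \<longleftrightarrow> (\<forall>e\<in>edges T. card e = 2 \<and> 3 \<le> label T e)"

definition diagram_max :: "'t::finite diagram \<Rightarrow> enat" where
  "diagram_max T = Max ({2} \<union> label T ` edges T)"

definition diagram_form :: "'t::finite diagram \<Rightarrow> real^'t^'t" where
  "diagram_form T = (\<chi> u v.
     if u = v then 1
     else if {u, v} \<in> edges T then
       (case label T {u, v} of enat k \<Rightarrow> - cos (pi / real k) | \<infinity> \<Rightarrow> - 1)
     else 0)"

definition spherical_diagram :: "'t::finite diagram \<Rightarrow> bool" where
  "spherical_diagram T \<longleftrightarrow> (\<forall>x. x \<noteq> 0 \<longrightarrow> x \<bullet> (diagram_form T *v x) > 0)"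

definition affine_diagram :: "'t::finite diagram \<Rightarrow> bool" where
  "affine_diagram T \<longleftrightarrow>
     (\<forall>x. x \<bullet> (diagram_form T *v x) \<ge> 0) \<and> rank (diagram_form T) = CARD('t) - 1"


section \<open>Coxeter complexes\<close>

definition coxeter_matrix :: "'t::finite diagram \<Rightarrow> 't \<Rightarrow> 't \<Rightarrow> enat" where
  "coxeter_matrix T s t =
     (if s = t then 1 else if {s, t} \<in> edges T then label T {s, t} else 2)"

text \<open>Equality, in the Coxeter group with generators \<open>'t\<close> and relations \<open>(s t) ^ m(s,t) = 1\<close>, of the
  elements represented by two words. Every generator is an involution, so positive words suffice.\<close>

inductive coxeter_eq :: "'t::finite diagram \<Rightarrow> 't list \<Rightarrow> 't list \<Rightarrow> bool" for T where
  refl: "coxeter_eq T u u"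
| sym: "coxeter_eq T u v \<Longrightarrow> coxeter_eq T v u"
| trans: "coxeter_eq T u v \<Longrightarrow> coxeter_eq T v w \<Longrightarrow> coxeter_eq T u w"
| rel: "coxeter_matrix T s t = enat k \<Longrightarrow>
    coxeter_eq T (u @ concat (replicate k [s, t]) @ v) (u @ v)"

text \<open>The coset \<open>w W\<^sub>J\<close> of the standard parabolic subgroup generated by \<open>J\<close>, as the set of all words
  that represent one of its elements.\<close>

definition standard_coset :: "'t::finite diagram \<Rightarrow> 't set \<Rightarrow> 't list \<Rightarrow> 't list set" where
  "standard_coset T J w = {u. \<exists>v\<in>lists J. coxeter_eq T u (w @ v)}"

text \<open>The faces of the Coxeter complex are the standard cosets, ordered by reverse inclusion. Its
  vertices are therefore the cosets of the maximal parabolics, those of label \<open>s\<close> being the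
  \<open>w W\<^bsub>S-{s}\<^esub>\<close>, and the face \<open>w W\<^bsub>S-J\<^esub>\<close> has the vertices \<open>w W\<^bsub>S-{s}\<^esub>\<close> with \<open>s \<in> J\<close>.\<close>

definition coxeter_complex :: "'t::finite diagram \<Rightarrow> 't list set set set" where
  "coxeter_complex T = {(\<lambda>s. standard_coset T (- {s}) w) ` J | w J. True}"


section \<open>Buildings\<close>

definition building :: "'t::finite diagram \<Rightarrow> 'a set set \<Rightarrow> 'a set set set \<Rightarrow> bool" where
  "building T X \<E> \<longleftrightarrow>
     coxeter_diagram T \<and> abstract_complex X \<and>
     (\<forall>A\<in>\<E>. abstract_complex A) \<and> \<Union>\<E> = X \<and>
     (\<forall>A\<in>\<E>. \<exists>f. complex_iso f A (coxeter_complex T)) \<and>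
     (\<forall>x\<in>X. \<forall>y\<in>X. \<exists>A\<in>\<E>. x \<in> A \<and> y \<in> A) \<and>
     (\<forall>A\<in>\<E>. \<forall>A'\<in>\<E>. \<forall>x\<in>A \<inter> A'. \<forall>y\<in>A \<inter> A'.
        \<exists>f. complex_iso f A A' \<and> (\<forall>v\<in>x \<union> y. f v = v))"

text \<open>The labelling \<open>\<tau>\<close> of the vertices by the vertices of the diagram: on every apartment it is the
  pullback of the canonical labelling of the Coxeter complex.\<close>

definition building_labelling :: "'t::finite diagram \<Rightarrow> 'a set set set \<Rightarrow> ('a \<Rightarrow> 't) \<Rightarrow> bool" where
  "building_labelling T \<E> \<tau> \<longleftrightarrow>
     (\<forall>A\<in>\<E>. \<exists>f. complex_iso f A (coxeter_complex T) \<and>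
        (\<forall>v\<in>\<Union>A. \<exists>w. f v = standard_coset T (- {\<tau> v}) w))"

definition thick :: "nat \<Rightarrow> 'a set set \<Rightarrow> bool" where
  "thick q X \<longleftrightarrow> (\<forall>x\<in>X. card x = dimension X \<longrightarrow>
     infinite {y \<in> faces X (dimension X). x \<subseteq> y} \<or>
     q \<le> card {y \<in> faces X (dimension X). x \<subseteq> y})"

text \<open>An action enters only through its image, a group of permutations of the vertices.\<close>

definition strongly_transitive :: "'a set set \<Rightarrow> 'a set set set \<Rightarrow> ('a \<Rightarrow> 't) \<Rightarrow> bool" where
  "strongly_transitive X \<E> \<tau> \<longleftrightarrow>
     (\<exists>G. subgroup G (BijGroup (\<Union>X)) \<and>
        (\<forall>g\<in>G. complex_iso g X X \<and> (\<forall>v\<in>\<Union>X. \<tau> (g v) = \<tau> v) \<and>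
           (\<forall>A\<in>\<E>. (\<lambda>x. g ` x) ` A \<in> \<E>)) \<and>
        (\<forall>A\<in>\<E>. \<forall>A'\<in>\<E>. \<forall>x\<in>faces A (dimension X). \<forall>x'\<in>faces A' (dimension X).
           \<exists>g\<in>G. (\<lambda>y. g ` y) ` A = A' \<and> g ` x = x'))"

definition thick_strongly_transitive_building ::
    "nat \<Rightarrow> 't::finite diagram \<Rightarrow> 'a set set \<Rightarrow> ('a \<Rightarrow> 't) \<Rightarrow> bool" where
  "thick_strongly_transitive_building q T X \<tau> \<longleftrightarrow>
     (\<exists>\<E>. building T X \<E> \<and> building_labelling T \<E> \<tau> \<and> thick q X \<and> strongly_transitive X \<E> \<tau>)"

text \<open>The two families of complexes. In the second one \<open>\<sigma>\<close> labels the vertices of the universal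
  covering \<open>Y\<close>, and \<open>\<tau>\<close> is the labelling that it induces on the vertices of \<open>X\<close>.\<close>

definition spherical_case :: "nat \<Rightarrow> 't::finite diagram \<Rightarrow> 'a set set \<Rightarrow> ('a \<Rightarrow> 't) \<Rightarrow> bool" where
  "spherical_case q T X \<tau> \<longleftrightarrow>
     thick_strongly_transitive_building q T X \<tau> \<and> spherical_diagram T"

definition labelling_descends :: "('b \<Rightarrow> 'a) \<Rightarrow> 'b set set \<Rightarrow> ('b \<Rightarrow> 't) \<Rightarrow> bool" where
  "labelling_descends p Y \<sigma> \<longleftrightarrow> (\<forall>u\<in>\<Union>Y. \<forall>v\<in>\<Union>Y. p u = p v \<longrightarrow> \<sigma> u = \<sigma> v)"

definition affine_case ::
    "nat \<Rightarrow> 't::finite diagram \<Rightarrow> 'a set set \<Rightarrow> ('a \<Rightarrow> 't) \<Rightarrow>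
     ('b \<Rightarrow> 'a) \<Rightarrow> 'b set set \<Rightarrow> ('b \<Rightarrow> 't) \<Rightarrow> bool" where
  "affine_case q T X \<tau> p Y \<sigma> \<longleftrightarrow>
     universal_covering p Y X \<and>
     thick_strongly_transitive_building q T Y \<sigma> \<and> affine_diagram T \<and> dimension Y \<ge> 2 \<and>
     labelling_descends p Y \<sigma> \<and> (\<forall>v\<in>\<Union>Y. \<tau> (p v) = \<sigma> v)"


section \<open>Weights and partite expansion\<close>

definition canonical_weight :: "'a set set \<Rightarrow> 'a set \<Rightarrow> real" where
  "canonical_weight X x =
     inverse (real ((dimension X + 1) choose card x)) *
     (real (card {y \<in> faces X (dimension X). x \<subseteq> y}) / real (card (faces X (dimension X))))"

text \<open>Real functions on the vertices are functions of the \<open>0\<close>-faces; only their values on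
  \<^term>\<open>faces X 0\<close> matter.\<close>

definition weighted_inner ::
    "'a set set \<Rightarrow> ('a set \<Rightarrow> real) \<Rightarrow> ('a set \<Rightarrow> real) \<Rightarrow> ('a set \<Rightarrow> real) \<Rightarrow> real" where
  "weighted_inner X w f g = (\<Sum>v\<in>faces X 0. w v * f v * g v)"

definition adjacency ::
    "'a set set \<Rightarrow> ('a set \<Rightarrow> real) \<Rightarrow> ('a set \<Rightarrow> real) \<Rightarrow> 'a set \<Rightarrow> real" where
  "adjacency X w f v = (\<Sum>e | e \<in> faces X 1 \<and> v \<subseteq> e. w e / (2 * w v) * f (e - v))"

definition part :: "'a set set \<Rightarrow> ('a \<Rightarrow> 't) \<Rightarrow> 't \<Rightarrow> 'a set set" where
  "part X \<tau> i = {x \<in> faces X 0. \<tau> ` x = {i}}"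

definition part_span :: "'a set set \<Rightarrow> ('a \<Rightarrow> 't::finite) \<Rightarrow> ('a set \<Rightarrow> real) set" where
  "part_span X \<tau> = range (\<lambda>c v. \<Sum>i\<in>UNIV. c i * indicator (part X \<tau> i) v)"

definition diamond_space ::
    "'a set set \<Rightarrow> ('a set \<Rightarrow> real) \<Rightarrow> ('a \<Rightarrow> 't::finite) \<Rightarrow> ('a set \<Rightarrow> real) set" where
  "diamond_space X w \<tau> = {f. \<forall>g\<in>part_span X \<tau>. weighted_inner X w f g = 0}"

definition partite_expander ::
    "'a set set \<Rightarrow> ('a set \<Rightarrow> real) \<Rightarrow> ('a \<Rightarrow> 't::finite) \<Rightarrow> real \<Rightarrow> real \<Rightarrow> bool" where
  "partite_expander X w \<tau> a b \<longleftrightarrow>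
     (\<forall>\<alpha>. (\<exists>f\<in>diamond_space X w \<tau>. (\<exists>v\<in>faces X 0. f v \<noteq> 0) \<and>
              (\<forall>v\<in>faces X 0. adjacency X w f v = \<alpha> * f v))
           \<longrightarrow> \<alpha> \<in> {a..b})"

end

theory Submission
  imports Defs "HOL-Analysis.Analysis"
begin

text \<open>The link of a face of codimension two in the building is a generalized polygon: retractions
  onto apartments fold it onto a cycle. The theorem of Feit and Higman bounds the order of a thick
  finite polygon by \<open>8\<close>, and the nontrivial eigenvalues of its adjacency operator are bounded by a
  three-term recurrence along spheres, so the link of a codimension-two face is an expander whose
  second eigenvalue is at most \<open>sqrt (m - 2) / sqrt q\<close>. A covering of \<open>X\<close> by a building is an
  isomorphism on stars of nonempty faces, so the same holds in \<open>X\<close>, and stars in \<open>X\<close> are connected;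
  Oppenheim's trickling down then carries the bound from the links to \<open>X\<close>. On chambers \<open>c\<close> it reads
  \<open>\<Sum>\<^sub>c (\<Sum>\<^sub>v f v)\<^sup>2 \<le> (1 + r\<lambda>) \<Sum>\<^sub>c \<Sum>\<^sub>v (f v)\<^sup>2\<close> for \<open>f\<close> of mean zero. Applied to the differences of
  two components of a function that has mean zero on every part, this also gives the lower bound.

  An edge with a label greater than \<open>6\<close> in an affine diagram with at least three vertices would be
  a connected component, so the radical of the form would split along it and the form would be
  degenerate on a proper subdiagram. But proper subdiagrams have finite Coxeter groups, since the
  covered complex is finite.\<close>

section \<open>Eigenvalue bounds for weighted averaging operators\<close>

text \<open>Every spectral statement is an inequality between quadratic forms on functions of mean
  zero. Such forms restrict to stars, pull back along coverings and sum over the vertices of a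
  chamber, and only the largest eigenvalue is ever needed.

  The words defining the Coxeter complex carry no normal form, so two facts about the group are
  proved first: parabolic subgroups intersect in parabolic subgroups (exchange condition, by
  counting reflections modulo 2), and \<open>s t\<close> has exactly the order prescribed by the
  diagram (geometric representation). Rigidity of the Coxeter complex then makes retractions well
  defined.

  Strong transitivity makes panels of one type lie in equally many chambers, so the polygons are
  biregular; their sphere sums then satisfy recurrences with constant coefficients. Feit-Higman
  rests on multiplicities being integers: this forces the norm of a zonal eigenfunction, hence a
  trigonometric expression in the diameter, to be rational.

  The condition \<open>r\<^sup>2 * (m - 2) \<le> q\<close> keeps every intermediate bound of the
  trickling below 1. It also gives \<open>q \<ge> 7\<close> as soon as \<open>m > 8\<close>, so the
  polygons are thick where their diameter has to be excluded.\<close>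

lemma compact_supported_box:
  fixes V :: "'v set"
  shows "compact {f :: 'v \<Rightarrow> real. \<forall>v. f v \<in> (if v \<in> V then {- c v..c v} else {0})}"
proof -
  have "compactin (product_topology (\<lambda>_. euclidean) UNIV)
      (PiE UNIV (\<lambda>v. if v \<in> V then {- c v..c v} else {0::real}))"
    unfolding compactin_PiE by (auto simp: compactin_euclidean_iff)
  then show ?thesis
    unfolding euclidean_product_topology compactin_euclidean_iff PiE_UNIV_domain Pi_def by simp
qed

text \<open>The maximum of the Rayleigh quotient on the functions of mean zero is attained, by
  compactness, and a maximizer is an eigenfunction.\<close>

lemma rayleigh_le_of_eigenvalues_le:
  fixes K :: "'v \<Rightarrow> 'v \<Rightarrow> real" and N :: "'v \<Rightarrow> real"
  assumes fin: "finite V" and N: "\<And>v. v \<in> V \<Longrightarrow> 0 < N v"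
    and sym: "\<And>u v. u \<in> V \<Longrightarrow> v \<in> V \<Longrightarrow> K u v = K v u"
    and row: "\<And>v. v \<in> V \<Longrightarrow> (\<Sum>u\<in>V. K v u) = N v"
    and eig: "\<And>f \<alpha>. \<lbrakk>\<exists>v\<in>V. f v \<noteq> 0; (\<Sum>v\<in>V. N v * f v) = 0;
        \<And>v. v \<in> V \<Longrightarrow> (\<Sum>u\<in>V. K v u * f u) = \<alpha> * N v * f v\<rbrakk> \<Longrightarrow> \<alpha> \<le> M"
    and f: "(\<Sum>v\<in>V. N v * f v) = 0"
  shows "(\<Sum>v\<in>V. \<Sum>u\<in>V. K v u * f v * f u) \<le> M * (\<Sum>v\<in>V. N v * (f v)\<^sup>2)"
proof (cases "\<exists>v\<in>V. f v \<noteq> 0")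
  case False
  then show ?thesis by simp
next
  case True
  define Q where "Q g h = (\<Sum>v\<in>V. \<Sum>u\<in>V. K v u * g v * h u)" for g h
  define R where "R g h = (\<Sum>v\<in>V. N v * g v * h v)" for g h
  define mean where "mean g = (\<Sum>v\<in>V. N v * g v)" for g
  have R_nonneg: "0 \<le> R g g" for g
    unfolding R_def using N by (intro sum_nonneg) (simp add: less_imp_le mult.assoc)
  have R_pos: "0 < R g g" if ex: "\<exists>v\<in>V. g v \<noteq> 0" for g
  proof -
    obtain v where v: "v \<in> V" "g v \<noteq> 0" using ex by blast
    have "0 < N v * (g v)\<^sup>2" using N[OF v(1)] v(2) by simp
    then have "0 < N v * g v * g v" by (simp add: power2_eq_square mult.assoc)
    also have "\<dots> \<le> R g g" unfolding R_def
      using N by (intro member_le_sum[OF v(1)] fin) (simp add: less_imp_le mult.assoc)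
    finally show ?thesis .
  qed
  have Q_sym: "Q g h = Q h g" for g h
    unfolding Q_def by (subst sum.swap) (intro sum.cong HOL.refl, use sym in simp)
  have Q_add: "Q (\<lambda>v. g v + t * h v) (\<lambda>v. g v + t * h v) = Q g g + 2 * t * Q g h + t\<^sup>2 * Q h h" for g h t
  proof -
    have "Q (\<lambda>v. g v + t * h v) (\<lambda>v. g v + t * h v) = Q g g + t * Q g h + t * Q h g + t\<^sup>2 * Q h h"
      unfolding Q_def sum_distrib_left sum.distrib[symmetric]
      by (intro sum.cong HOL.refl) (simp add: algebra_simps power2_eq_square)
    then show ?thesis using Q_sym[of h g] by simp
  qed
  have R_add: "R (\<lambda>v. g v + t * h v) (\<lambda>v. g v + t * h v) = R g g + 2 * t * R g h + t\<^sup>2 * R h h" for g h t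
    unfolding R_def sum_distrib_left sum.distrib[symmetric]
    by (intro sum.cong HOL.refl) (simp add: algebra_simps power2_eq_square)
  \<comment> \<open>Topologically these are functions on the whole type; vanishing off
    \<open>V\<close> places the unit sphere in a compact product box.\<close>
  define S where "S = {g. (\<forall>v. v \<notin> V \<longrightarrow> g v = 0) \<and> mean g = 0 \<and> R g g = 1}"
  have norm: "\<exists>s\<in>S. (\<forall>v\<in>V. g v = sqrt (R g g) * s v)" if g: "\<exists>v\<in>V. g v \<noteq> 0" "mean g = 0" for g
  proof -
    have pos: "0 < R g g" using R_pos g(1) by blast
    define s where "s v = (if v \<in> V then g v / sqrt (R g g) else 0)" for v
    have "mean s = mean g / sqrt (R g g)" unfolding mean_def s_def by (simp add: sum_divide_distrib)
    moreover have "R s s = R g g / (sqrt (R g g))\<^sup>2"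
      unfolding R_def[of s] R_def[of g] s_def by (simp add: sum_divide_distrib power2_eq_square del: real_sqrt_mult_self)
    ultimately have "s \<in> S" using g pos by (auto simp: S_def s_def)
    then show ?thesis using pos by (intro bexI[of _ s]) (auto simp: s_def)
  qed
  have Qscale: "Q g g = c\<^sup>2 * Q s s" "R g g = c\<^sup>2 * R s s" if "\<forall>v\<in>V. g v = c * s v" for g s c
    using that unfolding Q_def R_def
    by (auto simp: sum_distrib_left power2_eq_square mult_ac intro!: sum.cong)
  have cont: "continuous_on UNIV (\<lambda>g :: 'v \<Rightarrow> real. Q g g)" "continuous_on UNIV (\<lambda>g :: 'v \<Rightarrow> real. R g g)"
    "continuous_on UNIV (\<lambda>g :: 'v \<Rightarrow> real. mean g)"
    unfolding Q_def R_def mean_def by (intro continuous_intros continuous_on_product_coordinates)+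
  have "compact S"
  proof -
    define B where "B = {g :: 'v \<Rightarrow> real. \<forall>v. g v \<in> (if v \<in> V then {- sqrt (1 / N v)..sqrt (1 / N v)} else {0})}"
    have "S = B \<inter> ({g. mean g = 0} \<inter> {g. R g g = 1})"
    proof (intro Set.set_eqI iffI)
      fix g assume g: "g \<in> S"
      have "\<bar>g v\<bar> \<le> sqrt (1 / N v)" if v: "v \<in> V" for v
      proof -
        have "N v * g v * g v \<le> R g g" unfolding R_def
          using N by (intro member_le_sum[OF v] fin) (simp add: less_imp_le mult.assoc)
        then have "(g v)\<^sup>2 \<le> 1 / N v" using g N[OF v] by (simp add: S_def field_simps power2_eq_square)
        then show ?thesis using real_le_rsqrt[of "\<bar>g v\<bar>"] by simp
      qed
      then have "g \<in> B" using g by (auto simp: B_def S_def abs_le_iff minus_le_iff)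
      then show "g \<in> B \<inter> ({g. mean g = 0} \<inter> {g. R g g = 1})" using g by (simp add: S_def)
    next
      fix g assume "g \<in> B \<inter> ({g. mean g = 0} \<inter> {g. R g g = 1})"
      then have "g \<in> B" "mean g = 0" "R g g = 1" by auto
      moreover from this(1) have "g v = 0" if "v \<notin> V" for v using that unfolding B_def by (auto dest: spec[of _ v])
      ultimately show "g \<in> S" by (simp add: S_def)
    qed
    moreover have "closed {g. mean g = 0}" "closed {g. R g g = 1}"
      by (rule closed_Collect_eq[OF cont(3) continuous_on_const],
          rule closed_Collect_eq[OF cont(2) continuous_on_const])
    ultimately show ?thesis
      using compact_supported_box[of V "\<lambda>v. sqrt (1 / N v)"] unfolding B_def
      by (simp add: compact_Int_closed closed_Int)
  qed
  moreover have "S \<noteq> {}" using norm[of f] True f by (auto simp: mean_def)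
  ultimately obtain f0 where f0: "f0 \<in> S" "\<And>g. g \<in> S \<Longrightarrow> Q g g \<le> Q f0 f0"
    using continuous_attains_sup[of S "\<lambda>g. Q g g"] continuous_on_subset[OF cont(1)] by auto
  define \<mu> where "\<mu> = Q f0 f0"
  have f0': "mean f0 = 0" "R f0 f0 = 1" using f0(1) by (auto simp: S_def)
  have max: "Q g g \<le> \<mu> * R g g" if mean0: "mean g = 0" for g
  proof (cases "\<exists>v\<in>V. g v \<noteq> 0")
    case True
    then obtain s where s: "s \<in> S" "\<forall>v\<in>V. g v = sqrt (R g g) * s v" using norm[OF _ mean0] by blast
    have "Q g g = R g g * Q s s" using Qscale(1)[OF s(2)] R_nonneg[of g] by simp
    then show ?thesis using mult_left_mono[OF f0(2)[OF s(1)] R_nonneg[of g]] by (simp add: \<mu>_def mult.commute)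
  qed (simp add: Q_def R_def)
  \<comment> \<open>First variation: \<open>f0 + t h\<close> keeps mean zero, so maximality at
    \<open>t = 0\<close> kills the term linear in \<open>t\<close>.\<close>
  have var: "Q f0 h = \<mu> * R f0 h" if h: "mean h = 0" for h
  proof -
    have le: "2 * t * (Q f0 h - \<mu> * R f0 h) + t\<^sup>2 * (Q h h - \<mu> * R h h) \<le> 0" for t
    proof -
      have "mean (\<lambda>v. f0 v + t * h v) = mean f0 + t * mean h"
        unfolding mean_def by (simp add: sum.distrib sum_distrib_left algebra_simps)
      then have "Q (\<lambda>v. f0 v + t * h v) (\<lambda>v. f0 v + t * h v) \<le> \<mu> * R (\<lambda>v. f0 v + t * h v) (\<lambda>v. f0 v + t * h v)"
        using max[of "\<lambda>v. f0 v + t * h v"] h f0'(1) by simp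
      then show ?thesis unfolding Q_add R_add f0'(2) by (simp add: \<mu>_def algebra_simps)
    qed
    define x y where "x = Q f0 h - \<mu> * R f0 h" and "y = \<mu> * R h h - Q h h"
    \<comment> \<open>The choice \<open>t = x / (y + 1)\<close> turns the quadratic in
      \<open>t\<close> into a positive multiple of the square of \<open>x\<close>; the summand 1
      covers \<open>y = 0\<close>.\<close>
    have "0 \<le> y" using max[OF h] by (simp add: y_def)
    moreover have "2 * (x / (y + 1)) * x - (x / (y + 1))\<^sup>2 * y \<le> 0" using le[of "x / (y + 1)"] by (simp add: x_def y_def algebra_simps)
    moreover have "2 * (x / (y + 1)) * x - (x / (y + 1))\<^sup>2 * y = x\<^sup>2 * (y + 2) / (y + 1)\<^sup>2"
      using \<open>0 \<le> y\<close> by (simp add: divide_simps power2_eq_square) (simp add: algebra_simps)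
    ultimately have "x\<^sup>2 * (y + 2) / (y + 1)\<^sup>2 \<le> 0" by linarith
    then have "x = 0" using \<open>0 \<le> y\<close> by (auto simp: divide_le_0_iff mult_le_0_iff)
    then show ?thesis by (simp add: x_def)
  qed
  define e where "e v = (\<Sum>u\<in>V. K v u * f0 u) - \<mu> * N v * f0 v" for v
  have Qe: "Q f0 h - \<mu> * R f0 h = (\<Sum>v\<in>V. e v * h v)" for h
  proof -
    have "Q f0 h = (\<Sum>v\<in>V. (\<Sum>u\<in>V. K v u * f0 u) * h v)"
      using Q_sym[of f0 h] by (simp add: Q_def sum_distrib_right sum_distrib_left mult_ac)
    moreover have "(\<Sum>v\<in>V. e v * h v) = (\<Sum>v\<in>V. (\<Sum>u\<in>V. K v u * f0 u) * h v) - \<mu> * R f0 h"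
      unfolding e_def R_def left_diff_distrib sum_subtractf sum_distrib_left by (simp add: mult.assoc)
    ultimately show ?thesis by simp
  qed
  \<comment> \<open>The row sums of \<open>K\<close> are \<open>N\<close>, so the residual
    \<open>e\<close> sums to zero. Hence \<open>e / N\<close> has mean zero and is an admissible
    test function, and testing the variation with it gives a vanishing sum of squares.\<close>
  have "(\<Sum>v\<in>V. \<Sum>u\<in>V. K v u * f0 u) = (\<Sum>u\<in>V. (\<Sum>v\<in>V. K u v) * f0 u)"
    by (subst sum.swap) (simp add: sum_distrib_right sym cong: sum.cong)
  also have "\<dots> = mean f0" using row by (simp add: mean_def)
  finally have "(\<Sum>v\<in>V. e v) = 0"
    using f0'(1) by (simp add: e_def sum_subtractf mean_def sum_distrib_left[symmetric] mult.assoc)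
  then have "mean (\<lambda>v. e v / N v) = 0" unfolding mean_def using N by (simp add: less_imp_neq[THEN not_sym] cong: sum.cong)
  from var[OF this] have "(\<Sum>v\<in>V. e v * (e v / N v)) = 0" using Qe[of "\<lambda>v. e v / N v"] by simp
  moreover have "0 \<le> e v * (e v / N v)" if "v \<in> V" for v using N[OF that] by simp
  ultimately have e0: "\<forall>v\<in>V. e v * (e v / N v) = 0"
    using sum_nonneg_eq_0_iff[OF fin, of "\<lambda>v. e v * (e v / N v)"] by simp
  have "\<forall>v\<in>V. e v = 0"
  proof
    fix v assume v: "v \<in> V"
    then have "e v * (e v / N v) = 0" using e0 by blast
    then show "e v = 0" using N[OF v] by simp
  qed
  then have "\<And>v. v \<in> V \<Longrightarrow> (\<Sum>u\<in>V. K v u * f0 u) = \<mu> * N v * f0 v" by (simp add: e_def)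
  moreover have "\<exists>v\<in>V. f0 v \<noteq> 0" using f0'(2) by (auto simp: R_def intro: ccontr)
  ultimately have "\<mu> \<le> M" using eig[of f0 \<mu>] f0'(1) by (simp add: mean_def)
  moreover have "Q f f \<le> \<mu> * R f f" using max f by (simp add: mean_def)
  ultimately have "Q f f \<le> M * R f f" using R_nonneg[of f] by (meson mult_right_mono order_trans)
  then show ?thesis by (simp add: Q_def R_def power2_eq_square mult.assoc)
qed

section \<open>Generalized polygons\<close>

text \<open>A generalized \<open>n\<close>-gon in terms of distances: bipartite, of diameter at most
  \<open>n\<close>, with a unique way back along geodesics shorter than \<open>n\<close>. The two
  colours are points and lines, with degrees \<open>a\<close> and \<open>b\<close>.\<close>

locale gen_polygon =
  fixes V :: "'v set" and adj :: "'v \<Rightarrow> 'v \<Rightarrow> bool" and col :: "'v \<Rightarrow> bool"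
    and n :: nat and d :: "'v \<Rightarrow> 'v \<Rightarrow> nat" and a b :: nat
  assumes fin: "finite V" and n2: "2 \<le> n" and pos: "1 \<le> a" "1 \<le> b"
    and adj_V: "adj u v \<Longrightarrow> u \<in> V" and adj_sym: "adj u v \<Longrightarrow> adj v u"
    and adj_col: "adj u v \<Longrightarrow> col u \<noteq> col v"
    and d_le: "\<lbrakk>u \<in> V; v \<in> V\<rbrakk> \<Longrightarrow> d u v \<le> n"
    and d_0: "\<lbrakk>u \<in> V; v \<in> V\<rbrakk> \<Longrightarrow> d u v = 0 \<longleftrightarrow> u = v"
    and d_sym: "\<lbrakk>u \<in> V; v \<in> V\<rbrakk> \<Longrightarrow> d u v = d v u"
    and d_step: "\<lbrakk>u \<in> V; adj v w\<rbrakk> \<Longrightarrow> d u w = Suc (d u v) \<or> d u v = Suc (d u w)"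
    and d_down: "\<lbrakk>u \<in> V; v \<in> V; 0 < d u v; d u v < n\<rbrakk> \<Longrightarrow> \<exists>!w. adj v w \<and> d u v = Suc (d u w)"
    and d_even: "\<lbrakk>u \<in> V; v \<in> V\<rbrakk> \<Longrightarrow> even (d u v) \<longleftrightarrow> col u = col v"
    and deg: "u \<in> V \<Longrightarrow> card {v. adj u v} = (if col u then a else b)"

text \<open>Graph distance on the cycle of length \<open>2 n\<close>, for representatives below
  \<open>2 n\<close>.\<close>

definition cdist :: "nat \<Rightarrow> nat \<Rightarrow> nat \<Rightarrow> nat" where
  "cdist n x y = min (if x \<le> y then y - x else x - y) (2 * n - (if x \<le> y then y - x else x - y))"

text \<open>Combinatorial shadow of the retraction centred at the chamber \<open>u0 u1\<close>: a
  homomorphism to the \<open>2 n\<close>-cycle, with that edge as its only preimage of the edge from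
  0 to 1. The walk \<open>\<gamma>\<close> is an apartment through \<open>v\<close>, a section of
  the folding.\<close>

definition folding_map ::
    "'v set \<Rightarrow> ('v \<Rightarrow> 'v \<Rightarrow> bool) \<Rightarrow> nat \<Rightarrow> 'v \<Rightarrow> 'v \<Rightarrow> ('v \<Rightarrow> nat) \<Rightarrow> bool" where
  "folding_map V adj n u0 u1 r \<longleftrightarrow> r u0 = 0 \<and> r u1 = 1 \<and> (\<forall>v\<in>V. r v < 2 * n) \<and>
      (\<forall>v w. adj v w \<longrightarrow> r w = Suc (r v) mod (2 * n) \<or> r v = Suc (r w) mod (2 * n)) \<and>
      (\<forall>w w'. adj w w' \<longrightarrow> r w = 0 \<longrightarrow> r w' = 1 \<longrightarrow> w = u0 \<and> w' = u1) \<and>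
      (\<forall>v\<in>V. \<exists>\<gamma>. (\<forall>k. adj (\<gamma> k) (\<gamma> (Suc k)) \<and> r (\<gamma> k) = k mod (2 * n)) \<and> \<gamma> (r v) = v)"

locale folded_graph =
  fixes V :: "'v set" and adj :: "'v \<Rightarrow> 'v \<Rightarrow> bool" and col :: "'v \<Rightarrow> bool" and n :: nat
  assumes fin: "finite V" and n2: "2 \<le> n"
    and adj_V: "adj u v \<Longrightarrow> u \<in> V" and adj_sym: "adj u v \<Longrightarrow> adj v u"
    and adj_col: "adj u v \<Longrightarrow> col u \<noteq> col v"
    and nbr: "u \<in> V \<Longrightarrow> \<exists>v. adj u v"
    and folding: "adj u0 u1 \<Longrightarrow> \<exists>r. folding_map V adj n u0 u1 r"
begin

definition dist_adj :: "'v \<Rightarrow> 'v \<Rightarrow> nat" where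
  "dist_adj u v = (LEAST k. (adj ^^ k) u v)"

lemma adj_V': "adj u v \<Longrightarrow> v \<in> V" using adj_V adj_sym by blast

lemma cdist_step:
  assumes "x < 2 * n" "y < 2 * n" "z < 2 * n" "z = Suc y mod (2 * n) \<or> y = Suc z mod (2 * n)"
  shows "cdist n x z \<le> Suc (cdist n x y)"
proof -
  have min1: "min a b \<le> Suc (min c e)" if "a \<le> Suc c" "b \<le> Suc e" for a b c e :: nat
    using that by linarith
  have min2: "min a b \<le> Suc (min c e)" if "a \<le> Suc e" "b \<le> Suc c" for a b c e :: nat
    using that by linarith
  consider "z = Suc y" | "z = 0" "Suc y = 2 * n" | "y = Suc z" | "y = 0" "Suc z = 2 * n"
    using assms by (auto simp: mod_Suc split: if_splits)
  then show ?thesis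
  proof cases
    case 1
    then show ?thesis unfolding cdist_def by (intro min1) auto
  next
    case 2
    then show ?thesis using assms(1) unfolding cdist_def by (intro min2) auto
  next
    case 3
    then show ?thesis unfolding cdist_def by (intro min1) auto
  next
    case 4
    then show ?thesis using assms(1) unfolding cdist_def by (intro min2) auto
  qed
qed

lemma walk_cdist:
  assumes r: "\<forall>v\<in>V. r v < 2 * n"
    "\<forall>v w. adj v w \<longrightarrow> r w = Suc (r v) mod (2 * n) \<or> r v = Suc (r w) mod (2 * n)"
    and p: "p \<in> V"
  shows "(adj ^^ k) p q \<Longrightarrow> cdist n (r p) (r q) \<le> k"
proof (induction k arbitrary: q)
  case 0
  then show ?case by (simp add: cdist_def)
next
  case (Suc k)
  then obtain y where y: "(adj ^^ k) p y" "adj y q" by auto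
  have "cdist n (r p) (r q) \<le> Suc (cdist n (r p) (r y))"
    using r p y(2) adj_V adj_V' by (intro cdist_step) blast+
  then show ?case using Suc.IH[OF y(1)] by simp
qed

lemma path_walk: "(\<And>k. adj (\<gamma> k) (\<gamma> (Suc k))) \<Longrightarrow> (adj ^^ k) (\<gamma> i) (\<gamma> (i + k))"
  by (induction k) auto

lemma walk_sym: "(adj ^^ k) u v \<Longrightarrow> (adj ^^ k) v u"
proof (induction k arbitrary: v)
  case (Suc k)
  then obtain y where y: "(adj ^^ k) u y" "adj y v" by auto
  then have "(adj OO adj ^^ k) v u" using Suc.IH adj_sym by blast
  then show ?case by (simp add: relpowp_commute)
qed simp

text \<open>An apartment walk through \<open>v\<close> meets \<open>u\<close> at times 0 and
  \<open>2 n\<close> and \<open>v\<close> at time \<open>r v\<close>; one of the two arcs has length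
  at most \<open>n\<close>.\<close>

lemma walk_exists:
  assumes u: "u \<in> V" and v: "v \<in> V"
  shows "\<exists>k\<le>n. (adj ^^ k) u v"
proof -
  obtain u1 where u1: "adj u u1" using nbr[OF u] by blast
  obtain r where "folding_map V adj n u u1 r" using folding[OF u1] by blast
  then have r: "\<forall>v\<in>V. r v < 2 * n"
      "\<forall>w w'. adj w w' \<longrightarrow> r w = 0 \<longrightarrow> r w' = 1 \<longrightarrow> w = u \<and> w' = u1"
      "\<forall>v\<in>V. \<exists>\<gamma>. (\<forall>k. adj (\<gamma> k) (\<gamma> (Suc k)) \<and> r (\<gamma> k) = k mod (2 * n)) \<and> \<gamma> (r v) = v"
    unfolding folding_map_def by simp_all
  from r(3) v obtain \<gamma> where \<gamma>: "\<And>k. adj (\<gamma> k) (\<gamma> (Suc k))" "\<And>k. r (\<gamma> k) = k mod (2 * n)" "\<gamma> (r v) = v"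
    by metis
  have g0: "\<gamma> 0 = u" using r(2) \<gamma>(1)[of 0] \<gamma>(2)[of 0] \<gamma>(2)[of 1] n2 by auto
  \<comment> \<open>That the walk closes up follows from uniqueness of the base edge: its step from
    \<open>2 n\<close> to \<open>2 n + 1\<close> lies over the edge from 0 to 1.\<close>
  have g1: "\<gamma> (2 * n) = u" using r(2) \<gamma>(1)[of "2 * n"] \<gamma>(2)[of "2 * n"] \<gamma>(2)[of "Suc (2 * n)"] n2
    by (auto simp: mod_Suc)
  have "(adj ^^ r v) u v" using path_walk[of \<gamma> "r v" 0, OF \<gamma>(1)] \<gamma>(3) g0 by simp
  moreover have "(adj ^^ (2 * n - r v)) v u"
    using path_walk[of \<gamma> "2 * n - r v" "r v", OF \<gamma>(1)] \<gamma>(3) g1 r(1) v by (simp add: less_imp_le)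
  then have "(adj ^^ (2 * n - r v)) u v" by (rule walk_sym)
  moreover have "r v \<le> n \<or> 2 * n - r v \<le> n" by arith
  ultimately show ?thesis by blast
qed

lemma dist_walk: "u \<in> V \<Longrightarrow> v \<in> V \<Longrightarrow> (adj ^^ dist_adj u v) u v"
  unfolding dist_adj_def using walk_exists by (metis LeastI)

lemma dist_le_walk: "(adj ^^ k) u v \<Longrightarrow> dist_adj u v \<le> k"
  unfolding dist_adj_def by (rule Least_le)

lemma dist_le_n: "u \<in> V \<Longrightarrow> v \<in> V \<Longrightarrow> dist_adj u v \<le> n"
  using walk_exists dist_le_walk order_trans by blast

lemma dist_sym: "u \<in> V \<Longrightarrow> v \<in> V \<Longrightarrow> dist_adj u v = dist_adj v u"
  using dist_le_walk[OF walk_sym[OF dist_walk[of u v]]] dist_le_walk[OF walk_sym[OF dist_walk[of v u]]]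
  by (intro antisym)

lemma dist_0: "u \<in> V \<Longrightarrow> v \<in> V \<Longrightarrow> dist_adj u v = 0 \<longleftrightarrow> u = v"
  using dist_walk[of u v] dist_le_walk[of 0 u v] by auto

lemma walk_parity: "(adj ^^ k) u v \<Longrightarrow> even k \<longleftrightarrow> col u = col v"
  by (induction k arbitrary: v) (auto dest: adj_col)

lemma dist_parity: "u \<in> V \<Longrightarrow> v \<in> V \<Longrightarrow> even (dist_adj u v) \<longleftrightarrow> col u = col v"
  using walk_parity[OF dist_walk] .

lemma dist_step:
  assumes "u \<in> V" "adj v w"
  shows "dist_adj u w = Suc (dist_adj u v) \<or> dist_adj u v = Suc (dist_adj u w)"
proof -
  have V: "v \<in> V" "w \<in> V" by (rule adj_V[OF assms(2)], rule adj_V'[OF assms(2)])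
  have "(adj ^^ Suc (dist_adj u v)) u w" "(adj ^^ Suc (dist_adj u w)) u v"
    using dist_walk[OF assms(1) V(1)] dist_walk[OF assms(1) V(2)] assms(2) adj_sym[OF assms(2)] by auto
  then have "dist_adj u w \<le> Suc (dist_adj u v)" "dist_adj u v \<le> Suc (dist_adj u w)"
    using dist_le_walk by blast+
  moreover have "even (dist_adj u v) \<longleftrightarrow> odd (dist_adj u w)"
    using dist_parity[OF assms(1)] V adj_col[OF assms(2)] by auto
  ultimately show ?thesis by (metis le_SucE le_antisym even_Suc)
qed

text \<open>Two geodesics from \<open>v\<close> to \<open>u\<close> of length less than \<open>n\<close> fold onto the same arc of the cycle, so
  their first edges both lie over the edge at which the folding is injective.\<close>

lemma dist_down:
  assumes u: "u \<in> V" and v: "v \<in> V" and k: "0 < dist_adj u v" "dist_adj u v < n"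
  shows "\<exists>!w. adj v w \<and> dist_adj u v = Suc (dist_adj u w)"
proof -
  define k where "k = dist_adj u v"
  have "(adj ^^ Suc (k - 1)) u v" using dist_walk[OF u v] k(1) by (simp add: k_def)
  then obtain w where w: "(adj ^^ (k - 1)) u w" "adj w v" by auto
  have wV: "w \<in> V" using w(2) adj_V by blast
  have w': "adj v w" using w(2) adj_sym by blast
  have dw: "dist_adj u v = Suc (dist_adj u w)"
    using dist_step[OF u w'] dist_le_walk[OF w(1)] k by (auto simp: k_def)
  have "w2 = w" if w2: "adj v w2" "dist_adj u v = Suc (dist_adj u w2)" for w2
  proof -
    obtain r where "folding_map V adj n v w r" using folding[OF w'] by blast
    then have r0: "r v = 0" "r w = 1" and r1: "\<forall>v\<in>V. r v < 2 * n"
      and r2: "\<forall>v w. adj v w \<longrightarrow> r w = Suc (r v) mod (2 * n) \<or> r v = Suc (r w) mod (2 * n)"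
      and r3: "\<forall>x x'. adj x x' \<longrightarrow> r x = 0 \<longrightarrow> r x' = 1 \<longrightarrow> x = v \<and> x' = w"
      and r4: "\<forall>v\<in>V. \<exists>\<gamma>. (\<forall>k. adj (\<gamma> k) (\<gamma> (Suc k)) \<and> r (\<gamma> k) = k mod (2 * n)) \<and> \<gamma> (r v) = v"
      unfolding folding_map_def by simp_all
    have w2V: "w2 \<in> V" using w2(1) adj_V' by blast
    have ru: "r u < 2 * n" using r1 u by blast
    obtain \<gamma> where \<gamma>: "\<And>k. adj (\<gamma> k) (\<gamma> (Suc k))" "\<And>k. r (\<gamma> k) = k mod (2 * n)" "\<gamma> (r u) = u"
      using r4 u by metis
    have g0: "\<gamma> 0 = v" using r3 \<gamma>(1)[of 0] \<gamma>(2)[of 0] \<gamma>(2)[of 1] n2 by auto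
    have g1: "\<gamma> (2 * n) = v" using r3 \<gamma>(1)[of "2 * n"] \<gamma>(2)[of "2 * n"] \<gamma>(2)[of "Suc (2 * n)"] n2
      by (auto simp: mod_Suc)
    have "(adj ^^ r u) v u" using path_walk[of \<gamma> "r u" 0, OF \<gamma>(1)] \<gamma>(3) g0 by simp
    then have "(adj ^^ r u) u v" by (rule walk_sym)
    moreover have "(adj ^^ (2 * n - r u)) u v"
      using path_walk[of \<gamma> "2 * n - r u" "r u", OF \<gamma>(1)] \<gamma>(3) g1 ru by (simp add: less_imp_le)
    ultimately have 1: "k \<le> r u" "k \<le> 2 * n - r u" using dist_le_walk unfolding k_def by blast+
    have cd: "cdist n (r u) (r y) \<le> dist_adj u y" if "y \<in> V" for y
      by (rule walk_cdist[OF r1 r2 u dist_walk[OF u that]])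
    have 3: "cdist n (r u) 1 \<le> k - 1" using cd[OF wV] r0 dw by (simp add: k_def)
    have 4: "cdist n (r u) (r w2) \<le> k - 1" using cd[OF w2V] w2(2) by (simp add: k_def)
    have 5: "r w2 = 1 \<or> r w2 = 2 * n - 1" using r2[rule_format, OF w2(1)] r0(1) r1 w2V n2
      by (auto simp: mod_Suc split: if_splits)
    have kn: "0 < k" "k < n" using k by (auto simp: k_def)
    \<comment> \<open>The neighbour \<open>w\<close> lies over 1 at distance \<open>k - 1\<close>
      from \<open>u\<close>, while both arcs from 0 to \<open>r u\<close> have length at least
      \<open>k\<close>; this leaves \<open>r u = k\<close>.\<close>
    have "min (r u - 1) (2 * n - (r u - 1)) \<le> k - 1"
      using 3 1(1) kn(1) by (auto simp: cdist_def split: if_splits)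
    then have "r u - 1 \<le> k - 1 \<or> 2 * n - (r u - 1) \<le> k - 1" by (simp only: min_le_iff_disj)
    then have "r u = k" using 1 kn by linarith
    \<comment> \<open>The other cycle neighbour of 0 is separated from position \<open>k\<close> by
      arcs of lengths \<open>k + 1\<close> and \<open>2 n - 1 - k\<close>, both more than
      \<open>k - 1\<close> because \<open>k < n\<close>.\<close>
    have "r w2 \<noteq> 2 * n - 1"
    proof
      assume "r w2 = 2 * n - 1"
      moreover have "k \<le> 2 * n - 1" "2 * n - (2 * n - 1 - k) = Suc k" using kn by arith+
      ultimately have "min (2 * n - 1 - k) (Suc k) \<le> k - 1"
        using 4 \<open>r u = k\<close> by (simp add: cdist_def)
      then have "2 * n - 1 - k \<le> k - 1 \<or> Suc k \<le> k - 1" by (simp only: min_le_iff_disj)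
      then show False using kn by linarith
    qed
    then have "r w2 = 1" using 5 by simp
    then show "w2 = w" using r3 w2(1) r0(1) by blast
  qed
  then show ?thesis using w' dw by blast
qed

lemma gen_polygon:
  assumes "1 \<le> a" "1 \<le> b" "\<And>u. u \<in> V \<Longrightarrow> card {v. adj u v} = (if col u then a else b)"
  shows "gen_polygon V adj col n dist_adj a b"
  by unfold_locales
    (fact assms fin n2 adj_V adj_sym adj_col dist_le_n dist_0 dist_sym dist_step dist_down dist_parity)+

end

section \<open>The spectral gap of a generalized polygon\<close>

text \<open>The invariant is that consecutive values have ratio at least \<open>sqrt (c k)\<close>,
  where \<open>c\<close> alternates between \<open>s\<close> and \<open>t\<close>. It propagates
  because \<open>\<theta>\<close> exceeds the sum of two consecutive such roots.\<close>

lemma three_term_positive: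
  fixes e :: "nat \<Rightarrow> real"
  assumes st: "0 \<le> s" "0 \<le> t" and \<theta>: "\<theta> > sqrt s + sqrt t"
    and e0: "e 0 > 0" "e 1 = \<theta> * e 0"
    and rec: "\<And>k. Suc (Suc k) \<le> m \<Longrightarrow> e (Suc (Suc k)) = \<theta> * e (Suc k) - (if even k then s else t) * e k"
  shows "Suc k \<le> m \<Longrightarrow> e (Suc k) > 0"
proof -
  define c where "c k = (if even k then s else t)" for k :: nat
  have c0: "0 \<le> sqrt (c k)" "sqrt (c k) * sqrt (c k) = c k" for k using st by (simp_all add: c_def)
  have c\<theta>: "sqrt (c k) + sqrt (c (Suc k)) < \<theta>" for k using \<theta> by (auto simp: c_def)
  have "e k > 0 \<and> e (Suc k) \<ge> sqrt (c k) * e k \<and> e (Suc k) > 0" if "Suc k \<le> m" for k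
    using that
  proof (induction k)
    case 0
    have "sqrt (c 0) \<le> \<theta>" "0 < \<theta>" using c\<theta>[of 0] c0(1)[of 0] c0(1)[of "Suc 0"] by linarith+
    then show ?case using e0 by (simp add: mult_right_mono)
  next
    case (Suc k)
    then have IH: "e k > 0" "sqrt (c k) * e k \<le> e (Suc k)" "e (Suc k) > 0" by auto
    have "e (Suc (Suc k)) = \<theta> * e (Suc k) - c k * e k" using rec[of k] Suc.prems by (simp add: c_def)
    moreover have "c k * e k \<le> sqrt (c k) * e (Suc k)"
      using mult_left_mono[OF IH(2) c0(1)[of k]] c0(2)[of k] by (simp add: mult.assoc[symmetric])
    ultimately have *: "(\<theta> - sqrt (c k)) * e (Suc k) \<le> e (Suc (Suc k))" by (simp add: algebra_simps)
    have "sqrt (c (Suc k)) * e (Suc k) < (\<theta> - sqrt (c k)) * e (Suc k)"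
      using c\<theta>[of k] IH(3) by (intro mult_strict_right_mono) auto
    moreover have "0 \<le> sqrt (c (Suc k)) * e (Suc k)" using c0(1) IH(3) by simp
    ultimately show ?case using * IH(3) by linarith
  qed
  then show "Suc k \<le> m \<Longrightarrow> e (Suc k) > 0" by blast
qed

text \<open>The largest root of the orthogonal polynomial of the polygon: explicit for \<open>n \<le> 5\<close>, and at most
  \<open>\<surd>s + \<surd>t\<close> in general, which suffices for \<open>n \<ge> 6\<close>.\<close>

lemma three_term_root_bound:
  fixes e :: "nat \<Rightarrow> real" and q :: real
  assumes st: "0 \<le> s" "0 \<le> t" and \<theta>: "\<theta> > 0" and e0: "e 0 \<noteq> 0" "e 1 = \<theta> * e 0"
    and n: "2 \<le> n"
    and rec: "\<And>k. Suc (Suc k) \<le> n - 1 \<Longrightarrow> e (Suc (Suc k)) = \<theta> * e (Suc k) - (if even k then s else t) * e k"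
    and zero: "e (n - 1) = 0"
    and q: "s + 1 \<le> Q" "t + 1 \<le> Q"
  shows "\<theta>\<^sup>2 \<le> (real n - 2) * Q"
proof -
  define y where "y = \<theta>\<^sup>2"
  have y: "y > 0" using \<theta> by (simp add: y_def)
  have "n \<noteq> 2" using zero e0 \<theta> by auto
  have yy: "\<theta> * \<theta> = y" by (simp add: y_def power2_eq_square)
  have e2: "e 2 = (y - s) * e 0" if "n \<ge> 3"
  proof -
    have "e 2 = \<theta> * (\<theta> * e 0) - s * e 0" using rec[of 0] e0(2) that by (simp add: numeral_2_eq_2)
    then show ?thesis by (simp add: mult.assoc[symmetric] yy left_diff_distrib)
  qed
  have e3: "e 3 = \<theta> * ((y - s - t) * e 0)" if "n \<ge> 4"
  proof -
    have "e 3 = \<theta> * e 2 - t * e 1" using rec[of 1] that by (simp add: numeral_2_eq_2 numeral_3_eq_3)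
    then show ?thesis using e2 that e0(2) by (simp add: algebra_simps)
  qed
  from \<open>n \<noteq> 2\<close> consider "n = 3" | "n = 4" | "n = 5" | "n \<ge> 6" using n by linarith
  then have "y \<le> (real n - 2) * Q"
  proof cases
    case 1
    then have "y = s" using e2 zero e0(1) by simp
    then show ?thesis using q(1) 1 by simp
  next
    case 2
    then have "y = s + t" using e3 zero e0(1) \<theta> by simp
    then show ?thesis using q 2 by simp
  next
    case 3
    have "e 4 = \<theta> * e 3 - s * e 2"
      using rec[of 2] 3 by (simp add: numeral_2_eq_2 numeral_3_eq_3 eval_nat_numeral)
    then have "\<theta> * (\<theta> * ((y - s - t) * e 0)) = s * ((y - s) * e 0)" using e2 e3 zero 3 by simp
    then have "(y * (y - s - t)) * e 0 = (s * (y - s)) * e 0" by (simp add: mult.assoc[symmetric] yy)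
    then have "y * (y - s - t) = s * (y - s)" using e0(1) mult_right_cancel by blast
    \<comment> \<open>For \<open>n = 5\<close> the vanishing condition is quadratic in
      \<open>y\<close>; in this form its right side is a square, so the second factor cannot be
      negative.\<close>
    then have "y * (2 * s + t - y) = s\<^sup>2" by (simp add: power2_eq_square algebra_simps)
    then have "0 \<le> y * (2 * s + t - y)" by simp
    then have "y \<le> 2 * s + t" using y by (simp add: zero_le_mult_iff)
    then show ?thesis using q 3 by simp
  next
    case 4
    have "\<theta> \<le> sqrt s + sqrt t"
    proof (rule ccontr)
      assume "\<not> \<theta> \<le> sqrt s + sqrt t"
      then have gt: "\<theta> > sqrt s + sqrt t" by simp
      define e' where "e' k = e k / e 0" for k
      have "e' (Suc (n - 2)) > 0"
      proof (rule three_term_positive[OF st gt, of e' "n - 1"])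
        show "e' 0 > 0" "e' 1 = \<theta> * e' 0" using e0 by (auto simp: e'_def)
        show "e' (Suc (Suc k)) = \<theta> * e' (Suc k) - (if even k then s else t) * e' k"
          if "Suc (Suc k) \<le> n - 1" for k
          using rec[OF that] by (simp add: e'_def diff_divide_distrib)
        show "Suc (n - 2) \<le> n - 1" using 4 by simp
      qed
      moreover have "Suc (n - 2) = n - 1" using 4 by simp
      ultimately show False using zero by (simp add: e'_def)
    qed
    \<comment> \<open>The square of the sum is at most \<open>2 s + 2 t\<close>, hence at most
      \<open>4 Q\<close>; the factor 4 is where \<open>n \<ge> 6\<close> enters.\<close>
    then have "y \<le> (sqrt s + sqrt t)\<^sup>2" unfolding y_def using \<theta> by (intro power_mono) auto
    also have "\<dots> \<le> 2 * s + 2 * t"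
      using st sum_squares_bound[of "sqrt s" "sqrt t"] by (simp add: power2_sum)
    also have "\<dots> \<le> 4 * Q" using q by simp
    also have "\<dots> \<le> (real n - 2) * Q" using 4 st q by (intro mult_right_mono) auto
    finally show ?thesis .
  qed
  then show ?thesis by (simp add: y_def)
qed

context gen_polygon
begin

lemma adj_V': "adj u v \<Longrightarrow> v \<in> V" using adj_V adj_sym by blast

lemma nbrs_subset: "{w. adj v w} \<subseteq> V" using adj_V' by blast

lemma finite_nbrs [simp]: "finite {w. adj v w}" using fin nbrs_subset finite_subset by blast

definition dg :: "'v \<Rightarrow> nat" where "dg v = (if col v then a else b)"

lemma dg_pos: "1 \<le> dg v" using pos by (simp add: dg_def)

lemma card_nbrs: "v \<in> V \<Longrightarrow> card {w. adj v w} = dg v" using deg by (simp add: dg_def)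

lemma card_closer:
  assumes u: "u \<in> V" and v: "v \<in> V" and k: "d u v = Suc k"
  shows "card {w. adj v w \<and> d u w = k} = (if Suc k < n then 1 else dg v)"
proof (cases "Suc k < n")
  case True
  then have "\<exists>!w. adj v w \<and> d u w = k" using d_down[OF u v] k by (simp add: eq_commute[of k])
  then have "\<exists>w. {w. adj v w \<and> d u w = k} = {w}" by blast
  then show ?thesis using True by auto
next
  case False
  then have "d u v = n" using d_le[OF u v] k by simp
  then have "{w. adj v w \<and> d u w = k} = {w. adj v w}"
  proof -
    have "d u w = k" if vw: "adj v w" for w
      using d_step[OF u vw] d_le[OF u adj_V'[OF vw]] k \<open>d u v = n\<close> by auto
    then show ?thesis by blast
  qed
  then show ?thesis using False card_nbrs[OF v] by simp
qed

text \<open>Only distances of the parity of \<open>k\<close> are summed. Unlike single sphere sums,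
  these satisfy a three-term recurrence from the start, and the sum of index \<open>n - 1\<close>
  runs over a full colour class.\<close>

definition ball_sum :: "'v \<Rightarrow> ('v \<Rightarrow> real) \<Rightarrow> nat \<Rightarrow> real" where
  "ball_sum u g k = (\<Sum>v | v \<in> V \<and> d u v \<le> k \<and> even (d u v + k). g v)"

lemma sum_nbrs_swap:
  assumes "A \<subseteq> V"
  shows "(\<Sum>v\<in>A. \<Sum>w | adj v w. g w) = (\<Sum>w\<in>V. real (card {v \<in> A. adj w v}) * g w)"
proof -
  have fA: "finite A" using fin assms finite_subset by blast
  have "(\<Sum>v\<in>A. \<Sum>w | adj v w. g w) = (\<Sum>v\<in>A. \<Sum>w\<in>{w. w \<in> V \<and> adj v w}. g w)"
    using adj_V' by (intro sum.cong) auto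
  also have "\<dots> = (\<Sum>w\<in>V. \<Sum>v\<in>{v. v \<in> A \<and> adj v w}. g w)" by (rule sum.swap_restrict[OF fA fin])
  also have "\<dots> = (\<Sum>w\<in>V. real (card {v \<in> A. adj w v}) * g w)"
    using adj_sym by (intro sum.cong HOL.refl) (auto intro!: arg_cong[of _ _ card])
  finally show ?thesis .
qed

text \<open>Summing the eigenvalue equation over the ball counts a vertex at distance
  \<open>k + 1\<close> once, through its unique closer neighbour, and a vertex at distance at most
  \<open>k - 1\<close> once per neighbour. The excess over one is the degree minus 1.\<close>

lemma ball_sum_rec:
  assumes u: "u \<in> V" and k: "Suc k < n" and g: "\<And>v. v \<in> V \<Longrightarrow> (\<Sum>w | adj v w. g w) = \<theta> * g v"
  shows "\<theta> * ball_sum u g k = ball_sum u g (Suc k)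
     + (if k = 0 then 0 else (real (if even k = col u then b else a) - 1) * ball_sum u g (k - 1))"
proof -
  define A where "A = {v \<in> V. d u v \<le> k \<and> even (d u v + k)}"
  define B where "B j = {v \<in> V. d u v \<le> j \<and> even (d u v + Suc k)}" for j
  define D where "D = real (if even k = col u then b else a)"
  have AV: "A \<subseteq> V" by (auto simp: A_def)
  have "\<theta> * ball_sum u g k = (\<Sum>v\<in>A. \<Sum>w | adj v w. g w)"
    unfolding ball_sum_def A_def[symmetric] sum_distrib_left using g AV by (intro sum.cong) auto
  also have "\<dots> = (\<Sum>w\<in>V. real (card {v \<in> A. adj w v}) * g w)" by (rule sum_nbrs_swap[OF AV])
  also have "\<dots> = (\<Sum>w\<in>V. (if w \<in> B (Suc k) then g w else 0) + (if k \<noteq> 0 \<and> w \<in> B (k - 1) then (D - 1) * g w else 0))"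
  proof (intro sum.cong HOL.refl)
    fix w assume w: "w \<in> V"
    consider (far) "w \<notin> B (Suc k)" | (eq) "d u w = Suc k" | (near) "w \<in> B (Suc k)" "d u w \<noteq> Suc k" by blast
    then show "real (card {v \<in> A. adj w v}) * g w =
        (if w \<in> B (Suc k) then g w else 0) + (if k \<noteq> 0 \<and> w \<in> B (k - 1) then (D - 1) * g w else 0)"
    proof cases
      case far
      have "v \<notin> A" if "adj w v" for v
        using far d_step[OF u that] w by (auto simp: A_def B_def)
      then have "{v \<in> A. adj w v} = {}" by blast
      then show ?thesis using far by (auto simp: B_def)
    next
      case eq
      have "v \<in> A \<longleftrightarrow> d u v = k" if vw: "adj w v" for v
        using d_step[OF u vw] adj_V'[OF vw] eq by (auto simp: A_def)
      then have "{v \<in> A. adj w v} = {v. adj w v \<and> d u v = k}" by blast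
      then have "card {v \<in> A. adj w v} = 1" using card_closer[OF u w eq] k by simp
      then show ?thesis using eq w by (auto simp: B_def)
    next
      case near
      then have le: "d u w \<le> k" "even (d u w + Suc k)" by (auto simp: B_def)
      then have lt: "d u w \<le> k - 1" "k \<noteq> 0" by (cases "d u w = k"; auto)+
      have "v \<in> A" if vw: "adj w v" for v
        using d_step[OF u vw] adj_V'[OF vw] lt le by (auto simp: A_def)
      then have "{v \<in> A. adj w v} = {v. adj w v}" by blast
      then have c: "card {v \<in> A. adj w v} = dg w" using card_nbrs[OF w] by simp
      have "real (dg w) = D" using d_even[OF u w] le(2) by (auto simp: D_def dg_def)
      then show ?thesis using c near lt le w by (auto simp: B_def algebra_simps)
    qed
  qed
  also have "\<dots> = (\<Sum>w\<in>B (Suc k). g w) + (if k = 0 then 0 else (\<Sum>w\<in>B (k - 1). (D - 1) * g w))"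
  proof -
    have "B j \<subseteq> V" for j by (auto simp: B_def)
    then show ?thesis using fin by (simp add: sum.distrib sum.inter_restrict[symmetric] Int_absorb1)
  qed
  also have "\<dots> = ball_sum u g (Suc k) + (if k = 0 then 0 else (D - 1) * ball_sum u g (k - 1))"
    by (auto simp: ball_sum_def B_def sum_distrib_left intro!: sum.cong)
  finally show ?thesis unfolding D_def .
qed

lemma ball_sum_0: "u \<in> V \<Longrightarrow> ball_sum u g 0 = g u"
proof -
  assume u: "u \<in> V"
  have "d u u = 0" using d_0[OF u u] by simp
  moreover have "v = u" if "v \<in> V" "d u v = 0" for v using d_0[OF u that(1)] that(2) by simp
  ultimately have "{v \<in> V. d u v \<le> 0 \<and> even (d u v + 0)} = {u}" using u by auto
  then show ?thesis by (simp add: ball_sum_def)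
qed

text \<open>A vertex at distance \<open>n\<close> has the wrong parity for \<open>n - 1\<close>, so
  from index \<open>n - 1\<close> on the parity ball is an entire colour class, over which
  \<open>g\<close> sums to zero.\<close>

lemma ball_sum_last:
  assumes u: "u \<in> V" and k: "n - 1 \<le> k" and g: "\<And>c. (\<Sum>v | v \<in> V \<and> col v = c. g v) = 0"
  shows "ball_sum u g k = 0"
proof -
  have "{v \<in> V. d u v \<le> k \<and> even (d u v + k)} = {v \<in> V. col v = (if even k then col u else \<not> col u)}"
  proof (intro Set.set_eqI iffI)
    fix v assume "v \<in> {v \<in> V. d u v \<le> k \<and> even (d u v + k)}"
    then show "v \<in> {v \<in> V. col v = (if even k then col u else \<not> col u)}" using d_even[OF u, of v] by auto
  next
    fix v assume "v \<in> {v \<in> V. col v = (if even k then col u else \<not> col u)}"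
    then have v: "v \<in> V" "even (d u v + k)" using d_even[OF u, of v] by (auto split: if_splits)
    moreover have "d u v \<le> k" using d_le[OF u v(1)] k v(2) by (cases "d u v = n"; cases "k = n - 1") auto
    ultimately show "v \<in> {v \<in> V. d u v \<le> k \<and> even (d u v + k)}" by simp
  qed
  then show ?thesis using g by (simp add: ball_sum_def)
qed

text \<open>Multiplying by the square root of the degree turns \<open>f\<close> into an
  eigenfunction of the plain adjacency operator. Its ball sums around a vertex where it does not
  vanish start with a nonzero value and vanish at index \<open>n - 1\<close>, so the eigenvalue is a
  root of the orthogonal polynomial of the polygon.\<close>

lemma eigenvalue_bound:
  fixes f :: "'v \<Rightarrow> real" and \<alpha> :: real
  assumes q: "1 \<le> q" "q \<le> a" "q \<le> b"
    and f: "\<exists>v\<in>V. f v \<noteq> 0" "(\<Sum>v\<in>V. dg v * f v) = 0"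
    and eig: "\<And>v. v \<in> V \<Longrightarrow> (\<Sum>w | adj v w. f w) = \<alpha> * dg v * f v"
  shows "\<alpha> \<le> sqrt (real n - 2) / sqrt q"
proof (cases "\<alpha> \<le> 0")
  case True
  then show ?thesis using n2 by (intro order_trans[OF True] divide_nonneg_nonneg) auto
next
  case False
  define P where "P c = (\<Sum>v | v \<in> V \<and> col v = c. dg v * f v)" for c
  \<comment> \<open>The operator exchanges the two colour sums. With \<open>\<alpha> > 0\<close> and
    total mean zero this makes both of them vanish.\<close>
  have sw: "\<alpha> * P c = P (\<not> c)" for c
  proof -
    let ?A = "{v \<in> V. col v = c}"
    have "\<alpha> * P c = (\<Sum>v\<in>?A. \<Sum>w | adj v w. f w)"
      unfolding P_def sum_distrib_left by (intro sum.cong HOL.refl) (simp add: eig)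
    also have "\<dots> = (\<Sum>w\<in>V. real (card {v \<in> ?A. adj w v}) * f w)" by (rule sum_nbrs_swap) auto
    also have "\<dots> = (\<Sum>w\<in>V. if col w = (\<not> c) then dg w * f w else 0)"
    proof (intro sum.cong HOL.refl)
      fix w assume w: "w \<in> V"
      have "{v \<in> ?A. adj w v} = (if col w = (\<not> c) then {v. adj w v} else {})"
        using adj_col adj_V' by auto
      then show "real (card {v \<in> ?A. adj w v}) * f w = (if col w = (\<not> c) then dg w * f w else 0)"
        using card_nbrs[OF w] by simp
    qed
    also have "\<dots> = P (\<not> c)" unfolding P_def using fin by (simp add: sum.inter_filter[symmetric])
    finally show ?thesis .
  qed
  have "P True + P False = (\<Sum>v\<in>V. dg v * f v)"
  proof -
    have "V = {v \<in> V. col v = True} \<union> {v \<in> V. col v = False}" by auto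
    then show ?thesis unfolding P_def using fin
      by (subst (3) \<open>V = _\<close>) (rule sum.union_disjoint[symmetric]; auto)
  qed
  then have "P True * (1 + \<alpha>) = 0" using f(2) sw[of True] by (simp add: algebra_simps)
  then have "P True = 0" using False by auto
  moreover from this have "P False = 0" using sw[of True] by simp
  ultimately have P0: "P c = 0" for c by (cases c) auto
  define g where "g v = sqrt (dg v) * f v" for v
  have dg0: "0 < real (dg v)" for v using dg_pos[of v] by simp
  define \<theta> where "\<theta> = \<alpha> * sqrt (real a * real b)"
  have \<theta>: "\<theta> > 0" using False pos by (simp add: \<theta>_def)
  have g_eig: "(\<Sum>w | adj v w. g w) = \<theta> * g v" if v: "v \<in> V" for v
  proof -
    define h where "h = (if col v then b else a)"
    have "(\<Sum>w | adj v w. g w) = (\<Sum>w | adj v w. sqrt h * f w)"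
      unfolding g_def h_def using adj_col by (intro sum.cong HOL.refl) (auto simp: dg_def)
    also have "\<dots> = sqrt h * (\<alpha> * dg v * f v)" by (simp add: sum_distrib_left[symmetric] eig[OF v])
    also have "\<dots> = \<alpha> * (sqrt h * sqrt (dg v)) * (sqrt (dg v) * f v)"
      using dg0[of v] by simp
    also have "sqrt h * sqrt (dg v) = sqrt (real a * real b)"
      by (simp add: h_def dg_def real_sqrt_mult)
    finally show ?thesis by (simp add: \<theta>_def g_def)
  qed
  have g_sum: "(\<Sum>v | v \<in> V \<and> col v = c. g v) = 0" for c
  proof -
    have "(\<Sum>v | v \<in> V \<and> col v = c. g v) = (\<Sum>v | v \<in> V \<and> col v = c. dg v * f v / sqrt (if c then a else b))"
      using pos by (intro sum.cong HOL.refl) (auto simp: g_def dg_def real_div_sqrt field_simps)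
    also have "\<dots> = P c / sqrt (if c then a else b)" by (simp add: P_def sum_divide_distrib)
    finally show ?thesis using P0 by simp
  qed
  obtain u where u: "u \<in> V" "f u \<noteq> 0" using f(1) by blast
  then have gu: "g u \<noteq> 0" using dg0[of u] by (simp add: g_def)
  define s t where "s = real (if col u then a else b) - 1" and "t = real (if col u then b else a) - 1"
  \<comment> \<open>Since \<open>q\<close> is at most both degrees, \<open>Q\<close> dominates both;
    the product \<open>a b\<close> cancels when the bound is read for
    \<open>\<alpha>\<close>.\<close>
  define Q where "Q = real a * real b / real q"
  have "\<theta>\<^sup>2 \<le> (real n - 2) * Q"
  proof (rule three_term_root_bound[of s t \<theta> "ball_sum u g"])
    show "0 \<le> s" "0 \<le> t" using pos by (auto simp: s_def t_def)
    show "0 < \<theta>" by fact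
    show "ball_sum u g 0 \<noteq> 0" using gu ball_sum_0[OF u(1)] by simp
    show "ball_sum u g 1 = \<theta> * ball_sum u g 0" using ball_sum_rec[OF u(1) _ g_eig, of 0] n2 by simp
    show "2 \<le> n" by (rule n2)
    show "ball_sum u g (Suc (Suc k)) = \<theta> * ball_sum u g (Suc k) - (if even k then s else t) * ball_sum u g k"
      if "Suc (Suc k) \<le> n - 1" for k
      using ball_sum_rec[OF u(1) _ g_eig, of "Suc k"] that by (auto simp: s_def t_def)
    show "ball_sum u g (n - 1) = 0" by (rule ball_sum_last[OF u(1) order_refl g_sum])
    have "real q * real a \<le> real a * real b" "real q * real b \<le> real a * real b"
      using q mult_right_mono[of "real q" "real b" "real a"] mult_right_mono[of "real q" "real a" "real b"]
      by (simp_all add: mult.commute)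
    then have "real a \<le> Q" "real b \<le> Q" using q(1) by (simp_all add: Q_def field_simps)
    then show "s + 1 \<le> Q" "t + 1 \<le> Q" by (auto simp: s_def t_def)
  qed
  then have "\<alpha>\<^sup>2 * (real a * real b) \<le> (real n - 2) / real q * (real a * real b)"
    by (simp add: \<theta>_def Q_def power_mult_distrib)
  moreover have "0 < real a * real b" using pos by simp
  ultimately have "\<alpha>\<^sup>2 \<le> (real n - 2) / real q" by (rule mult_right_le_imp_le)
  then have "\<alpha> \<le> sqrt ((real n - 2) / real q)" by (rule real_le_rsqrt)
  then show ?thesis by (simp add: real_sqrt_divide)
qed

end

section \<open>The theorem of Feit and Higman\<close>

text \<open>The trace of an orthogonal projection is a natural number: as long as the projection is not
  zero, a rank one projection onto one of its columns can be split off.\<close>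

lemma trace_projection_nat:
  fixes prj :: "'v \<Rightarrow> 'v \<Rightarrow> real"
  assumes fin: "finite W"
    and "\<And>u v. u \<in> W \<Longrightarrow> v \<in> W \<Longrightarrow> prj u v = prj v u"
    and "\<And>u v. u \<in> W \<Longrightarrow> v \<in> W \<Longrightarrow> (\<Sum>w\<in>W. prj u w * prj w v) = prj u v"
  shows "\<exists>m::nat. (\<Sum>u\<in>W. prj u u) = real m"
  using assms(2,3)
proof (induction "nat \<lfloor>\<Sum>u\<in>W. prj u u\<rfloor>" arbitrary: prj rule: less_induct)
  case less
  have diag: "prj u u = (\<Sum>w\<in>W. (prj u w)\<^sup>2)" if u: "u \<in> W" for u
  proof -
    have "prj u u = (\<Sum>w\<in>W. prj u w * prj w u)" using less(3)[OF u u] by simp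
    also have "\<dots> = (\<Sum>w\<in>W. (prj u w)\<^sup>2)"
      using less(2)[OF u] by (intro sum.cong) (auto simp: power2_eq_square)
    finally show ?thesis .
  qed
  show ?case
  proof (cases "\<exists>u\<in>W. prj u u \<noteq> 0")
    case False
    then show ?thesis by (intro exI[of _ 0]) simp
  next
    case True
    then obtain e where e: "e \<in> W" "prj e e \<noteq> 0" by blast
    have "0 \<le> prj e e" using diag[OF e(1)] by (simp add: sum_nonneg)
    then have epos: "0 < prj e e" using e(2) by simp
    define prj' where "prj' u v = prj u v - prj u e * prj e v / prj e e" for u v
    have sym: "prj' u v = prj' v u" if "u \<in> W" "v \<in> W" for u v
      using less(2)[OF that] less(2)[OF that(1) e(1)] less(2)[OF that(2) e(1)] by (simp add: prj'_def)
    have idem: "(\<Sum>w\<in>W. prj' u w * prj' w v) = prj' u v" if uv: "u \<in> W" "v \<in> W" for u v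
    proof -
      have "(\<Sum>w\<in>W. prj' u w * prj' w v) =
          (\<Sum>w\<in>W. prj u w * prj w v - (prj u w * prj w e) * (prj e v / prj e e)
            - (prj u e / prj e e) * (prj e w * prj w v) + (prj u e / prj e e) * (prj e w * prj w e) * (prj e v / prj e e))"
        unfolding prj'_def by (intro sum.cong HOL.refl) (simp add: algebra_simps)
      also have "\<dots> = prj u v - prj u e * (prj e v / prj e e) - (prj u e / prj e e) * prj e v
           + (prj u e / prj e e) * prj e e * (prj e v / prj e e)"
        unfolding sum.distrib sum_subtractf sum_distrib_right[symmetric] sum_distrib_left[symmetric]
          less(3)[OF uv] less(3)[OF uv(1) e(1)] less(3)[OF e(1) uv(2)] less(3)[OF e(1) e(1)] ..
      also have "\<dots> = prj' u v" using e(2) by (simp add: prj'_def)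
      finally show ?thesis .
    qed
    have "(\<Sum>u\<in>W. prj u e * prj e u) = prj e e"
      using less(3)[OF e(1) e(1)] by (simp add: mult.commute)
    then have tr: "(\<Sum>u\<in>W. prj' u u) = (\<Sum>u\<in>W. prj u u) - 1"
      using e(2) by (simp add: prj'_def sum_subtractf sum_divide_distrib[symmetric])
    have "0 \<le> prj' u u" if u: "u \<in> W" for u
    proof -
      have "prj' u u = (\<Sum>w\<in>W. prj' u w * prj' w u)" using idem[OF u u] by simp
      also have "\<dots> = (\<Sum>w\<in>W. (prj' u w)\<^sup>2)" using sym[OF u] by (intro sum.cong) (auto simp: power2_eq_square)
      finally show ?thesis by (simp add: sum_nonneg)
    qed
    \<comment> \<open>The remaining trace is nonnegative, so the old one was at least 1 and its
      floor drops strictly.\<close>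
    then have "0 \<le> (\<Sum>u\<in>W. prj' u u)" by (rule sum_nonneg)
    then have "nat \<lfloor>\<Sum>u\<in>W. prj' u u\<rfloor> < nat \<lfloor>\<Sum>u\<in>W. prj u u\<rfloor>" using tr by linarith
    from less(1)[OF this sym idem] obtain m where "(\<Sum>u\<in>W. prj' u u) = real m" by blast
    then show ?thesis using tr by (intro exI[of _ "Suc m"]) simp
  qed
qed

section \<open>Radial functions, sphere sizes and multiplicities of zonal eigenfunctions\<close>

context gen_polygon
begin

definition sphere :: "'v \<Rightarrow> nat \<Rightarrow> 'v set" where
  "sphere u k = {v \<in> V. d u v = k}"

lemma finite_sphere [simp]: "finite (sphere u k)" using fin by (simp add: sphere_def)

lemma d_refl: "u \<in> V \<Longrightarrow> d u u = 0" using d_0 by blast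

lemma nbr_d0:
  assumes u: "u \<in> V" and w: "adj u w"
  shows "d u w = 1"
  using d_step[OF u w] d_refl[OF u] by simp

lemma dg_dist: "u \<in> V \<Longrightarrow> v \<in> V \<Longrightarrow> dg v = (if even (d u v) = col u then a else b)"
  using d_even[of u v] by (auto simp: dg_def)

text \<open>Adjacency is tridiagonal on functions of the distance: one neighbour is closer and the
  rest are farther, except at distance 0 and at distance \<open>n\<close>, where all neighbours
  behave alike.\<close>

lemma sum_nbrs_radial:
  fixes \<phi> :: "nat \<Rightarrow> real"
  assumes u: "u \<in> V" and v: "v \<in> V"
  shows "(\<Sum>w | adj v w. \<phi> (d u w)) =
    (if d u v = 0 then dg v * \<phi> 1 else if d u v = n then dg v * \<phi> (n - 1)
     else \<phi> (d u v - 1) + (real (dg v) - 1) * \<phi> (Suc (d u v)))"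
proof (cases "d u v")
  case 0
  then have "v = u" using d_0[OF u v] by simp
  then have "(\<Sum>w | adj v w. \<phi> (d u w)) = (\<Sum>w | adj v w. \<phi> 1)" using nbr_d0[OF u] by (intro sum.cong) auto
  then show ?thesis using card_nbrs[OF v] 0 by simp
next
  case (Suc k)
  define A where "A = {w. adj v w \<and> d u w = k}"
  define B where "B = {w. adj v w} - A"
  have fA: "finite A" unfolding A_def by (rule finite_subset[OF _ finite_nbrs[of v]]) auto
  have "d u w = Suc (Suc k)" if "w \<in> B" for w
    using that d_step[OF u, of v w] Suc by (auto simp: A_def B_def)
  then have "(\<Sum>w\<in>B. \<phi> (d u w)) = real (card B) * \<phi> (Suc (Suc k))" by simp
  moreover have "(\<Sum>w\<in>A. \<phi> (d u w)) = real (card A) * \<phi> k" by (simp add: A_def)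
  moreover have "(\<Sum>w | adj v w. \<phi> (d u w)) = (\<Sum>w\<in>B. \<phi> (d u w)) + (\<Sum>w\<in>A. \<phi> (d u w))"
    unfolding B_def by (rule sum.subset_diff) (auto simp: A_def)
  moreover have "card B = dg v - card A"
    unfolding B_def using card_Diff_subset[OF fA, of "{w. adj v w}"] card_nbrs[OF v] by (auto simp: A_def)
  moreover have "card A = (if Suc k < n then 1 else dg v)"
    using card_closer[OF u v Suc] by (simp add: A_def)
  moreover have "Suc k \<le> n" using d_le[OF u v] Suc by simp
  ultimately show ?thesis using Suc dg_pos[of v] by (auto simp: of_nat_diff)
qed

text \<open>Double counting of the edges between consecutive spheres, carried out by applying the
  adjacency operator to the indicator of the outer sphere.\<close>

lemma card_sphere_Suc:
  assumes u: "u \<in> V" and k: "k < n"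
  shows "real (card (sphere u (Suc k))) * (if Suc k < n then 1 else real (if even (Suc k) = col u then a else b)) =
    real (card (sphere u k)) * (if k = 0 then real (if col u then a else b) else real (if even k = col u then a else b) - 1)"
proof -
  define \<phi> :: "nat \<Rightarrow> real" where "\<phi> j = (if j = Suc k then 1 else 0)" for j
  have sV: "sphere u j \<subseteq> V" for j by (auto simp: sphere_def)
  have "(\<Sum>v\<in>sphere u k. \<Sum>w | adj v w. \<phi> (d u w)) =
      real (card (sphere u k)) * (if k = 0 then real (if col u then a else b) else real (if even k = col u then a else b) - 1)"
  proof -
    have "(\<Sum>w | adj v w. \<phi> (d u w)) =
        (if k = 0 then real (if col u then a else b) else real (if even k = col u then a else b) - 1)"
      if v: "v \<in> sphere u k" for v
    proof -
      have v': "v \<in> V" "d u v = k" using v by (auto simp: sphere_def)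
      have "dg v = (if even k = col u then a else b)" using dg_dist[OF u v'(1)] v'(2) by simp
      then show ?thesis using sum_nbrs_radial[OF u v'(1), of \<phi>] v'(2) k by (auto simp: \<phi>_def)
    qed
    then show ?thesis by simp
  qed
  moreover have "(\<Sum>v\<in>sphere u k. \<Sum>w | adj v w. \<phi> (d u w)) =
      real (card (sphere u (Suc k))) * (if Suc k < n then 1 else real (if even (Suc k) = col u then a else b))"
  proof -
    have "(\<Sum>v\<in>sphere u k. \<Sum>w | adj v w. \<phi> (d u w)) =
        (\<Sum>w\<in>V. real (card {v \<in> sphere u k. adj w v}) * \<phi> (d u w))"
      by (rule sum_nbrs_swap[OF sV])
    also have "\<dots> = (\<Sum>w\<in>sphere u (Suc k). real (card {v \<in> sphere u k. adj w v}))"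
      unfolding sphere_def[of u "Suc k"] sum.inter_filter[OF fin] by (intro sum.cong) (auto simp: \<phi>_def)
    also have "\<dots> = (\<Sum>w\<in>sphere u (Suc k). (if Suc k < n then 1 else real (if even (Suc k) = col u then a else b)))"
    proof (intro sum.cong HOL.refl)
      fix w assume "w \<in> sphere u (Suc k)"
      then have w: "w \<in> V" "d u w = Suc k" by (auto simp: sphere_def)
      have "{v \<in> sphere u k. adj w v} = {v. adj w v \<and> d u v = k}" using adj_V' by (auto simp: sphere_def)
      then show "real (card {v \<in> sphere u k. adj w v}) =
          (if Suc k < n then 1 else real (if even (Suc k) = col u then a else b))"
        using card_closer[OF u w] dg_dist[OF u w(1)] w(2) by simp
    qed
    finally show ?thesis by simp
  qed
  ultimately show ?thesis by simp
qed

lemma card_sphere_0: "u \<in> V \<Longrightarrow> card (sphere u 0) = 1"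
proof -
  assume u: "u \<in> V"
  have "sphere u 0 = {u}" using d_0[OF u] u by (auto simp: sphere_def)
  then show ?thesis by simp
qed

lemma ball_sum_sphere:
  "ball_sum u g (Suc (Suc k)) = ball_sum u g k + (\<Sum>v\<in>sphere u (Suc (Suc k)). g v)"
proof -
  have "{v \<in> V. d u v \<le> Suc (Suc k) \<and> even (d u v + Suc (Suc k))} =
      {v \<in> V. d u v \<le> k \<and> even (d u v + k)} \<union> sphere u (Suc (Suc k))"
    by (auto simp: sphere_def le_Suc_eq)
  then show ?thesis
    unfolding ball_sum_def using fin by (simp add: sum.union_disjoint sphere_def disjoint_iff)
qed

lemma ball_sum_small: "k \<le> 1 \<Longrightarrow> ball_sum u g k = (\<Sum>v\<in>sphere u k. g v)"
  unfolding ball_sum_def sphere_def by (intro sum.cong) (auto simp: le_Suc_eq)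

text \<open>The closing relation at the end of the recurrence: every neighbour of a vertex of the
  parity of \<open>n\<close> lies in the parity ball of radius \<open>n - 1\<close>, so degrees
  replace the count 1.\<close>

lemma ball_sum_top:
  assumes u: "u \<in> V" and g: "\<And>v. v \<in> V \<Longrightarrow> (\<Sum>w | adj v w. g w) = \<theta> * g v"
  shows "\<theta> * ball_sum u g (n - 1) = real (if even n = col u then a else b) * ball_sum u g n"
proof -
  define A where "A = {v \<in> V. d u v \<le> n - 1 \<and> even (d u v + (n - 1))}"
  have AV: "A \<subseteq> V" by (auto simp: A_def)
  have "\<theta> * ball_sum u g (n - 1) = (\<Sum>v\<in>A. \<Sum>w | adj v w. g w)"
    unfolding ball_sum_def A_def[symmetric] sum_distrib_left using g AV by (intro sum.cong) auto
  also have "\<dots> = (\<Sum>w\<in>V. real (card {v \<in> A. adj w v}) * g w)" by (rule sum_nbrs_swap[OF AV])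
  also have "\<dots> = (\<Sum>w\<in>V. if d u w \<le> n \<and> even (d u w + n) then real (if even n = col u then a else b) * g w else 0)"
  proof (intro sum.cong HOL.refl)
    fix w assume w: "w \<in> V"
    have *: "v \<in> A \<longleftrightarrow> even (d u w + n)" if v: "adj w v" for v
      using d_step[OF u v] adj_V'[OF v] d_le[OF u adj_V'[OF v]] n2 d_le[OF u w] by (auto simp: A_def; presburger)
    show "real (card {v \<in> A. adj w v}) * g w =
        (if d u w \<le> n \<and> even (d u w + n) then real (if even n = col u then a else b) * g w else 0)"
    proof (cases "even (d u w + n)")
      case True
      then have "{v \<in> A. adj w v} = {v. adj w v}" using * by blast
      then show ?thesis using True card_nbrs[OF w] dg_dist[OF u w] d_le[OF u w] by auto
    next
      case False
      then have "{v \<in> A. adj w v} = {}" using * by blast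
      then show ?thesis using False by simp
    qed
  qed
  also have "\<dots> = real (if even n = col u then a else b) * ball_sum u g n"
    unfolding ball_sum_def sum_distrib_left using fin by (intro sum.inter_filter[symmetric])
  finally show ?thesis .
qed

text \<open>The recurrences involve only the eigenvalue, so the value at the centre determines all
  ball sums of an eigenfunction.\<close>

lemma ball_sum_proportional:
  fixes g z :: "'v \<Rightarrow> real" and \<theta> :: real
  assumes u: "u \<in> V" and g: "\<And>v. v \<in> V \<Longrightarrow> (\<Sum>w | adj v w. g w) = \<theta> * g v"
    and z: "\<And>v. v \<in> V \<Longrightarrow> (\<Sum>w | adj v w. z w) = \<theta> * z v" "z u = 1"
  shows "k \<le> n \<Longrightarrow> ball_sum u g k = ball_sum u z k * g u"
proof (induction k rule: less_induct)
  case (less k)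
  consider "k = 0" | j where "k = Suc j" "k < n" | "k = n" using less(2) by (cases k; cases "k = n") auto
  then show ?case
  proof cases
    case 1
    then show ?thesis using ball_sum_0[OF u] z(2) by simp
  next
    case (2 j)
    have IH: "ball_sum u g i = ball_sum u z i * g u" if "i < k" for i using less that by simp
    have "ball_sum u g k = \<theta> * ball_sum u g j - (if j = 0 then 0 else (real (if even j = col u then b else a) - 1) * ball_sum u g (j - 1))"
      using ball_sum_rec[OF u _ g, of j] 2 by simp
    also have "\<dots> = (\<theta> * ball_sum u z j - (if j = 0 then 0 else (real (if even j = col u then b else a) - 1) * ball_sum u z (j - 1))) * g u"
      using IH[of j] IH[of "j - 1"] 2 by (simp add: algebra_simps)
    also have "\<dots> = ball_sum u z k * g u" using ball_sum_rec[OF u _ z(1), of j] 2 by simp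
    finally show ?thesis .
  next
    case 3
    have "ball_sum u g (n - 1) = ball_sum u z (n - 1) * g u" using less(1)[of "n - 1"] 3 n2 by simp
    then have "real (if even n = col u then a else b) * ball_sum u g n =
        real (if even n = col u then a else b) * (ball_sum u z n * g u)"
      using ball_sum_top[OF u g] ball_sum_top[OF u z(1)] by (metis mult.assoc)
    then show ?thesis using 3 pos by (auto split: if_splits)
  qed
qed

lemma sphere_sum_proportional:
  fixes g z :: "'v \<Rightarrow> real" and \<theta> :: real
  assumes u: "u \<in> V" and g: "\<And>v. v \<in> V \<Longrightarrow> (\<Sum>w | adj v w. g w) = \<theta> * g v"
    and z: "\<And>v. v \<in> V \<Longrightarrow> (\<Sum>w | adj v w. z w) = \<theta> * z v" "z u = 1" and k: "k \<le> n"
  shows "(\<Sum>v\<in>sphere u k. g v) = (\<Sum>v\<in>sphere u k. z v) * g u"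
proof (cases "k \<le> 1")
  case True
  then show ?thesis using ball_sum_proportional[OF u g z k] ball_sum_small by simp
next
  case False
  then obtain j where j: "k = Suc (Suc j)" by (metis One_nat_def Suc_le_mono le0 not0_implies_Suc)
  then show ?thesis
    using ball_sum_proportional[OF u g z k] ball_sum_proportional[OF u g z, of j] k
    by (simp add: ball_sum_sphere algebra_simps)
qed

text \<open>A zonal eigenfunction \<open>p (d u v)\<close>, suitably normalized, is the kernel of a projection.\<close>

lemma zonal_multiplicity:
  fixes p :: "nat \<Rightarrow> real" and \<kappa> :: "nat \<Rightarrow> real"
  assumes W: "W \<subseteq> V" and p0: "p 0 = 1"
    and eig: "\<And>u v. u \<in> W \<Longrightarrow> v \<in> V \<Longrightarrow> (\<Sum>w | adj v w. p (d u w)) = \<theta> * p (d u v)"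
    and J: "J \<subseteq> {..n}" "0 \<in> J" "\<And>u v. u \<in> W \<Longrightarrow> v \<in> V \<Longrightarrow> v \<in> W \<longleftrightarrow> d u v \<in> J"
    and \<kappa>: "\<And>u k. u \<in> W \<Longrightarrow> k \<in> J \<Longrightarrow> real (card (sphere u k)) = \<kappa> k"
  shows "\<exists>m::nat. real m * (\<Sum>k\<in>J. \<kappa> k * (p k)\<^sup>2) = real (card W)"
proof (cases "W = {}")
  case True
  then show ?thesis by (intro exI[of _ 0]) simp
next
  case False
  define c where "c = (\<Sum>k\<in>J. \<kappa> k * (p k)\<^sup>2)"
  have fJ: "finite J" using J(1) finite_subset by blast
  have fW: "finite W" using W fin finite_subset by blast
  obtain u0 where u0: "u0 \<in> W" using False by blast
  have \<kappa>0: "0 \<le> \<kappa> k" if "k \<in> J" for k using \<kappa>[OF u0 that] by (metis of_nat_0_le_iff)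
  have "\<kappa> 0 * (p 0)\<^sup>2 \<le> c" unfolding c_def using \<kappa>0 by (intro member_le_sum J(2) fJ) simp
  moreover have "\<kappa> 0 = 1" using \<kappa>[OF u0 J(2)] card_sphere_0 u0 W by auto
  ultimately have c: "0 < c" using p0 by simp
  \<comment> \<open>For fixed \<open>w\<close>, \<open>p (d w v)\<close> is an eigenfunction of
    \<open>v\<close>, so its sums over spheres around \<open>u\<close> are proportional to those of
    the zonal function at \<open>u\<close>. Hence the kernel squares to \<open>c\<close> times
    itself, and dividing by \<open>c\<close> gives a projection.\<close>
  have main: "(\<Sum>v\<in>W. p (d u v) * p (d v w)) = c * p (d u w)" if uw: "u \<in> W" "w \<in> W" for u w
  proof -
    have V: "u \<in> V" "w \<in> V" using uw W by auto
    have Wsum: "(\<Sum>v\<in>W. h v) = (\<Sum>k\<in>J. \<Sum>v\<in>sphere u k. h v)" for h :: "'v \<Rightarrow> real"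
    proof -
      have "W = (\<Union>k\<in>J. sphere u k)" using J(3)[OF uw(1)] W by (auto simp: sphere_def)
      then show ?thesis using fJ by (simp add: sum.UNION_disjoint sphere_def disjoint_iff fin)
    qed
    have "(\<Sum>v\<in>W. p (d u v) * p (d v w)) = (\<Sum>k\<in>J. \<Sum>v\<in>sphere u k. p k * p (d w v))"
      unfolding Wsum using d_sym V(2) by (intro sum.cong HOL.refl) (auto simp: sphere_def)
    also have "\<dots> = (\<Sum>k\<in>J. p k * (\<Sum>v\<in>sphere u k. p (d w v)))" by (simp add: sum_distrib_left)
    also have "\<dots> = (\<Sum>k\<in>J. p k * ((\<Sum>v\<in>sphere u k. p (d u v)) * p (d w u)))"
    proof (intro sum.cong HOL.refl)
      fix k assume "k \<in> J"
      then have k: "k \<le> n" using J(1) by auto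
      have "p (d u u) = 1" using d_refl[OF V(1)] p0 by simp
      then have "(\<Sum>v\<in>sphere u k. p (d w v)) = (\<Sum>v\<in>sphere u k. p (d u v)) * p (d w u)"
        using sphere_sum_proportional[OF V(1) _ _ _ k, of "\<lambda>v. p (d w v)" \<theta> "\<lambda>v. p (d u v)"] eig uw by simp
      then show "p k * (\<Sum>v\<in>sphere u k. p (d w v)) = p k * ((\<Sum>v\<in>sphere u k. p (d u v)) * p (d w u))" by simp
    qed
    also have "\<dots> = (\<Sum>k\<in>J. \<kappa> k * (p k)\<^sup>2 * p (d w u))"
    proof (intro sum.cong HOL.refl)
      fix k assume k: "k \<in> J"
      have "(\<Sum>v\<in>sphere u k. p (d u v)) = \<kappa> k * p k" using \<kappa>[OF uw(1) k] by (simp add: sphere_def)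
      then show "p k * ((\<Sum>v\<in>sphere u k. p (d u v)) * p (d w u)) = \<kappa> k * (p k)\<^sup>2 * p (d w u)"
        by (simp add: power2_eq_square)
    qed
    also have "\<dots> = c * p (d u w)" using d_sym[OF V] by (simp add: c_def sum_distrib_right)
    finally show ?thesis .
  qed
  have "\<exists>m::nat. (\<Sum>u\<in>W. p (d u u) / c) = real m"
  proof (rule trace_projection_nat[OF fW, of "\<lambda>u v. p (d u v) / c"])
    show "p (d u v) / c = p (d v u) / c" if "u \<in> W" "v \<in> W" for u v
    proof -
      have "d u v = d v u" using that W by (intro d_sym) auto
      then show ?thesis by simp
    qed
    show "(\<Sum>w\<in>W. p (d u w) / c * (p (d w v) / c)) = p (d u v) / c" if "u \<in> W" "v \<in> W" for u v
    proof -
      have "(\<Sum>w\<in>W. p (d u w) / c * (p (d w v) / c)) = (\<Sum>w\<in>W. p (d u w) * p (d w v)) / (c * c)"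
        by (simp add: sum_divide_distrib)
      then show ?thesis using main[OF that] c by simp
    qed
  qed
  then obtain m :: nat where m: "(\<Sum>u\<in>W. p (d u u) / c) = real m" by blast
  \<comment> \<open>The diagonal of the kernel is 1, so the trace, a natural number, is the size of
    \<open>W\<close> divided by the norm \<open>c\<close>.\<close>
  have "(\<Sum>u\<in>W. p (d u u) / c) = (\<Sum>u\<in>W. 1 / c)" using W d_refl p0 by (intro sum.cong) auto
  then have "real (card W) / c = real m" using m by simp
  then show ?thesis using c by (intro exI[of _ m]) (simp add: c_def field_simps)
qed

end

section \<open>Trigonometric sums and rational cosines\<close>

lemma trig_square_sum:
  assumes j: "0 < j" "j < n" and \<phi>: "\<phi> = pi * real j / real n"
  shows "(\<Sum>k<n. (cos (real k * \<phi>) + \<beta> * sin (real k * \<phi>))\<^sup>2) = real n / 2 * (1 + \<beta>\<^sup>2)"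
proof -
  have n\<phi>: "real n * \<phi> = pi * real j" using j by (simp add: \<phi>)
  have "0 < \<phi>" "\<phi> < pi" using j by (simp_all add: \<phi> field_simps)
  then have s0: "sin \<phi> \<noteq> 0" using sin_gt_zero by force
  \<comment> \<open>Multiplication by \<open>2 sin \<phi>\<close> makes the sums of double-angle
    cosines and sines telescope; over \<open>n\<close> terms they vanish because
    \<open>n \<phi>\<close> is a multiple of pi.\<close>
  have C: "2 * sin \<phi> * (\<Sum>k<m. cos (2 * real k * \<phi>)) = sin ((2 * real m - 1) * \<phi>) + sin \<phi>" for m
  proof (induction m)
    case (Suc m)
    have "2 * sin \<phi> * cos (2 * real m * \<phi>) = sin ((2 * real m + 1) * \<phi>) - sin ((2 * real m - 1) * \<phi>)"
      by (simp add: sin_add sin_diff algebra_simps)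
    moreover have "(2 * real (Suc m) - 1) * \<phi> = (2 * real m + 1) * \<phi>" by (simp add: algebra_simps)
    ultimately show ?case using Suc by (simp add: distrib_left add.commute)
  qed simp
  have S: "2 * sin \<phi> * (\<Sum>k<m. sin (2 * real k * \<phi>)) = cos \<phi> - cos ((2 * real m - 1) * \<phi>)" for m
  proof (induction m)
    case (Suc m)
    have "2 * sin \<phi> * sin (2 * real m * \<phi>) = cos ((2 * real m - 1) * \<phi>) - cos ((2 * real m + 1) * \<phi>)"
      by (simp add: cos_add cos_diff algebra_simps)
    moreover have "(2 * real (Suc m) - 1) * \<phi> = (2 * real m + 1) * \<phi>" by (simp add: algebra_simps)
    ultimately show ?case using Suc by (simp add: distrib_left add.commute)
  qed simp
  have "(2 * real n - 1) * \<phi> = 2 * pi * real j - \<phi>" using n\<phi> by (simp add: algebra_simps)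
  moreover have "sin (2 * pi * real j) = 0" "cos (2 * pi * real j) = 1"
    using sin_2npi[of j] cos_2npi[of j] by (simp_all add: mult_ac)
  ultimately have "sin ((2 * real n - 1) * \<phi>) = - sin \<phi>" "cos ((2 * real n - 1) * \<phi>) = cos \<phi>"
    by (simp_all add: sin_diff cos_diff)
  then have C0: "(\<Sum>k<n. cos (2 * real k * \<phi>)) = 0" and S0: "(\<Sum>k<n. sin (2 * real k * \<phi>)) = 0"
    using C[of n] S[of n] s0 by simp_all
  have "(cos x + \<beta> * sin x)\<^sup>2 = (1 + \<beta>\<^sup>2) / 2 + (1 - \<beta>\<^sup>2) / 2 * cos (2 * x) + \<beta> * sin (2 * x)" for x
    unfolding cos_double_cos sin_double power2_sum power_mult_distrib sin_squared_eq
    by (simp add: field_simps)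
  then have "(\<Sum>k<n. (cos (real k * \<phi>) + \<beta> * sin (real k * \<phi>))\<^sup>2) =
      (\<Sum>k<n. (1 + \<beta>\<^sup>2) / 2 + (1 - \<beta>\<^sup>2) / 2 * cos (2 * real k * \<phi>) + \<beta> * sin (2 * real k * \<phi>))"
    by (simp add: mult.assoc)
  also have "\<dots> = real n * ((1 + \<beta>\<^sup>2) / 2)"
    by (simp add: sum.distrib sum_distrib_left[symmetric] sum_divide_distrib[symmetric] C0 S0)
  finally show ?thesis by simp
qed

text \<open>Niven's theorem. Doubling the angle squares the denominator of \<open>2 cos\<close>, but the multiples of a
  rational angle have only finitely many cosines.\<close>

lemma rational_cos_integer:
  assumes h: "0 < h" and rat: "2 * cos (2 * pi * real j / real h) \<in> \<rat>"
  shows "2 * cos (2 * pi * real j / real h) \<in> \<int>"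
proof -
  define A where "A i = 2 * cos (2 * pi * real i / real h)" for i :: nat
  have per: "A (i mod h) = A i" for i
  proof -
    have "real i = real (i mod h) + real (i div h) * real h"
      by (metis add.commute div_mult_mod_eq of_nat_add of_nat_mult)
    then have "2 * pi * real i / real h = 2 * pi * real (i mod h) / real h + 2 * pi * real (i div h)"
      using h by (simp add: field_simps)
    moreover have "sin (2 * pi * real (i div h)) = 0" "cos (2 * pi * real (i div h)) = 1"
      using sin_2npi[of "i div h"] cos_2npi[of "i div h"] by (simp_all add: mult_ac)
    ultimately show ?thesis by (simp add: A_def cos_add)
  qed
  obtain p q :: int where pq: "0 < q" "coprime p q" "A j = real_of_int p / real_of_int q"
    using rat unfolding A_def[symmetric] by (metis Rats_cases' )
  have dbl: "A (2 * i) = (A i)\<^sup>2 - 2" for i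
    unfolding A_def using cos_double_cos[of "2 * pi * real i / real h"] by (simp add: power2_eq_square algebra_simps)
  have ex: "\<exists>u. coprime u q \<and> A (2 ^ k * j) = real_of_int u / real_of_int q ^ (2 ^ k)" for k
  proof (induction k)
    case 0
    then show ?case using pq by auto
  next
    case (Suc k)
    then obtain u where u: "coprime u q" "A (2 ^ k * j) = real_of_int u / real_of_int q ^ (2 ^ k)" by blast
    define v where "v = u\<^sup>2 - 2 * q ^ (2 ^ Suc k)"
    have "A (2 ^ Suc k * j) = (real_of_int u / real_of_int q ^ (2 ^ k))\<^sup>2 - 2"
      using dbl[of "2 ^ k * j"] u(2) by (simp add: mult.assoc)
    also have "\<dots> = real_of_int v / real_of_int q ^ (2 ^ Suc k)"
      using pq(1) by (simp add: v_def power_divide power_mult[symmetric] mult.commute diff_divide_distrib)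
    finally have "A (2 ^ Suc k * j) = real_of_int v / real_of_int q ^ (2 ^ Suc k)" .
    \<comment> \<open>The subtracted term is a multiple of \<open>q\<close>, so coprimality is
      inherited from the square of \<open>u\<close>.\<close>
    moreover have "coprime v q"
    proof -
      have "q dvd 2 * q ^ (2 ^ Suc k)" by (simp add: dvd_power)
      then obtain w where w: "2 * q ^ (2 ^ Suc k) = q * w" by blast
      have "coprime (u\<^sup>2) q" using u(1) by simp
      then show ?thesis
        using gcd_add_mult[of q "- w" "u\<^sup>2"] unfolding v_def w
        by (simp add: coprime_iff_gcd_eq_1 gcd.commute[of _ q] mult.commute)
    qed
    ultimately show ?case by blast
  qed
  have "q = 1"
  proof (rule ccontr)
    assume "q \<noteq> 1"
    then have q1: "\<not> is_unit q" using pq(1) by auto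
    \<comment> \<open>Pigeonhole: two repeated doublings agree modulo \<open>h\<close>, so their
      cosines agree although their reduced denominators are different powers of
      \<open>q\<close>.\<close>
    have "range (\<lambda>k. (2 ^ k * j) mod h) \<subseteq> {..<h}" using h by auto
    then have "finite (range (\<lambda>k. (2 ^ k * j) mod h))" using finite_subset by blast
    then have "\<not> inj (\<lambda>k. (2 ^ k * j) mod h)" using range_inj_infinite by blast
    then obtain k l where kl: "k \<noteq> l" "(2 ^ k * j) mod h = (2 ^ l * j) mod h" by (auto simp: inj_def)
    have False if kl: "k < l" "(2 ^ k * j) mod h = (2 ^ l * j) mod h" for k l
    proof -
      have "A (2 ^ k * j) = A (2 ^ l * j)" using per[of "2 ^ k * j"] per[of "2 ^ l * j"] kl(2) by simp
      moreover obtain u v where uv: "coprime u q" "A (2 ^ k * j) = real_of_int u / real_of_int q ^ (2 ^ k)"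
        "coprime v q" "A (2 ^ l * j) = real_of_int v / real_of_int q ^ (2 ^ l)" using ex by meson
      ultimately have "real_of_int u / real_of_int q ^ (2 ^ k) = real_of_int v / real_of_int q ^ (2 ^ l)" by simp
      then have "real_of_int u * real_of_int q ^ (2 ^ l) = real_of_int v * real_of_int q ^ (2 ^ k)"
        using pq(1) by (simp add: field_simps)
      then have "u * q ^ (2 ^ l) = v * q ^ (2 ^ k)" by (metis of_int_eq_iff of_int_mult of_int_power)
      moreover have "(2::nat) ^ k < 2 ^ l" using kl(1) by simp
      then have "q ^ (2 ^ l) = q ^ (2 ^ k) * (q * q ^ (2 ^ l - 2 ^ k - 1))"
        by (metis Suc_diff_1 Suc_diff_Suc le_add_diff_inverse less_imp_le power_Suc power_add zero_less_diff diff_Suc_eq_diff_pred)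
      ultimately have "v = u * (q * q ^ (2 ^ l - 2 ^ k - 1))" using pq(1) by simp
      then have "q dvd v" by simp
      then show False using uv(3) q1 by (metis coprime_absorb_right coprime_commute)
    qed
    then show False using kl by (metis linorder_neqE_nat)
  qed
  then show ?thesis using pq(3) by (simp add: A_def)
qed

text \<open>The two relations are one relation at \<open>x\<close> and at \<open>- x\<close>. Their
  sum is linear in the square of \<open>x\<close> and determines it, because
  \<open>(s + t) (1 + s t)\<close> differs from \<open>4 s t\<close> when both are at least 2. Their
  difference is linear in \<open>x\<close> with coefficient
  \<open>2 (s - 1) (t - 1)\<close>.\<close>

lemma mult_scaled_sum:
  fixes x :: real
  assumes st: "2 \<le> s" "2 \<le> t" "s \<in> \<rat>" "t \<in> \<rat>"
    and 1: "(s + t + x) * (1 + s * t - x) = \<rho> * (4 * s * t - x\<^sup>2)" "\<rho> \<in> \<rat>"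
    and 2: "(s + t - x) * (1 + s * t + x) = \<rho>' * (4 * s * t - x\<^sup>2)" "\<rho>' \<in> \<rat>"
  shows "x \<in> \<rat>"
proof -
  define A C where "A = s + t" and "C = 1 + s * t"
  have AC: "A \<in> \<rat>" "C \<in> \<rat>" using st by (auto simp: A_def C_def)
  have "2 * (A * C - x\<^sup>2) = (\<rho> + \<rho>') * (4 * s * t - x\<^sup>2)"
    using 1(1) 2(1) by (simp add: A_def C_def power2_eq_square algebra_simps)
  then have sum: "x\<^sup>2 * (2 - (\<rho> + \<rho>')) = 2 * A * C - (\<rho> + \<rho>') * (4 * s * t)"
    by (simp add: algebra_simps)
  have "0 < s * t * (s + t - 4) + s + t" using st by (intro add_nonneg_pos add_nonneg_nonneg mult_nonneg_nonneg) auto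
  then have "A * C \<noteq> 4 * s * t" by (simp add: A_def C_def algebra_simps)
  then have nz: "2 - (\<rho> + \<rho>') \<noteq> 0" using sum by auto
  have "x\<^sup>2 = (2 * A * C - (\<rho> + \<rho>') * (4 * s * t)) / (2 - (\<rho> + \<rho>'))" using sum nz by (simp add: field_simps)
  then have x2: "x\<^sup>2 \<in> \<rat>" using AC st 1(2) 2(2) by simp
  have "2 * (C - A) * x = (\<rho> - \<rho>') * (4 * s * t - x\<^sup>2)"
    using 1(1) 2(1) by (simp add: A_def C_def power2_eq_square algebra_simps)
  moreover have "1 * 1 \<le> (s - 1) * (t - 1)" using st by (intro mult_mono) auto
  then have "C - A \<noteq> 0" by (auto simp: A_def C_def algebra_simps)
  ultimately have "x = (\<rho> - \<rho>') * (4 * s * t - x\<^sup>2) / (2 * (C - A))" by (simp add: field_simps)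
  then show ?thesis using AC st 1(2) 2(2) x2 by (metis Rats_diff Rats_divide Rats_mult Rats_number_of)
qed

text \<open>These are the real solutions with \<open>P 0 = 1\<close> of the recurrence whose
  characteristic roots are \<open>exp (i \<phi>) / r\<close> and its conjugate;
  \<open>\<beta>\<close> is left free to meet a boundary condition.\<close>

lemma trig_three_term:
  fixes r \<phi> \<beta> :: real
  defines "P \<equiv> \<lambda>i::nat. (cos (real i * \<phi>) + \<beta> * sin (real i * \<phi>)) / r ^ i"
  assumes r: "r \<noteq> 0"
  shows "P i + r * r * P (i + 2) = 2 * r * cos \<phi> * P (i + 1)"
proof -
  define Q where "Q i = cos (real i * \<phi>) + \<beta> * sin (real i * \<phi>)" for i :: nat
  have "cos (real i * \<phi>) + cos (real (i + 2) * \<phi>) = 2 * cos \<phi> * cos (real (i + 1) * \<phi>)"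
    "sin (real i * \<phi>) + sin (real (i + 2) * \<phi>) = 2 * cos \<phi> * sin (real (i + 1) * \<phi>)"
    using cos_add[of "real (i + 1) * \<phi>" \<phi>] cos_diff[of "real (i + 1) * \<phi>" \<phi>]
      sin_add[of "real (i + 1) * \<phi>" \<phi>] sin_diff[of "real (i + 1) * \<phi>" \<phi>]
    by (simp_all add: algebra_simps)
  moreover have "Q i + Q (i + 2) = (cos (real i * \<phi>) + cos (real (i + 2) * \<phi>)) +
      \<beta> * (sin (real i * \<phi>) + sin (real (i + 2) * \<phi>))"
    by (simp only: Q_def distrib_left add_ac)
  ultimately have "Q i + Q (i + 2) = 2 * cos \<phi> * Q (i + 1)" by (simp only: Q_def distrib_left mult_ac)
  moreover have "P i = Q i / r ^ i" "r * r * P (i + 2) = Q (i + 2) / r ^ i"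
    "2 * r * cos \<phi> * P (i + 1) = 2 * cos \<phi> * Q (i + 1) / r ^ i"
    unfolding P_def Q_def using r by simp_all
  ultimately show ?thesis by (simp add: add_divide_distrib[symmetric])
qed

text \<open>The weights are the sphere sizes and cancel the powers of \<open>r\<close>. The first
  weight falls short of \<open>(s + 1) / s\<close> by \<open>1 / s\<close>, and the last term
  contributes exactly \<open>1 / s\<close>, so the sum becomes the unweighted one over
  \<open>i < h\<close>.\<close>

lemma trig_weighted_square_sum:
  fixes r s S \<phi> \<beta> :: real
  defines "P \<equiv> \<lambda>i::nat. (cos (real i * \<phi>) + \<beta> * sin (real i * \<phi>)) / r ^ i"
  assumes j: "0 < j" "j < h" and \<phi>: "\<phi> = pi * real j / real h" and r: "0 < r" "r\<^sup>2 = S" and s: "0 < s"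
  shows "(\<Sum>i\<le>h. (if i = 0 then 1 else if i = h then S ^ h / s else (s + 1) / s * S ^ i) * (P i)\<^sup>2) =
    (s + 1) / s * (real h / 2 * (1 + \<beta>\<^sup>2))" (is "(\<Sum>i\<le>h. ?\<kappa> i * _) = _")
proof -
  define Q where "Q i = cos (real i * \<phi>) + \<beta> * sin (real i * \<phi>)" for i :: nat
  have S: "0 < S" using r by auto
  have PQ: "S ^ i * (P i)\<^sup>2 = (Q i)\<^sup>2" for i
  proof -
    have "(r ^ i)\<^sup>2 = S ^ i" by (simp add: r(2)[symmetric] power_mult[symmetric] mult.commute)
    then show ?thesis using S by (simp add: P_def Q_def power_divide)
  qed
  have "real h * \<phi> = pi * real j" using j by (simp add: \<phi>)
  then have "(Q h)\<^sup>2 = 1" by (simp add: Q_def mult.commute[of pi] power_mult[symmetric])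
  then have "?\<kappa> h * (P h)\<^sup>2 = 1 / s" using j PQ[of h] by simp
  then have "(\<Sum>i\<le>h. ?\<kappa> i * (P i)\<^sup>2) = (\<Sum>i<h. ?\<kappa> i * (P i)\<^sup>2) + 1 / s"
    by (simp add: lessThan_Suc_atMost[symmetric] del: if_split_asm)
  also have "(\<Sum>i<h. ?\<kappa> i * (P i)\<^sup>2) = (\<Sum>i<h. (s + 1) / s * (Q i)\<^sup>2 - (if i = 0 then 1 / s else 0))"
  proof (intro sum.cong HOL.refl)
    fix i assume i: "i \<in> {..<h}"
    show "?\<kappa> i * (P i)\<^sup>2 = (s + 1) / s * (Q i)\<^sup>2 - (if i = 0 then 1 / s else 0)"
    proof (cases "i = 0")
      case True
      then show ?thesis using s by (simp add: P_def Q_def field_simps)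
    next
      case False
      then show ?thesis using i PQ[of i] by (simp add: mult.assoc)
    qed
  qed
  also have "\<dots> = (s + 1) / s * (\<Sum>i<h. (Q i)\<^sup>2) - 1 / s" using j by (simp add: sum_subtractf sum_distrib_left)
  finally show ?thesis using trig_square_sum[OF j \<phi>, of \<beta>] by (simp add: Q_def)
qed

text \<open>With \<open>\<beta>\<close> from the boundary condition, the numerator of
  \<open>1 + \<beta>\<^sup>2\<close> factors. The norm then depends on the angle only through
  \<open>2 * r * z\<close>, and no square root of \<open>s t\<close> remains by itself.\<close>

lemma zonal_norm_even:
  fixes s t h z y B :: real
  assumes "0 < s" "0 < t" "sn\<^sup>2 = 1 - z\<^sup>2" "sn \<noteq> 0" "r\<^sup>2 = s * t" "r > 0"
    and "\<beta> = ((s - 1) * (r * z) + s * (t - 1)) / ((s + 1) * r * sn)"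
  shows "(s + 1) / s * (h / 2 * (1 + \<beta>\<^sup>2)) * (2 * (s + 1) * (4 * s * t - (2 * r * z)\<^sup>2)) =
    4 * h * ((s + t + 2 * r * z) * (1 + s * t - 2 * r * z))"
proof -
  define x where "x = r * z"
  have rs: "r\<^sup>2 * sn\<^sup>2 = s * t - x\<^sup>2"
    using assms(3,5) by (simp only: x_def power_mult_distrib) (simp add: right_diff_distrib)
  have nz: "s * t - x\<^sup>2 \<noteq> 0" "s + 1 \<noteq> 0" "s \<noteq> 0" using rs assms by auto
  have "\<beta>\<^sup>2 = ((s - 1) * x + s * (t - 1))\<^sup>2 / ((s + 1)\<^sup>2 * (s * t - x\<^sup>2))"
    unfolding assms(7) x_def[symmetric] by (simp add: power_divide power_mult_distrib rs[symmetric])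
  then have "(1 + \<beta>\<^sup>2) * ((s + 1)\<^sup>2 * (s * t - x\<^sup>2)) = (s + 1)\<^sup>2 * (s * t - x\<^sup>2) + ((s - 1) * x + s * (t - 1))\<^sup>2"
    using nz by (simp add: field_simps)
  also have "\<dots> = s * ((s + t + 2 * x) * (1 + s * t - 2 * x))"
    by (simp add: power2_eq_square algebra_simps)
  finally have "(1 + \<beta>\<^sup>2) * ((s + 1)\<^sup>2 * (s * t - x\<^sup>2)) = s * ((s + t + 2 * x) * (1 + s * t - 2 * x))" .
  moreover have "(s + 1) / s * (h / 2 * (1 + \<beta>\<^sup>2)) * (2 * (s + 1) * (4 * s * t - (2 * x)\<^sup>2)) =
      4 * h / s * ((1 + \<beta>\<^sup>2) * ((s + 1)\<^sup>2 * (s * t - x\<^sup>2)))"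
    using nz by (simp add: power2_eq_square field_simps)
  ultimately show ?thesis using nz by (simp add: x_def mult.assoc)
qed


section \<open>Zonal eigenfunctions for even diameter\<close>

context gen_polygon
begin

lemma card_sphere_thick:
  assumes u: "u \<in> V" "col u" and k: "0 < k" "k < n"
  shows "real (card (sphere u k)) =
    (if even k then real a * (real b - 1) * ((real a - 1) * (real b - 1)) ^ (k div 2 - 1)
     else real a * ((real a - 1) * (real b - 1)) ^ (k div 2))"
  using k
proof (induction k)
  case (Suc k)
  show ?case
  proof (cases "k = 0")
    case True
    then show ?thesis using card_sphere_Suc[OF u(1), of 0] card_sphere_0[OF u(1)] u(2) Suc.prems by simp
  next
    case False
    then have IH: "real (card (sphere u k)) =
      (if even k then real a * (real b - 1) * ((real a - 1) * (real b - 1)) ^ (k div 2 - 1)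
       else real a * ((real a - 1) * (real b - 1)) ^ (k div 2))" using Suc by simp
    have step: "real (card (sphere u (Suc k))) = real (card (sphere u k)) * (real (if even k then a else b) - 1)"
      using card_sphere_Suc[OF u(1), of k] u(2) Suc.prems False by simp
    show ?thesis
    proof (cases "even k")
      case True
      then obtain i where i: "k = 2 * Suc i" using False by (metis evenE mult_0_right not0_implies_Suc)
      show ?thesis unfolding step IH using i by simp
    next
      case odd: False
      then obtain i where i: "k = 2 * i + 1" by (metis oddE)
      show ?thesis unfolding step IH using i by simp
    qed
  qed
qed simp

text \<open>On even distances the zonal function is \<open>P\<close>, an eigenfunction of the
  squared adjacency operator; the values at odd distances are forced by one adjacency step. The
  multiplicity on one colour class is a natural number, so the norm is rational, and clearing its
  denominator gives the relation for \<open>x\<close>.\<close>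

lemma zonal_relation_even:
  assumes thick: "3 \<le> a" "3 \<le> b" and h: "n = 2 * h" "0 < j" "j < h" and V: "\<exists>u\<in>V. col u"
    and s: "s = real a - 1" and t: "t = real b - 1" and x: "x = 2 * sqrt (s * t) * cos (pi * real j / real h)"
  shows "\<exists>\<rho>\<in>\<rat>. (s + t + x) * (1 + s * t - x) = \<rho> * (4 * s * t - x\<^sup>2)"
proof -
  define \<phi> where "\<phi> = pi * real j / real h"
  define r where "r = sqrt (s * t)"
  \<comment> \<open>Solves the eigenvalue equation at distance 0, stated below as
    \<open>bot\<close>.\<close>
  define \<beta> where "\<beta> = ((s - 1) * (r * cos \<phi>) + s * (t - 1)) / ((s + 1) * r * sin \<phi>)"
  define P where "P i = (cos (real i * \<phi>) + \<beta> * sin (real i * \<phi>)) / r ^ i" for i :: nat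
  define y where "y = s + t + 2 * r * cos \<phi>"
  define \<theta> where "\<theta> = sqrt y"
  define p where "p k = (if even k then P (k div 2) else (P (k div 2) + t * P (Suc (k div 2))) / \<theta>)" for k
  have st: "2 \<le> s" "2 \<le> t" using thick by (auto simp: s t)
  have r: "r\<^sup>2 = s * t" "r * r = s * t" "0 < r" using st by (auto simp: r_def)
  have h\<phi>: "real h * \<phi> = pi * real j" using h by (simp add: \<phi>_def)
  have \<phi>: "0 < \<phi>" "\<phi> < pi" using h by (simp_all add: \<phi>_def field_simps)
  have sn: "0 < sin \<phi>" using sin_gt_zero[OF \<phi>] .
  \<comment> \<open>The squared eigenvalue \<open>y\<close> is positive by the inequality between
    the arithmetic and geometric means, so \<open>\<theta>\<close> may be divided by.\<close>
  have "- 1 < cos \<phi>" using cos_monotone_0_pi[of \<phi> pi] \<phi> by simp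
  then have "- (2 * r) < 2 * r * cos \<phi>" using mult_strict_left_mono[of "-1" "cos \<phi>" "2 * r"] r(3) by simp
  moreover have "2 * r \<le> s + t"
    using sum_squares_bound[of "sqrt s" "sqrt t"] st by (simp add: r_def real_sqrt_mult)
  ultimately have y: "0 < y" by (simp add: y_def)
  have \<theta>: "0 < \<theta>" "\<theta> * \<theta> = y" using y by (auto simp: \<theta>_def)
  have \<beta>: "(s + 1) * (r * \<beta> * sin \<phi>) = (s - 1) * (r * cos \<phi>) + s * (t - 1)"
    using sn r(3) st by (simp add: \<beta>_def)
  have P0: "P 0 = 1" by (simp add: P_def)
  have P1: "r * P 1 = cos \<phi> + \<beta> * sin \<phi>" using r(3) by (simp add: P_def)
  have sj: "sin (real h * \<phi>) = 0" "cos (real h * \<phi>) = (- 1) ^ j" unfolding h\<phi> by (simp_all add: mult.commute[of pi])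
  have Ph: "P h = (- 1) ^ j / r ^ h" by (simp add: P_def sj)
  have Prec: "P i + s * t * P (i + 2) = 2 * r * cos \<phi> * P (i + 1)" for i
    using trig_three_term[of r i \<phi> \<beta>] r by (simp add: P_def)
  have bot: "(s + 1) * (P 0 + t * P 1) = y * P 0"
  proof -
    have "r * r * P 1 = r * (cos \<phi> + \<beta> * sin \<phi>)" using P1 by simp
    then have "s * (t * P 1) = r * cos \<phi> + r * \<beta> * sin \<phi>" by (simp add: r(2) algebra_simps)
    then have "s * ((s + 1) * (P 0 + t * P 1)) = (s + 1) * s + (s + 1) * (r * cos \<phi>) + (s + 1) * (r * \<beta> * sin \<phi>)"
      using P0 by (simp add: algebra_simps)
    also have "\<dots> = s * (y * P 0)" unfolding \<beta> P0 y_def by (simp add: algebra_simps)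
    finally show ?thesis using st by simp
  qed
  \<comment> \<open>The same \<open>\<beta>\<close> meets the equation at distance \<open>n\<close>:
    \<open>h \<phi>\<close> is a multiple of pi, so up to sign the solution there is its reflection
    at 0.\<close>
  have top: "(s + 1) * (P (h - 1) + t * P h) = y * P h"
  proof -
    obtain g where g: "h = Suc g" using h by (cases h) auto
    have "real g * \<phi> = real h * \<phi> - \<phi>" by (simp add: g algebra_simps)
    then have "cos (real g * \<phi>) = (- 1) ^ j * cos \<phi>" "sin (real g * \<phi>) = - ((- 1) ^ j * sin \<phi>)"
      using sj by (simp_all add: cos_diff sin_diff)
    then have "P g = (cos \<phi> - \<beta> * sin \<phi>) * ((- 1) ^ j / r ^ g)" by (simp add: P_def algebra_simps)
    also have "(- 1) ^ j / r ^ g = r * P h" using r(3) Ph by (simp add: g)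
    finally have Pg: "P g = (r * cos \<phi> - r * \<beta> * sin \<phi>) * P h" by (simp add: algebra_simps)
    have "(s + 1) * (P g + t * P h) = ((s + 1) * (r * cos \<phi>) - (s + 1) * (r * \<beta> * sin \<phi>) + (s + 1) * t) * P h"
      unfolding Pg by (simp add: algebra_simps)
    also have "\<dots> = y * P h" unfolding \<beta> y_def by (simp add: algebra_simps)
    finally show ?thesis by (simp add: g)
  qed
  define W where "W = {v \<in> V. col v}"
  define \<kappa> where "\<kappa> k = (if k = 0 then 1 else if k = n then (s * t) ^ h / s else (s + 1) / s * (s * t) ^ (k div 2))" for k
  have eig: "(\<Sum>w | adj v w. p (d u w)) = \<theta> * p (d u v)" if u: "u \<in> W" and v: "v \<in> V" for u v
  proof -
    have u': "u \<in> V" "col u" using u by (auto simp: W_def)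
    define k where "k = d u v"
    have kn: "k \<le> n" using d_le[OF u'(1) v] by (simp add: k_def)
    have dgv: "real (dg v) = (if even k then s + 1 else t + 1)"
      using dg_dist[OF u'(1) v] u'(2) by (simp add: k_def s t)
    have sum: "(\<Sum>w | adj v w. p (d u w)) =
      (if k = 0 then dg v * p 1 else if k = n then dg v * p (n - 1) else p (k - 1) + (real (dg v) - 1) * p (Suc k))"
      unfolding k_def by (rule sum_nbrs_radial[OF u'(1) v])
    consider "k = 0" | "k = n" "k \<noteq> 0" | i where "k = 2 * i + 1" | i where "k = 2 * i + 2" "k < n"
    proof -
      assume c: "k = 0 \<Longrightarrow> thesis" "k = n \<Longrightarrow> k \<noteq> 0 \<Longrightarrow> thesis" "\<And>i. k = 2 * i + 1 \<Longrightarrow> thesis"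
        "\<And>i. k = 2 * i + 2 \<Longrightarrow> k < n \<Longrightarrow> thesis"
      show thesis
      proof (cases "even k")
        case True
        then obtain g where g: "k = 2 * g" by blast
        then show thesis using c(1,2) c(4)[of "g - 1"] kn by (cases g; cases "k = n") auto
      qed (use c(3) in \<open>auto elim: oddE\<close>)
    qed
    then have "(\<Sum>w | adj v w. p (d u w)) = \<theta> * p k"
    proof cases
      case 1
      have "\<theta> * ((s + 1) * p 1) = \<theta> * (\<theta> * p 0)" using bot \<theta> by (simp add: p_def mult.assoc[symmetric])
      then show ?thesis using sum dgv 1 \<theta>(1) by simp
    next
      case 2
      have e: "even n" "n div 2 = h" "odd (n - 1)" "(n - 1) div 2 = h - 1" "Suc (h - 1) = h" using h by auto
      have "\<theta> * ((s + 1) * p (n - 1)) = \<theta> * (\<theta> * p n)" using top \<theta> e by (simp add: p_def mult.assoc[symmetric])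
      then show ?thesis using sum dgv 2 e \<theta>(1) by simp
    next
      case (3 i)
      have "k \<noteq> n" using 3 h by presburger
      then have "(\<Sum>w | adj v w. p (d u w)) = p (k - 1) + t * p (Suc k)" using sum dgv 3 by simp
      also have "\<dots> = \<theta> * p k" using 3 \<theta>(1) by (simp add: p_def)
      finally show ?thesis .
    next
      case (4 i)
      have "(\<Sum>w | adj v w. p (d u w)) = p (k - 1) + s * p (Suc k)" using sum dgv 4 by simp
      also have "\<dots> = (P i + t * P (Suc i) + s * (P (Suc i) + t * P (Suc (Suc i)))) / \<theta>"
      proof -
        have "p (k - 1) = (P i + t * P (Suc i)) / \<theta>" "p (Suc k) = (P (Suc i) + t * P (Suc (Suc i))) / \<theta>"
          using 4 by (simp_all add: p_def)
        then show ?thesis by (simp add: add_divide_distrib distrib_left)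
      qed
      also have "P i + t * P (Suc i) + s * (P (Suc i) + t * P (Suc (Suc i))) = y * P (Suc i)"
        using Prec[of i] by (simp add: y_def algebra_simps)
      also have "y * P (Suc i) / \<theta> = \<theta> * P (Suc i)" using \<theta> by (simp add: \<theta>(2)[symmetric])
      finally show ?thesis using 4 by (simp add: p_def)
    qed
    then show ?thesis by (simp add: k_def)
  qed
  have \<kappa>: "real (card (sphere u k)) = \<kappa> k" if u: "u \<in> W" and k: "k \<in> {k. k \<le> n \<and> even k}" for u k
  proof -
    have u': "u \<in> V" "col u" using u by (auto simp: W_def)
    have a: "real a = s + 1" "real b = t + 1" by (simp_all add: s t)
    consider "k = 0" | "k = n" "k \<noteq> 0" | "0 < k" "k < n" using k by fastforce
    then show ?thesis
    proof cases
      case 1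
      then show ?thesis using card_sphere_0[OF u'(1)] by (simp add: \<kappa>_def)
    next
      case 2
      obtain g where g: "h = Suc g" using h by (cases h) auto
      have n1: "n - 1 = 2 * g + 1" "n = Suc (2 * g + 1)" using h g by auto
      have "real (card (sphere u n)) * real a = real (card (sphere u (2 * g + 1))) * (real b - 1)"
        using card_sphere_Suc[OF u'(1), of "2 * g + 1"] u'(2) n1 by simp
      moreover have "real (card (sphere u (2 * g + 1))) = real a * (s * t) ^ g"
        using card_sphere_thick[OF u', of "2 * g + 1"] n1 by (simp add: s t)
      ultimately have "real (card (sphere u n)) = (s * t) ^ g * t" using thick by (simp add: t)
      also have "\<dots> = (s * t) ^ h / s" using st by (simp add: g)
      finally show ?thesis using 2 by (simp add: \<kappa>_def)
    next
      case 3
      then obtain i where i: "k = 2 * Suc i" using k by (metis evenE mem_Collect_eq mult_0_right not0_implies_Suc less_irrefl)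
      have "real (card (sphere u k)) = (s + 1) * t * (s * t) ^ i"
        using card_sphere_thick[OF u', of k] 3 k i by (simp add: s t)
      also have "\<dots> = \<kappa> k" using 3 i st by (simp add: \<kappa>_def)
      finally show ?thesis .
    qed
  qed
  have J: "{k. k \<le> n \<and> even k} \<subseteq> {..n}" "0 \<in> {k. k \<le> n \<and> even k}" by auto
  have WJ: "v \<in> W \<longleftrightarrow> d u v \<in> {k. k \<le> n \<and> even k}" if "u \<in> W" "v \<in> V" for u v
    using that d_even[of u v] d_le[of u v] by (auto simp: W_def)
  have p0: "p 0 = 1" by (simp add: p_def P0)
  obtain m :: nat where m: "real m * (\<Sum>k | k \<le> n \<and> even k. \<kappa> k * (p k)\<^sup>2) = real (card W)"
    using zonal_multiplicity[OF _ p0 eig J WJ \<kappa>] by (auto simp: W_def)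
  have "(\<Sum>k | k \<le> n \<and> even k. \<kappa> k * (p k)\<^sup>2) = (\<Sum>i\<le>h. \<kappa> (2 * i) * (P i)\<^sup>2)"
    by (rule sum.reindex_bij_witness[of _ "\<lambda>i. 2 * i" "\<lambda>k. k div 2"]) (auto simp: h p_def)
  also have "\<dots> = (\<Sum>i\<le>h. (if i = 0 then 1 else if i = h then (s * t) ^ h / s else (s + 1) / s * (s * t) ^ i) * (P i)\<^sup>2)"
    by (intro sum.cong) (auto simp: \<kappa>_def h)
  also have "\<dots> = (s + 1) / s * (real h / 2 * (1 + \<beta>\<^sup>2))"
    unfolding P_def using st by (intro trig_weighted_square_sum[OF h(2,3) \<phi>_def r(3,1)]) simp
  finally have c: "real m * ((s + 1) / s * (real h / 2 * (1 + \<beta>\<^sup>2))) = real (card W)" using m by simp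
  have xr: "x = 2 * r * cos \<phi>" by (simp add: x r_def \<phi>_def)
  have norm: "(s + 1) / s * (real h / 2 * (1 + \<beta>\<^sup>2)) * (2 * (s + 1) * (4 * s * t - x\<^sup>2)) =
      4 * real h * ((s + t + x) * (1 + s * t - x))"
    unfolding xr using zonal_norm_even[of s t "sin \<phi>" "cos \<phi>" r \<beta> "real h"] st sn r \<beta>_def by (simp add: sin_squared_eq)
  have "0 < card W" using V fin by (auto simp: W_def card_gt_0_iff)
  then have m0: "m \<noteq> 0" using c by (intro notI) simp
  have "real (card W) * (2 * (s + 1) * (4 * s * t - x\<^sup>2)) = real m * (4 * real h * ((s + t + x) * (1 + s * t - x)))"
    unfolding c[symmetric] norm[symmetric] by (simp only: mult.assoc)
  then have "(s + t + x) * (1 + s * t - x) = (real (card W) * (s + 1) / (2 * real m * real h)) * (4 * s * t - x\<^sup>2)"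
    using m0 h by (simp add: field_simps)
  moreover have "real (card W) * (s + 1) / (2 * real m * real h) \<in> \<rat>" by (simp add: s)
  ultimately show ?thesis by blast
qed

end

section \<open>Equal degrees, odd diameter, and the exclusion of large diameters\<close>

context gen_polygon
begin

text \<open>With equal degrees the recurrence has constant coefficients on all of \<open>V\<close>,
  so the zonal function at angle \<open>pi / n\<close> is explicit without squaring the operator.
  Its norm is rational and involves the angle only through the squared cosine, for which the
  resulting equation is solved.\<close>

lemma zonal_rational_odd:
  assumes ab: "a = b" and a: "3 \<le> a" and V: "V \<noteq> {}" and n: "3 \<le> n"
  shows "cos (2 * pi / real n) \<in> \<rat>"
proof -
  define s where "s = real a - 1"
  define \<eta> where "\<eta> = pi * real 1 / real n"
  define r where "r = sqrt s"
  define \<beta> where "\<beta> = (s - 1) * cos \<eta> / ((s + 1) * sin \<eta>)"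
  define p where "p k = (cos (real k * \<eta>) + \<beta> * sin (real k * \<eta>)) / r ^ k" for k :: nat
  define \<theta> where "\<theta> = 2 * r * cos \<eta>"
  have s: "2 \<le> s" using a by (simp add: s_def)
  have r: "r\<^sup>2 = s" "r * r = s" "0 < r" using s by (auto simp: r_def)
  have n\<eta>: "real n * \<eta> = pi" using n by (simp add: \<eta>_def)
  have \<eta>: "0 < \<eta>" "\<eta> < pi" using n by (simp_all add: \<eta>_def field_simps)
  have sn: "0 < sin \<eta>" using sin_gt_zero[OF \<eta>] .
  have \<beta>: "(s + 1) * (\<beta> * sin \<eta>) = (s - 1) * cos \<eta>" using sn s by (simp add: \<beta>_def)
  have p0: "p 0 = 1" by (simp add: p_def)
  have pn: "p n = - 1 / r ^ n" by (simp add: p_def n\<eta>)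
  have prec: "p i + s * p (i + 2) = \<theta> * p (i + 1)" for i
    using trig_three_term[of r i \<eta> \<beta>] r by (simp add: p_def \<theta>_def)
  have bot: "(s + 1) * p 1 = \<theta> * p 0"
  proof -
    have "r * p 1 = cos \<eta> + \<beta> * sin \<eta>" using r(3) by (simp add: p_def)
    then have "r * ((s + 1) * p 1) = (s + 1) * cos \<eta> + (s + 1) * (\<beta> * sin \<eta>)"
      by (metis distrib_left mult.left_commute)
    also have "\<dots> = r * (\<theta> * p 0)" unfolding \<beta> \<theta>_def p0 using r(2) by (simp add: algebra_simps)
    finally show ?thesis using r(3) by simp
  qed
  have top: "(s + 1) * p (n - 1) = \<theta> * p n"
  proof -
    obtain g where g: "n = Suc g" using n by (cases n) auto
    have "real g * \<eta> = real n * \<eta> - \<eta>" by (simp add: g algebra_simps)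
    then have "cos (real g * \<eta>) = - cos \<eta>" "sin (real g * \<eta>) = sin \<eta>"
      using n\<eta> by (simp_all add: cos_diff sin_diff)
    then have "p g = (cos \<eta> - \<beta> * sin \<eta>) * (- 1 / r ^ g)"
      using r(3) by (simp add: p_def field_simps)
    also have "- 1 / r ^ g = r * p n" using r(3) pn by (simp add: g)
    finally have pg: "p g = (cos \<eta> - \<beta> * sin \<eta>) * (r * p n)" .
    have "(s + 1) * p g = ((s + 1) * cos \<eta> - (s + 1) * (\<beta> * sin \<eta>)) * (r * p n)"
      unfolding pg by (simp add: algebra_simps)
    also have "\<dots> = \<theta> * p n" unfolding \<beta> \<theta>_def by (simp add: algebra_simps)
    finally show ?thesis by (simp add: g)
  qed
  have if1: "real (if X then a else b) = s + 1" for X using ab by (simp add: s_def)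
  have dgv: "real (dg v) = s + 1" for v unfolding dg_def by (rule if1)
  define \<kappa> where "\<kappa> k = (if k = 0 then 1 else if k = n then s ^ n / s else (s + 1) / s * s ^ k)" for k
  have eig: "(\<Sum>w | adj v w. p (d u w)) = \<theta> * p (d u v)" if u: "u \<in> V" and v: "v \<in> V" for u v
  proof -
    define k where "k = d u v"
    have sum: "(\<Sum>w | adj v w. p (d u w)) =
      (if k = 0 then dg v * p 1 else if k = n then dg v * p (n - 1) else p (k - 1) + (real (dg v) - 1) * p (Suc k))"
      unfolding k_def by (rule sum_nbrs_radial[OF u v])
    show ?thesis
    proof (cases "k = 0 \<or> k = n")
      case True
      then show ?thesis using sum bot top dgv[of v] n by (auto simp: k_def[symmetric])
    next
      case False
      then obtain i where "k = Suc i" by (cases k) auto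
      then show ?thesis using sum dgv[of v] False prec[of i] by (simp add: k_def[symmetric])
    qed
  qed
  have card: "real (card (sphere u k)) = (s + 1) / s * s ^ k" if u: "u \<in> V" and k: "0 < k" "k < n" for u k
    using k
  proof (induction k)
    case (Suc k)
    show ?case
    proof (cases "k = 0")
      case True
      then show ?thesis using card_sphere_Suc[OF u, of 0] card_sphere_0[OF u] Suc.prems s unfolding if1 by simp
    next
      case False
      then show ?thesis using card_sphere_Suc[OF u, of k] Suc s unfolding if1 by simp
    qed
  qed simp
  have \<kappa>: "real (card (sphere u k)) = \<kappa> k" if u: "u \<in> V" and k: "k \<in> {..n}" for u k
  proof -
    consider "k = 0" | "k = n" "k \<noteq> 0" | "0 < k" "k < n" using k by fastforce
    then show ?thesis
    proof cases
      case 1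
      then show ?thesis using card_sphere_0[OF u] by (simp add: \<kappa>_def)
    next
      case 2
      obtain g where g: "n = Suc g" using n by (cases n) auto
      have "real (card (sphere u n)) * (s + 1) = (s + 1) / s * s ^ g * s"
        using card_sphere_Suc[OF u, of g] card[OF u, of g] g n unfolding if1 by simp
      then have "real (card (sphere u n)) = s ^ g" using s by simp
      then show ?thesis using 2 g s by (simp add: \<kappa>_def)
    next
      case 3
      then show ?thesis using card[OF u] by (simp add: \<kappa>_def)
    qed
  qed
  have W: "v \<in> V \<longleftrightarrow> d u v \<in> {..n}" if "u \<in> V" "v \<in> V" for u v using that d_le by auto
  obtain m :: nat where m: "real m * (\<Sum>k\<le>n. \<kappa> k * (p k)\<^sup>2) = real (card V)"
    using zonal_multiplicity[OF order_refl p0 eig _ _ W \<kappa>] by auto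
  moreover have "(\<Sum>k\<le>n. \<kappa> k * (p k)\<^sup>2) = (s + 1) / s * (real n / 2 * (1 + \<beta>\<^sup>2))"
    unfolding p_def \<kappa>_def using n s by (intro trig_weighted_square_sum[OF _ _ \<eta>_def r(3,1)]) simp_all
  ultimately have c: "real m * ((s + 1) / s * (real n / 2 * (1 + \<beta>\<^sup>2))) = real (card V)" by simp
  define C where "C = (cos \<eta>)\<^sup>2"
  have sC: "(sin \<eta>)\<^sup>2 = 1 - C" by (simp add: C_def sin_squared_eq)
  have nzC: "1 - C \<noteq> 0" using sC sn by auto
  have "\<beta>\<^sup>2 = (s - 1)\<^sup>2 * C / ((s + 1)\<^sup>2 * (1 - C))"
    by (simp add: \<beta>_def power_divide power_mult_distrib C_def[symmetric] sC)
  then have "(1 + \<beta>\<^sup>2) * ((s + 1)\<^sup>2 * (1 - C)) = (s + 1)\<^sup>2 * (1 - C) + (s - 1)\<^sup>2 * C"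
    using nzC s by (simp add: field_simps)
  also have "\<dots> = (s + 1)\<^sup>2 - 4 * s * C" by (simp add: power2_eq_square algebra_simps)
  finally have norm: "(1 + \<beta>\<^sup>2) * ((s + 1)\<^sup>2 * (1 - C)) = (s + 1)\<^sup>2 - 4 * s * C" .
  have "0 < card V" using V fin by (simp add: card_gt_0_iff)
  then have m0: "m \<noteq> 0" using c by (intro notI) simp
  define \<rho> where "\<rho> = (s + 1)\<^sup>2 * (real (card V) * 2 * s / (real m * real n * (s + 1)))"
  have "1 + \<beta>\<^sup>2 = real (card V) * 2 * s / (real m * real n * (s + 1))"
  proof -
    have "(1 + \<beta>\<^sup>2) * (real m * real n * (s + 1)) = real (card V) * 2 * s"
      using c[symmetric] s by (simp add: field_simps)
    moreover have "real m * real n * (s + 1) \<noteq> 0" using m0 n s by simp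
    ultimately show ?thesis by (simp only: eq_divide_eq) simp
  qed
  then have eq: "\<rho> * (1 - C) = (s + 1)\<^sup>2 - 4 * s * C" using norm by (simp add: \<rho>_def mult_ac)
  have \<rho>: "\<rho> \<in> \<rat>" "s \<in> \<rat>" by (simp_all add: \<rho>_def s_def)
  \<comment> \<open>This is the denominator of the solution for \<open>C\<close>; it vanishes only
    if \<open>s = 1\<close>.\<close>
  have "\<rho> \<noteq> 4 * s"
  proof
    assume "\<rho> = 4 * s"
    then have "(s - 1)\<^sup>2 = 0" using eq by (simp add: power2_eq_square algebra_simps)
    then show False using s by simp
  qed
  then have "C = (\<rho> - (s + 1)\<^sup>2) / (\<rho> - 4 * s)" using eq by (simp add: field_simps)
  then have "C \<in> \<rat>" using \<rho> by simp
  moreover have "cos (2 * pi / real n) = 2 * C - 1"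
    using cos_double_cos[of \<eta>] by (simp add: C_def \<eta>_def)
  ultimately show ?thesis by simp
qed

text \<open>A geodesic extends up to length \<open>n\<close>: at most one neighbour is closer to its
  start, and every vertex has at least two neighbours.\<close>

lemma opposite_exists:
  assumes ab: "2 \<le> a" "2 \<le> b" and u: "u \<in> V"
  shows "\<exists>v\<in>V. d u v = n"
proof -
  have "\<exists>v\<in>V. d u v = k" if "k \<le> n" for k
    using that
  proof (induction k)
    case 0
    then show ?case using d_refl[OF u] u by blast
  next
    case (Suc k)
    then obtain v where v: "v \<in> V" "d u v = k" by auto
    have "{w. adj v w} \<noteq> {w. adj v w \<and> d u v = Suc (d u w)}"
    proof (cases k)
      case 0
      then have "{w. adj v w \<and> d u v = Suc (d u w)} = {}" using v by simp
      moreover have "card {w. adj v w} \<noteq> 0" using card_nbrs[OF v(1)] dg_pos[of v] by simp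
      ultimately show ?thesis by (metis card.empty)
    next
      case (Suc j)
      then have "card {w. adj v w \<and> d u w = j} = 1" using card_closer[OF u v(1)] v(2) Suc.prems by simp
      moreover have "{w. adj v w \<and> d u v = Suc (d u w)} = {w. adj v w \<and> d u w = j}" using v(2) Suc by auto
      moreover have "card {w. adj v w} \<ge> 2" using card_nbrs[OF v(1)] ab by (simp add: dg_def)
      ultimately have "card {w. adj v w} \<noteq> card {w. adj v w \<and> d u v = Suc (d u w)}" by simp
      then show ?thesis by metis
    qed
    then obtain w where "adj v w" "d u v \<noteq> Suc (d u w)" by blast
    then show ?case using d_step[OF u] v(2) adj_V' by blast
  qed
  then show ?thesis by blast
qed

text \<open>Opposite vertices have equally many neighbours: each neighbour of one is at distance
  \<open>n - 2\<close> from exactly one neighbour of the other. For odd \<open>n\<close> opposite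
  vertices have different colours, so this compares \<open>a\<close> with \<open>b\<close>.\<close>

lemma regular_of_odd:
  assumes n: "odd n" and ab: "2 \<le> a" "2 \<le> b" and V: "V \<noteq> {}"
  shows "a = b"
proof -
  obtain u where u: "u \<in> V" using V by blast
  obtain v where v: "v \<in> V" "d u v = n" using opposite_exists[OF ab u] by blast
  have n3: "3 \<le> n" using n n2 by presburger
  have far: "d w x = n - 1" if "adj x y" "w \<in> V" "d w y = n" for w x y
  proof -
    have "d w x \<le> n" "d w x = Suc (d w y) \<or> d w y = Suc (d w x)"
      using d_le[OF that(2) adj_V[OF that(1)]] d_step[OF that(2) adj_sym[OF that(1)]] by auto
    then show ?thesis using that(3) by simp
  qed
  have one: "\<exists>!y. adj v y \<and> d w y = n - 2" if w: "adj u w" for w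
  proof -
    have wV: "w \<in> V" using adj_V'[OF w] .
    have "d v u = n" using v d_sym[OF u v(1)] by simp
    then have "d v w = n - 1" using far[OF adj_sym[OF w] v(1)] by simp
    then have "d w v = n - 1" using d_sym[OF wV v(1)] by simp
    then show ?thesis using d_down[OF wV v(1)] n3 by (auto simp: numeral_2_eq_2 Suc_diff_Suc)
  qed
  have two: "\<exists>!w. adj u w \<and> d w y = n - 2" if y: "adj v y" for y
  proof -
    have yV: "y \<in> V" using adj_V'[OF y] .
    have "d u y = n - 1" using far[OF adj_sym[OF y] u] v by simp
    then have "d y u = n - 1" using d_sym[OF u yV] by simp
    then have "\<exists>!w. adj u w \<and> n - 1 = Suc (d y w)" using d_down[OF yV u] n3 by simp
    moreover have "n - 1 = Suc (d y w) \<longleftrightarrow> d w y = n - 2" if "adj u w" for w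
      using d_sym[OF yV adj_V'[OF that]] n3 by auto
    ultimately show ?thesis by metis
  qed
  have "bij_betw (\<lambda>w. THE y. adj v y \<and> d w y = n - 2) {w. adj u w} {y. adj v y}"
  proof (rule bij_betwI[of _ _ _ "\<lambda>y. THE w. adj u w \<and> d w y = n - 2"])
    show "(\<lambda>w. THE y. adj v y \<and> d w y = n - 2) \<in> {w. adj u w} \<rightarrow> {y. adj v y}"
      using theI'[OF one] by auto
    show "(\<lambda>y. THE w. adj u w \<and> d w y = n - 2) \<in> {y. adj v y} \<rightarrow> {w. adj u w}"
      using theI'[OF two] by auto
    show "(THE w'. adj u w' \<and> d w' (THE y. adj v y \<and> d w y = n - 2) = n - 2) = w" if "w \<in> {w. adj u w}" for w
    proof -
      have w: "adj u w" using that by simp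
      have y: "adj v (THE y. adj v y \<and> d w y = n - 2)" "d w (THE y. adj v y \<and> d w y = n - 2) = n - 2"
        using theI'[OF one[OF w]] by auto
      show ?thesis by (rule the1_equality[OF two[OF y(1)]]) (use w y in blast)
    qed
    show "(THE y'. adj v y' \<and> d (THE w. adj u w \<and> d w y = n - 2) y' = n - 2) = y" if "y \<in> {y. adj v y}" for y
    proof -
      have y: "adj v y" using that by simp
      have w: "adj u (THE w. adj u w \<and> d w y = n - 2)" "d (THE w. adj u w \<and> d w y = n - 2) y = n - 2"
        using theI'[OF two[OF y]] by auto
      show ?thesis by (rule the1_equality[OF one[OF w(1)]]) (use w y in blast)
    qed
  qed
  then have "card {w. adj u w} = card {y. adj v y}" by (rule bij_betw_same_card)
  then have "dg u = dg v" using card_nbrs[OF u] card_nbrs[OF v(1)] by simp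
  moreover have "col u \<noteq> col v" using d_even[OF u v(1)] v(2) n by simp
  ultimately show ?thesis by (auto simp: dg_def split: if_splits)
qed

text \<open>For odd \<open>n \<ge> 9\<close>, \<open>2 cos (2 pi / n)\<close> would be an integer
  strictly between 1 and 2. For \<open>n = 2 h\<close> with \<open>h \<ge> 5\<close>,
  \<open>2 cos (2 pi / h)\<close> is an integer strictly between 0 and 2; the value 1 means
  \<open>h = 6\<close>, which is excluded by the irrationality of \<open>sqrt 3\<close>.\<close>

theorem feit_higman:
  assumes thick: "3 \<le> a" "3 \<le> b" and V: "V \<noteq> {}"
  shows "n \<le> 8"
proof (rule ccontr)
  assume "\<not> n \<le> 8"
  then have n9: "9 \<le> n" by simp
  show False
  proof (cases "odd n")
    case True
    have "a = b" using regular_of_odd[OF True _ _ V] thick by simp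
    then have "2 * cos (2 * pi * real 1 / real n) \<in> \<rat>" using zonal_rational_odd[OF _ thick(1) V] n9 by simp
    then have "2 * cos (2 * pi * real 1 / real n) \<in> \<int>" by (rule rational_cos_integer[rotated]) (use n9 in simp)
    then obtain z :: int where z: "2 * cos (2 * pi / real n) = of_int z" by (auto elim: Ints_cases)
    have "cos (pi / 3) < cos (2 * pi / real n)"
      using n9 by (intro cos_monotone_0_pi) (auto simp: field_simps)
    moreover have "cos (2 * pi / real n) < cos 0"
      using n9 by (intro cos_monotone_0_pi) (auto simp: field_simps)
    ultimately have "1 < real_of_int z" "real_of_int z < 2" using z by (simp_all add: cos_60)
    then have "1 < z" "z < 2" by simp_all
    then show False by simp
  next
    case False
    then obtain h where h: "n = 2 * h" by blast
    have h5: "5 \<le> h" using n9 h by simp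
    obtain v where v: "v \<in> V" using V by blast
    have "card {w. adj v w} \<noteq> 0" using card_nbrs[OF v] dg_pos[of v] by simp
    then obtain w where w: "adj v w" by (metis Collect_empty_eq card.empty)
    have colV: "\<exists>u\<in>V. col u" using v w adj_col[OF w] adj_V'[OF w] by blast
    define s t where "s = real a - 1" and "t = real b - 1"
    define r where "r = sqrt (s * t)"
    have st: "2 \<le> s" "2 \<le> t" "s \<in> \<rat>" "t \<in> \<rat>" using thick by (auto simp: s_def t_def)
    have r: "0 < r" "r\<^sup>2 = s * t" using st by (auto simp: r_def)
    have x: "2 * r * cos (pi * real j / real h) \<in> \<rat>" if j: "0 < j" "j < h" for j
    proof -
      define x where "x = 2 * r * cos (pi * real j / real h)"
      have "x = 2 * sqrt (s * t) * cos (pi * real j / real h)" by (simp add: x_def r_def)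
      from zonal_relation_even[OF thick h j colV s_def t_def this]
      obtain \<rho> where \<rho>: "\<rho> \<in> \<rat>" "(s + t + x) * (1 + s * t - x) = \<rho> * (4 * s * t - x\<^sup>2)" by blast
      have "pi * real (h - j) / real h = pi - pi * real j / real h"
        using j by (simp add: of_nat_diff field_simps)
      \<comment> \<open>Replacing \<open>j\<close> by \<open>h - j\<close> changes the sign of
        \<open>x\<close> and supplies the second relation.\<close>
      then have "- x = 2 * sqrt (s * t) * cos (pi * real (h - j) / real h)" by (simp add: x_def r_def)
      from zonal_relation_even[OF thick h _ _ colV s_def t_def this] j
      obtain \<rho>' where \<rho>': "\<rho>' \<in> \<rat>" "(s + t + (- x)) * (1 + s * t - (- x)) = \<rho>' * (4 * s * t - (- x)\<^sup>2)"
        by auto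
      show ?thesis using mult_scaled_sum[OF st \<rho>(2,1), of \<rho>'] \<rho>' by (simp add: x_def)
    qed
    \<comment> \<open>Squaring replaces the possibly irrational \<open>r\<close> by the rational
      \<open>s t\<close> and doubles the angle.\<close>
    have "(2 * r * cos (pi * real 1 / real h))\<^sup>2 \<in> \<rat>" using x[of 1] h5 by simp
    moreover have "(2 * r * cos (pi * real 1 / real h))\<^sup>2 = 2 * (s * t) * (1 + cos (2 * (pi * real 1 / real h)))"
      unfolding cos_double_cos power_mult_distrib r(2) by (simp add: algebra_simps)
    ultimately have "2 * (s * t) * (1 + cos (2 * (pi * real 1 / real h))) \<in> \<rat>" by simp
    then have "(2 * (s * t) * (1 + cos (2 * (pi * real 1 / real h)))) / (s * t) - 2 \<in> \<rat>"
      using st by (intro Rats_diff Rats_divide) auto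
    moreover have "(2 * (s * t) * (1 + cos (2 * (pi * real 1 / real h)))) / (s * t) - 2 = 2 * cos (2 * pi * real 1 / real h)"
      using st by (simp add: field_simps)
    ultimately have "2 * cos (2 * pi * real 1 / real h) \<in> \<rat>" by simp
    then have "2 * cos (2 * pi * real 1 / real h) \<in> \<int>" by (rule rational_cos_integer[rotated]) (use h5 in simp)
    then obtain z :: int where z: "2 * cos (2 * pi / real h) = of_int z" by (auto elim: Ints_cases)
    have "cos (pi / 2) < cos (2 * pi / real h)"
      using h5 by (intro cos_monotone_0_pi) (auto simp: field_simps)
    moreover have "cos (2 * pi / real h) < cos 0"
      using h5 by (intro cos_monotone_0_pi) (auto simp: field_simps)
    ultimately have "0 < real_of_int z" "real_of_int z < 2" using z by simp_all
    then have "0 < z" "z < 2" by simp_all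
    then have "z = 1" by simp
    then have "cos (2 * pi / real h) = cos (pi / 3)" using z by (simp add: cos_60)
    then have "2 * pi / real h = pi / 3"
      using cos_inj_pi[of "2 * pi / real h" "pi / 3"] h5 by (auto simp: field_simps)
    then have h6: "real h = 6" using h5 by (simp add: field_simps)
    \<comment> \<open>The 12-gon survives the integrality test. Two rational scaled cosines have the
      quotient \<open>sqrt 3\<close>, since the unknown \<open>r\<close> cancels.\<close>
    have "2 * r * cos (pi / 6) \<in> \<rat>" "2 * r * cos (pi / 3) \<in> \<rat>" using x[of 1] x[of 2] h6 h5 by simp_all
    then have "(2 * r * cos (pi / 6)) / (2 * r * cos (pi / 3)) \<in> \<rat>" by (rule Rats_divide)
    then have "sqrt 3 \<in> \<rat>" using r(1) by (simp add: cos_30 cos_60)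
    moreover have "algebraic_int (sqrt 3)"
      using int_imp_algebraic_int[of "3 :: real"] by (intro algebraic_int_sqrt) simp
    ultimately have "sqrt 3 \<in> \<int>" using rational_algebraic_int_is_int by blast
    then obtain i :: int where i: "sqrt 3 = of_int i" by (auto elim: Ints_cases)
    have "1 < sqrt (3 :: real)" "sqrt (3 :: real) < 2" by (auto intro: real_less_lsqrt)
    then have "1 < i" "i < 2" unfolding i by simp_all
    then show False by simp
  qed
qed

end

section \<open>Trickling down\<close>

definition star :: "'a set set \<Rightarrow> 'a set \<Rightarrow> 'a set set" where
  "star Ch x = {c \<in> Ch. x \<subseteq> c}"

text \<open>If the faces of \<open>c - x\<close> have \<open>k + 1\<close> vertices, the constant \<open>M = 1 + k\<mu>\<close> corresponds to the
  bound \<open>\<mu>\<close> for the averaging operator of the link of \<open>x\<close>.\<close>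

definition spectral_bound :: "'a set set \<Rightarrow> 'a set \<Rightarrow> real \<Rightarrow> bool" where
  "spectral_bound Ch x M \<longleftrightarrow> (\<forall>f :: 'a \<Rightarrow> real. (\<Sum>c\<in>star Ch x. \<Sum>v\<in>c - x. f v) = 0 \<longrightarrow>
     (\<Sum>c\<in>star Ch x. (\<Sum>v\<in>c - x. f v)\<^sup>2) \<le> M * (\<Sum>c\<in>star Ch x. \<Sum>v\<in>c - x. (f v)\<^sup>2))"

lemma spectral_bound_mono:
  assumes "spectral_bound Ch x M" "M \<le> M'"
  shows "spectral_bound Ch x M'"
  unfolding spectral_bound_def
proof (intro allI impI)
  fix f :: "'a \<Rightarrow> real" assume "(\<Sum>c\<in>star Ch x. \<Sum>v\<in>c - x. f v) = 0"
  then have "(\<Sum>c\<in>star Ch x. (\<Sum>v\<in>c - x. f v)\<^sup>2) \<le> M * (\<Sum>c\<in>star Ch x. \<Sum>v\<in>c - x. (f v)\<^sup>2)"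
    using assms(1) by (simp add: spectral_bound_def)
  also have "\<dots> \<le> M' * (\<Sum>c\<in>star Ch x. \<Sum>v\<in>c - x. (f v)\<^sup>2)"
    using assms(2) by (intro mult_right_mono sum_nonneg) auto
  finally show "(\<Sum>c\<in>star Ch x. (\<Sum>v\<in>c - x. f v)\<^sup>2) \<le> M' * (\<Sum>c\<in>star Ch x. \<Sum>v\<in>c - x. (f v)\<^sup>2)" .
qed

locale star_system =
  fixes Ch :: "'a set set" and x :: "'a set" and k :: nat
  assumes fin: "finite Ch" and fin_c: "\<And>c. c \<in> Ch \<Longrightarrow> finite c"
    and size: "\<And>c. c \<in> star Ch x \<Longrightarrow> card (c - x) = Suc k"
begin

definition V :: "'a set" where "V = \<Union>(star Ch x) - x"

definition N :: "'a \<Rightarrow> real" where "N v = card {c \<in> star Ch x. v \<in> c}"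

lemma finite_star: "finite (star Ch x)" using fin by (simp add: star_def)

lemma finite_V: "finite V" using finite_star fin_c by (auto simp: V_def star_def)

lemma swap:
  fixes g :: "'a set \<Rightarrow> 'a \<Rightarrow> real"
  shows "(\<Sum>c\<in>star Ch x. \<Sum>v\<in>c - x. g c v) = (\<Sum>v\<in>V. \<Sum>c | c \<in> star Ch x \<and> v \<in> c. g c v)"
proof -
  have "(\<Sum>c\<in>star Ch x. \<Sum>v\<in>c - x. g c v) = (\<Sum>c\<in>star Ch x. \<Sum>v | v \<in> V \<and> v \<in> c. g c v)"
    by (intro sum.cong HOL.refl) (auto simp: V_def)
  also have "\<dots> = (\<Sum>v\<in>V. \<Sum>c | c \<in> star Ch x \<and> v \<in> c. g c v)"
    by (rule sum.swap_restrict[OF finite_star finite_V])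
  finally show ?thesis .
qed

lemma sum_single: "(\<Sum>c\<in>star Ch x. \<Sum>v\<in>c - x. f v) = (\<Sum>v\<in>V. N v * f v)"
  for f :: "'a \<Rightarrow> real"
  by (simp add: swap N_def)

lemma N_pos: "v \<in> V \<Longrightarrow> 0 < N v"
  using finite_star by (auto simp: N_def V_def card_gt_0_iff)

text \<open>The sum of squared chamber sums is the form whose kernel counts the chambers containing
  two given vertices. Its row sums are \<open>k + 1\<close> times \<open>N\<close>, so the Rayleigh
  bound is used with the rescaled weight \<open>N'\<close>.\<close>

lemma spectral_boundI:
  assumes eig: "\<And>f t. \<lbrakk>\<exists>v\<in>V. f v \<noteq> 0; (\<Sum>c\<in>star Ch x. \<Sum>v\<in>c - x. f v) = 0;
      \<And>v. v \<in> V \<Longrightarrow> (\<Sum>c | c \<in> star Ch x \<and> v \<in> c. \<Sum>u\<in>c - x. f u) = t * N v * f v\<rbrakk> \<Longrightarrow> t \<le> M"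
  shows "spectral_bound Ch x M"
  unfolding spectral_bound_def
proof (intro allI impI)
  fix f :: "'a \<Rightarrow> real" assume f: "(\<Sum>c\<in>star Ch x. \<Sum>v\<in>c - x. f v) = 0"
  define K where "K v u = real (card {c \<in> star Ch x. v \<in> c \<and> u \<in> c})" for v u
  define N' where "N' v = real (Suc k) * N v" for v
  have Ksum: "(\<Sum>u\<in>V. K v u * g u) = (\<Sum>c | c \<in> star Ch x \<and> v \<in> c. \<Sum>u\<in>c - x. g u)" for v and g :: "'a \<Rightarrow> real"
  proof -
    have fin': "finite {c \<in> star Ch x. v \<in> c}" using finite_star by simp
    have "(\<Sum>c | c \<in> star Ch x \<and> v \<in> c. \<Sum>u\<in>c - x. g u) = (\<Sum>c\<in>{c \<in> star Ch x. v \<in> c}. \<Sum>u | u \<in> V \<and> u \<in> c. g u)"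
      by (intro sum.cong HOL.refl) (auto simp: V_def)
    also have "\<dots> = (\<Sum>u\<in>V. \<Sum>c | c \<in> {c \<in> star Ch x. v \<in> c} \<and> u \<in> c. g u)"
      by (rule sum.swap_restrict[OF fin' finite_V])
    also have "\<dots> = (\<Sum>u\<in>V. K v u * g u)" by (simp add: K_def conj_assoc)
    finally show ?thesis by simp
  qed
  have "(\<Sum>v\<in>V. \<Sum>u\<in>V. K v u * f v * f u) \<le> M / real (Suc k) * (\<Sum>v\<in>V. N' v * (f v)\<^sup>2)"
  proof (rule rayleigh_le_of_eigenvalues_le[OF finite_V])
    show "0 < N' v" if "v \<in> V" for v using N_pos[OF that] by (simp add: N'_def)
    show "K u v = K v u" for u v by (simp add: K_def conj_commute)
    show "(\<Sum>u\<in>V. K v u) = N' v" if "v \<in> V" for v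
    proof -
      have "(\<Sum>u\<in>V. K v u) = (\<Sum>c | c \<in> star Ch x \<and> v \<in> c. \<Sum>u\<in>c - x. 1)" using Ksum[of v "\<lambda>_. 1"] by simp
      also have "\<dots> = (\<Sum>c | c \<in> star Ch x \<and> v \<in> c. real (Suc k))"
        using size by (intro sum.cong HOL.refl) simp
      finally show ?thesis by (simp add: N'_def N_def)
    qed
    show "(\<Sum>v\<in>V. N' v * f v) = 0"
      using f by (simp add: sum_single N'_def mult.assoc sum_distrib_left[symmetric] del: of_nat_Suc)
    show "\<alpha> \<le> M / real (Suc k)" if g: "\<exists>v\<in>V. g v \<noteq> 0" "(\<Sum>v\<in>V. N' v * g v) = 0"
      "\<And>v. v \<in> V \<Longrightarrow> (\<Sum>u\<in>V. K v u * g u) = \<alpha> * N' v * g v" for g \<alpha>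
    proof -
      have "real (Suc k) * (\<Sum>v\<in>V. N v * g v) = 0"
        using g(2) by (simp add: N'_def mult.assoc sum_distrib_left[symmetric] del: of_nat_Suc)
      then have "(\<Sum>v\<in>V. N v * g v) = 0" by simp
      then have "\<alpha> * real (Suc k) \<le> M"
        using g(3) by (intro eig[OF g(1)]) (auto simp: sum_single Ksum N'_def mult.assoc)
      then show ?thesis by (simp add: field_simps)
    qed
  qed
  also have "M / real (Suc k) * (\<Sum>v\<in>V. N' v * (f v)\<^sup>2) = M * (\<Sum>c\<in>star Ch x. \<Sum>v\<in>c - x. (f v)\<^sup>2)"
    by (simp add: sum_single N'_def mult.assoc sum_distrib_left[symmetric] del: of_nat_Suc)
  also have "(\<Sum>v\<in>V. \<Sum>u\<in>V. K v u * f v * f u) = (\<Sum>c\<in>star Ch x. (\<Sum>v\<in>c - x. f v)\<^sup>2)"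
  proof -
    have "(\<Sum>v\<in>V. \<Sum>u\<in>V. K v u * f v * f u) = (\<Sum>v\<in>V. f v * (\<Sum>u\<in>V. K v u * f u))"
      by (simp add: sum_distrib_left mult_ac)
    also have "\<dots> = (\<Sum>v\<in>V. \<Sum>c | c \<in> star Ch x \<and> v \<in> c. f v * (\<Sum>u\<in>c - x. f u))"
      by (simp add: Ksum sum_distrib_left)
    also have "\<dots> = (\<Sum>c\<in>star Ch x. \<Sum>v\<in>c - x. f v * (\<Sum>u\<in>c - x. f u))" by (rule swap[symmetric])
    finally show ?thesis by (simp add: power2_eq_square sum_distrib_right)
  qed
  finally show "(\<Sum>c\<in>star Ch x. (\<Sum>v\<in>c - x. f v)\<^sup>2) \<le> M * (\<Sum>c\<in>star Ch x. \<Sum>v\<in>c - x. (f v)\<^sup>2)" .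
qed

text \<open>Oppenheim's trickling down step, applied to an eigenfunction \<open>f\<close>: on the link of \<open>v\<close> its mean
  is \<open>\<alpha> f v\<close>, and the bound for the link is used for \<open>f\<close> minus this mean.\<close>

lemma trickle_step:
  assumes k: "1 \<le> k" and \<mu>: "0 \<le> \<mu>" "\<mu> < 1"
    and link: "\<And>v. v \<in> V \<Longrightarrow> spectral_bound Ch (insert v x) (1 + (real k - 1) * \<mu>)"
    and conn: "\<And>h :: 'a \<Rightarrow> real. (\<And>c u v. \<lbrakk>c \<in> star Ch x; u \<in> c - x; v \<in> c - x\<rbrakk> \<Longrightarrow> h u = h v)
      \<Longrightarrow> \<forall>u\<in>V. \<forall>v\<in>V. h u = h v"
    and k2: "2 \<le> k"
  shows "spectral_bound Ch x (1 + real k * (\<mu> / (1 - \<mu>)))"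
proof (rule spectral_boundI)
  fix f :: "'a \<Rightarrow> real" and t
  assume nz: "\<exists>v\<in>V. f v \<noteq> 0" and mean: "(\<Sum>c\<in>star Ch x. \<Sum>v\<in>c - x. f v) = 0"
    and eig: "\<And>v. v \<in> V \<Longrightarrow> (\<Sum>c | c \<in> star Ch x \<and> v \<in> c. \<Sum>u\<in>c - x. f u) = t * N v * f v"
  define F where "F c = (\<Sum>u\<in>c - x. f u)" for c
  define G where "G c = (\<Sum>u\<in>c - x. (f u)\<^sup>2)" for c
  define R where "R = (\<Sum>v\<in>V. N v * (f v)\<^sup>2)"
  \<comment> \<open>In \<open>t\<close> each vertex also counts itself; \<open>\<alpha>\<close> is
    the eigenvalue of averaging over the other \<open>k\<close> vertices of a chamber.\<close>
  define \<alpha> where "\<alpha> = (t - 1) / real k"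
  have kr: "real k > 0" using k by simp
  have t: "t = 1 + real k * \<alpha>" using k by (simp add: \<alpha>_def)
  have eigF: "(\<Sum>c | c \<in> star Ch x \<and> v \<in> c. F c) = t * N v * f v" if "v \<in> V" for v
    using eig[OF that] by (simp add: F_def)
  have R_pos: "0 < R"
  proof -
    obtain v where v: "v \<in> V" "f v \<noteq> 0" using nz by blast
    have "0 < N v * (f v)\<^sup>2" using N_pos[OF v(1)] v(2) by simp
    also have "\<dots> \<le> R" unfolding R_def
      using N_pos by (intro member_le_sum[OF v(1)] finite_V) (simp add: less_imp_le)
    finally show ?thesis .
  qed
  have SG: "(\<Sum>c\<in>star Ch x. G c) = R" by (simp add: G_def R_def sum_single)
  have SF: "(\<Sum>c\<in>star Ch x. (F c)\<^sup>2) = t * R"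
  proof -
    have "(\<Sum>c\<in>star Ch x. (F c)\<^sup>2) = (\<Sum>c\<in>star Ch x. \<Sum>v\<in>c - x. f v * F c)"
      by (simp add: F_def power2_eq_square sum_distrib_right)
    also have "\<dots> = (\<Sum>v\<in>V. f v * (\<Sum>c | c \<in> star Ch x \<and> v \<in> c. F c))" by (simp add: swap sum_distrib_left)
    also have "\<dots> = (\<Sum>v\<in>V. t * (N v * (f v)\<^sup>2))"
      by (intro sum.cong HOL.refl) (simp add: eigF power2_eq_square)
    finally show ?thesis by (simp add: R_def sum_distrib_left)
  qed
  \<comment> \<open>If \<open>\<alpha>\<close> were at least 1, the variance of \<open>f\<close> on
    every chamber would vanish. By connectedness \<open>f\<close> would be constant, hence zero
    because its mean is zero.\<close>
  have \<alpha>1: "\<alpha> < 1"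
  proof (rule ccontr)
    assume "\<not> \<alpha> < 1"
    then have tk: "real (Suc k) \<le> t" using mult_left_mono[of 1 \<alpha> "real k"] kr by (simp add: t)
    have var: "(\<Sum>v\<in>c - x. (f v - F c / real (Suc k))\<^sup>2) = G c - (F c)\<^sup>2 / real (Suc k)" if c: "c \<in> star Ch x" for c
    proof -
      define m where "m = F c / real (Suc k)"
      have "(\<Sum>v\<in>c - x. (f v - m)\<^sup>2) = (\<Sum>v\<in>c - x. (f v)\<^sup>2 - 2 * m * f v + m\<^sup>2)"
        by (intro sum.cong HOL.refl) (simp add: power2_diff mult_ac)
      also have "\<dots> = G c - 2 * m * F c + real (Suc k) * m\<^sup>2"
        using size[OF c]
        by (simp add: sum.distrib sum_subtractf sum_distrib_left[symmetric] F_def G_def del: of_nat_Suc)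
      also have "real (Suc k) * m\<^sup>2 = m * F c" by (simp add: m_def power2_eq_square)
      finally show ?thesis by (simp add: m_def power2_eq_square)
    qed
    have "(\<Sum>c\<in>star Ch x. G c - (F c)\<^sup>2 / real (Suc k)) = R - t * R / real (Suc k)"
      using SF SG by (simp add: sum_subtractf sum_divide_distrib[symmetric])
    also have "\<dots> \<le> 0" using mult_right_mono[OF tk less_imp_le[OF R_pos]] by (simp add: field_simps)
    finally have le: "(\<Sum>c\<in>star Ch x. G c - (F c)\<^sup>2 / real (Suc k)) \<le> 0" .
    have ge: "0 \<le> G c - (F c)\<^sup>2 / real (Suc k)" if "c \<in> star Ch x" for c
      using var[OF that] by (metis sum_nonneg zero_le_power2)
    have "(\<Sum>c\<in>star Ch x. G c - (F c)\<^sup>2 / real (Suc k)) = 0"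
      using le sum_nonneg[of "star Ch x" "\<lambda>c. G c - (F c)\<^sup>2 / real (Suc k)"] ge by (intro antisym) auto
    then have z: "\<forall>c\<in>star Ch x. G c - (F c)\<^sup>2 / real (Suc k) = 0"
      using sum_nonneg_eq_0_iff[OF finite_star, of "\<lambda>c. G c - (F c)\<^sup>2 / real (Suc k)"] ge by simp
    have const: "f v = F c / real (Suc k)" if c: "c \<in> star Ch x" and v: "v \<in> c - x" for c v
    proof -
      have "(\<Sum>v\<in>c - x. (f v - F c / real (Suc k))\<^sup>2) = 0" using var[OF c] z c by simp
      moreover have "finite (c - x)" using c fin_c by (auto simp: star_def)
      ultimately have "\<forall>v\<in>c - x. (f v - F c / real (Suc k))\<^sup>2 = 0"
        using sum_nonneg_eq_0_iff[of "c - x" "\<lambda>v. (f v - F c / real (Suc k))\<^sup>2"] by simp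
      then show ?thesis using v by auto
    qed
    then have "\<forall>u\<in>V. \<forall>v\<in>V. f u = f v" using const by (intro conn) metis
    then obtain y where y: "\<forall>v\<in>V. f v = y" using nz by metis
    have "(\<Sum>v\<in>V. N v) * y = (\<Sum>v\<in>V. N v * f v)" using y by (simp add: sum_distrib_right)
    also have "\<dots> = 0" using mean by (simp add: sum_single)
    finally have "(\<Sum>v\<in>V. N v) * y = 0" .
    moreover have "0 < (\<Sum>v\<in>V. N v)" using N_pos nz finite_V by (intro sum_pos) auto
    ultimately show False using nz y by auto
  qed
  have loc: "(\<Sum>c | c \<in> star Ch x \<and> v \<in> c. (F c)\<^sup>2) - t\<^sup>2 * (N v * (f v)\<^sup>2) \<le>
      (1 + (real k - 1) * \<mu>) * ((\<Sum>c | c \<in> star Ch x \<and> v \<in> c. G c) - (1 + real k * \<alpha>\<^sup>2) * (N v * (f v)\<^sup>2))"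
    if v: "v \<in> V" for v
  proof -
    define a where "a = \<alpha> * f v"
    define S where "S = {c \<in> star Ch x. v \<in> c}"
    have starv: "star Ch (insert v x) = S" by (auto simp: star_def S_def)
    have cS: "real (card S) = N v" by (simp add: S_def N_def)
    have split: "(\<Sum>u\<in>c - insert v x. g u) = (\<Sum>u\<in>c - x. g u) - g v" if c: "c \<in> S" for c and g :: "'a \<Rightarrow> real"
    proof -
      have "finite (c - x)" "v \<in> c - x" using c fin_c v by (auto simp: S_def star_def V_def)
      moreover have "c - insert v x = (c - x) - {v}" by auto
      ultimately show ?thesis by (simp add: sum_diff1)
    qed
    have card: "real (card (c - x)) = real k + 1" if "c \<in> S" for c using size that by (simp add: S_def)
    have 1: "(\<Sum>u\<in>c - insert v x. f u - a) = F c - t * f v" if c: "c \<in> S" for c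
      using card[OF c] unfolding split[OF c] by (simp add: sum_subtractf F_def a_def t algebra_simps)
    have 2: "(\<Sum>u\<in>c - insert v x. (f u - a)\<^sup>2) = G c - (f v)\<^sup>2 - 2 * a * (F c - f v) + real k * a\<^sup>2" if c: "c \<in> S" for c
    proof -
      have "(\<Sum>u\<in>c - x. (f u - a)\<^sup>2) = (\<Sum>u\<in>c - x. (f u)\<^sup>2 - 2 * a * f u + a\<^sup>2)"
        by (intro sum.cong HOL.refl) (simp add: power2_diff mult_ac)
      also have "\<dots> = G c - 2 * a * F c + (real k + 1) * a\<^sup>2"
        using card[OF c] by (simp add: sum.distrib sum_subtractf sum_distrib_left[symmetric] F_def G_def)
      finally show ?thesis unfolding split[OF c] by (simp add: power2_diff algebra_simps)
    qed
    have SFv: "(\<Sum>c\<in>S. F c) = t * N v * f v" using eigF[OF v] by (simp add: S_def)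
    have "(\<Sum>c\<in>S. \<Sum>u\<in>c - insert v x. f u - a) = (\<Sum>c\<in>S. F c - t * f v)" using 1 by (intro sum.cong) auto
    also have "\<dots> = 0" using SFv cS by (simp add: sum_subtractf)
    finally have "(\<Sum>c\<in>S. (\<Sum>u\<in>c - insert v x. f u - a)\<^sup>2) \<le>
        (1 + (real k - 1) * \<mu>) * (\<Sum>c\<in>S. \<Sum>u\<in>c - insert v x. (f u - a)\<^sup>2)"
      using link[OF v] unfolding spectral_bound_def starv by blast
    moreover have "(\<Sum>c\<in>S. (\<Sum>u\<in>c - insert v x. f u - a)\<^sup>2) = (\<Sum>c\<in>S. (F c)\<^sup>2) - t\<^sup>2 * (N v * (f v)\<^sup>2)"
    proof -
      have "(\<Sum>c\<in>S. (\<Sum>u\<in>c - insert v x. f u - a)\<^sup>2) = (\<Sum>c\<in>S. (F c)\<^sup>2 - 2 * (t * f v) * F c + (t * f v)\<^sup>2)"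
        using 1 by (intro sum.cong HOL.refl) (simp add: power2_diff mult_ac)
      also have "\<dots> = (\<Sum>c\<in>S. (F c)\<^sup>2) - 2 * (t * f v) * (t * N v * f v) + N v * (t * f v)\<^sup>2"
        unfolding SFv[symmetric] using cS by (simp add: sum.distrib sum_subtractf sum_distrib_left[symmetric])
      finally show ?thesis by (simp add: power2_eq_square algebra_simps)
    qed
    moreover have "(\<Sum>c\<in>S. \<Sum>u\<in>c - insert v x. (f u - a)\<^sup>2) = (\<Sum>c\<in>S. G c) - (1 + real k * \<alpha>\<^sup>2) * (N v * (f v)\<^sup>2)"
    proof -
      have "(\<Sum>c\<in>S. \<Sum>u\<in>c - insert v x. (f u - a)\<^sup>2) =
          (\<Sum>c\<in>S. G c - 2 * a * F c + (real k * a\<^sup>2 - (f v)\<^sup>2 + 2 * a * f v))"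
        using 2 by (intro sum.cong HOL.refl) (simp add: algebra_simps)
      also have "\<dots> = (\<Sum>c\<in>S. G c) - 2 * a * (t * N v * f v) + N v * (real k * a\<^sup>2 - (f v)\<^sup>2 + 2 * a * f v)"
        unfolding SFv[symmetric] using cS by (simp add: sum.distrib sum_subtractf sum_distrib_left[symmetric])
      finally show ?thesis by (simp add: a_def t power2_eq_square algebra_simps)
    qed
    ultimately show ?thesis by (simp add: S_def)
  qed
  \<comment> \<open>Summing the local inequalities over all \<open>v\<close> counts each chamber
    once for each of its \<open>k + 1\<close> vertices off \<open>x\<close>.\<close>
  have dbl: "(\<Sum>v\<in>V. \<Sum>c | c \<in> star Ch x \<and> v \<in> c. g c) = (real k + 1) * (\<Sum>c\<in>star Ch x. g c)" for g :: "'a set \<Rightarrow> real"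
    unfolding swap[symmetric] using size by (simp add: sum_distrib_left add.commute)
  have "(real k + 1) * (t * R) - t\<^sup>2 * R \<le> (1 + (real k - 1) * \<mu>) * ((real k + 1) * R - (1 + real k * \<alpha>\<^sup>2) * R)"
  proof -
    have "(\<Sum>v\<in>V. (\<Sum>c | c \<in> star Ch x \<and> v \<in> c. (F c)\<^sup>2) - t\<^sup>2 * (N v * (f v)\<^sup>2)) \<le>
        (\<Sum>v\<in>V. (1 + (real k - 1) * \<mu>) * ((\<Sum>c | c \<in> star Ch x \<and> v \<in> c. G c) - (1 + real k * \<alpha>\<^sup>2) * (N v * (f v)\<^sup>2)))"
      using loc by (rule sum_mono)
    then show ?thesis
      by (simp add: sum_subtractf sum_distrib_left[symmetric] dbl SF SG R_def[symmetric])
  qed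
  then have "((real k + 1) * t - t\<^sup>2) * R \<le> ((1 + (real k - 1) * \<mu>) * (real k - real k * \<alpha>\<^sup>2)) * R"
    by (simp add: algebra_simps)
  then have "(real k + 1) * t - t\<^sup>2 \<le> (1 + (real k - 1) * \<mu>) * (real k - real k * \<alpha>\<^sup>2)"
    using R_pos by simp
  moreover have "(real k + 1) * t - t\<^sup>2 = real k * (1 - \<alpha>) * (1 + real k * \<alpha>)"
    by (simp add: t power2_eq_square algebra_simps)
  moreover have "(1 + (real k - 1) * \<mu>) * (real k - real k * \<alpha>\<^sup>2) = real k * (1 - \<alpha>) * ((1 + (real k - 1) * \<mu>) * (1 + \<alpha>))"
    by (simp add: power2_eq_square algebra_simps)
  \<comment> \<open>Both sides carry this factor; cancelling it leaves an inequality linear in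
    \<open>\<alpha>\<close>.\<close>
  moreover have "0 < real k * (1 - \<alpha>)" using kr \<alpha>1 by simp
  ultimately have "1 + real k * \<alpha> \<le> (1 + (real k - 1) * \<mu>) * (1 + \<alpha>)"
    using mult_le_cancel_left_pos by metis
  then have "(real k - 1) * \<alpha> \<le> (real k - 1) * (\<mu> * (1 + \<alpha>))" by (simp add: algebra_simps)
  then have "\<alpha> \<le> \<mu> * (1 + \<alpha>)" using k2 by simp
  then have "\<alpha> * (1 - \<mu>) \<le> \<mu>" by (simp add: algebra_simps)
  then have "\<alpha> \<le> \<mu> / (1 - \<mu>)" using \<mu>(2) by (simp add: pos_le_divide_eq)
  then show "t \<le> 1 + real k * (\<mu> / (1 - \<mu>))"
    using mult_left_mono[of \<alpha> "\<mu> / (1 - \<mu>)" "real k"] kr by (simp add: t)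
qed

end

text \<open>Here \<open>k\<close> is the dimension of the link of \<open>x\<close>. One step sends
  the bound \<open>\<nu>\<close> to \<open>\<nu> / (1 - \<nu>)\<close>, so for positive bounds the
  reciprocal drops by 1 with each dimension. The condition on \<open>(r - 1) \<mu>\<close> keeps all
  bounds before the last step below 1.\<close>

theorem trickling_down:
  fixes Ch :: "'a set set"
  assumes fin: "finite Ch" and card: "\<And>c. c \<in> Ch \<Longrightarrow> finite c \<and> card c = Suc r"
    and r: "1 \<le> r" and \<mu>: "0 \<le> \<mu>" "(real r - 1) * \<mu> < 1"
    and base: "\<And>x. \<lbrakk>star Ch x \<noteq> {}; card x + 1 = r\<rbrakk> \<Longrightarrow> spectral_bound Ch x (1 + \<mu>)"
    and conn: "\<And>x (h :: 'a \<Rightarrow> real). \<lbrakk>star Ch x \<noteq> {}; card x + 1 \<le> r;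
        \<And>c u v. \<lbrakk>c \<in> star Ch x; u \<in> c - x; v \<in> c - x\<rbrakk> \<Longrightarrow> h u = h v\<rbrakk>
      \<Longrightarrow> \<forall>u\<in>\<Union>(star Ch x) - x. \<forall>v\<in>\<Union>(star Ch x) - x. h u = h v"
    and ne: "Ch \<noteq> {}"
  shows "spectral_bound Ch {} (1 + real r * (\<mu> / (1 - (real r - 1) * \<mu>)))"
proof -
  have "spectral_bound Ch x (1 + real k * (\<mu> / (1 - (real k - 1) * \<mu>)))"
    if "1 \<le> k" "k \<le> r" "star Ch x \<noteq> {}" "card x + k = r" for k x
    using that
  proof (induction k arbitrary: x rule: nat_induct_at_least)
    case base
    then show ?case using assms(6)[of x] by simp
  next
    case (Suc k)
    obtain c0 where c0: "c0 \<in> Ch" "x \<subseteq> c0" using Suc.prems(2) by (auto simp: star_def)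
    have fx: "finite x" using card[OF c0(1)] c0(2) finite_subset by blast
    interpret star_system Ch x "Suc k"
    proof
      show "finite Ch" by (rule fin)
      show "finite c" if "c \<in> Ch" for c using card that by blast
      show "card (c - x) = Suc (Suc k)" if "c \<in> star Ch x" for c
        using that card[of c] card_Diff_subset[OF fx, of c] Suc.prems by (auto simp: star_def)
    qed
    define \<nu> where "\<nu> = \<mu> / (1 - (real k - 1) * \<mu>)"
    have k\<mu>: "real k * \<mu> < 1"
      using mult_right_mono[of "real k" "real r - 1" \<mu>] \<mu> Suc.prems(1) by simp
    have k1\<mu>: "0 < 1 - (real k - 1) * \<mu>" using k\<mu> \<mu>(1) by (simp add: algebra_simps)
    have "\<nu> < 1" using k\<mu> k1\<mu> by (simp add: \<nu>_def divide_less_eq algebra_simps)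
    moreover have "0 \<le> \<nu>" using k1\<mu> \<mu>(1) by (simp add: \<nu>_def)
    moreover have "\<nu> / (1 - \<nu>) = \<mu> / (1 - (real (Suc k) - 1) * \<mu>)"
      using k1\<mu> k\<mu> by (simp add: \<nu>_def divide_simps) (simp add: algebra_simps)
    moreover have "spectral_bound Ch x (1 + real (Suc k) * (\<nu> / (1 - \<nu>)))"
    proof (rule trickle_step)
      show "spectral_bound Ch (insert v x) (1 + (real (Suc k) - 1) * \<nu>)" if v: "v \<in> V" for v
      proof -
        have "star Ch (insert v x) \<noteq> {}" "v \<notin> x" using v by (auto simp: V_def star_def)
        then show ?thesis using Suc.IH[of "insert v x"] Suc.prems fx by (simp add: \<nu>_def)
      qed
      show "\<forall>u\<in>V. \<forall>v\<in>V. h u = h v"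
        if h: "\<And>c u v. \<lbrakk>c \<in> star Ch x; u \<in> c - x; v \<in> c - x\<rbrakk> \<Longrightarrow> h u = h v" for h :: "'a \<Rightarrow> real"
      proof -
        have "card x + 1 \<le> r" using Suc.prems by simp
        from conn[OF Suc.prems(2) this h] show ?thesis unfolding V_def .
      qed
    qed (use calculation Suc.hyps in auto)
    ultimately show ?case by simp
  qed
  from this[of r "{}"] show ?thesis using r ne by (auto simp: star_def)
qed

section \<open>Words in a Coxeter group\<close>

fun alt :: "'t \<Rightarrow> 't \<Rightarrow> nat \<Rightarrow> 't list" where
  "alt s t 0 = []"
| "alt s t (Suc k) = s # alt t s k"

lemma length_alt [simp]: "length (alt s t k) = k"
  by (induction k arbitrary: s t) auto

lemma set_alt: "set (alt s t k) \<subseteq> {s, t}"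
  by (induction k arbitrary: s t) auto

lemma alt_double: "alt s t (2 * k) = concat (replicate k [s, t])"
  by (induction k) auto

lemma alt_add: "alt s t (k + l) = alt s t k @ (if even k then alt s t l else alt t s l)"
  by (induction k arbitrary: s t) auto

lemma alt_snoc: "alt s t (Suc k) = alt s t k @ [if even k then s else t]"
  using alt_add[of s t k 1] by simp

text \<open>Prefix conjugates of the letters: the reflections in the walls crossed, in order, by the
  gallery of the word.\<close>

fun reflections :: "'t list \<Rightarrow> 't list list" where
  "reflections [] = []"
| "reflections (s # u) = [s] # map (\<lambda>r. s # r @ [s]) (reflections u)"

lemma length_reflections [simp]: "length (reflections u) = length u"
  by (induction u) auto

lemma reflections_alt:
  "reflections (alt s t k) = map (\<lambda>i. alt s t (2 * i + 1)) [0..<k]"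
proof (induction k arbitrary: s t)
  case (Suc k)
  have "s # alt t s (2 * i + 1) @ [s] = alt s t (2 * Suc i + 1)" for i
    using alt_snoc[of t s "2 * i + 1"] by simp
  then have "map (\<lambda>i. s # alt t s (2 * i + 1) @ [s]) [0..<k] = map (\<lambda>i. alt s t (2 * Suc i + 1)) [0..<k]"
    by (metis (no_types, lifting) map_eq_conv)
  also have "\<dots> = map (\<lambda>i. alt s t (2 * i + 1)) [Suc 0..<Suc k]"
    by (simp add: map_Suc_upt[symmetric] del: upt_Suc)
  finally show ?case using Suc by (simp add: upt_conv_Cons o_def del: upt_Suc)
qed simp

context
  fixes T :: "'t::finite diagram"
  assumes T: "coxeter_diagram T"
begin

abbreviation ceq (infix "\<sim>" 50) where "u \<sim> v \<equiv> coxeter_eq T u v"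

lemma ceq_refl [simp]: "u \<sim> u" by (rule coxeter_eq.refl)

lemma ceq_sym: "u \<sim> v \<Longrightarrow> v \<sim> u" by (rule coxeter_eq.sym)

lemma ceq_trans [trans]: "u \<sim> v \<Longrightarrow> v \<sim> w \<Longrightarrow> u \<sim> w" by (rule coxeter_eq.trans)

lemma ceq_cong: "u \<sim> v \<Longrightarrow> a @ u @ b \<sim> a @ v @ b"
proof (induction rule: coxeter_eq.induct)
  case (rel s t k u v)
  then show ?case using coxeter_eq.rel[of T s t k "a @ u" "v @ b"] by simp
qed (auto intro: coxeter_eq.intros)

lemma ceq_append: "u \<sim> u' \<Longrightarrow> v \<sim> v' \<Longrightarrow> u @ v \<sim> u' @ v'"
  using ceq_cong[of u u' "[]" v] ceq_cong[of v v' u' "[]"] ceq_trans by simp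

lemma ceq_Cons: "v \<sim> v' \<Longrightarrow> s # v \<sim> s # v'"
  using ceq_append[of "[s]" "[s]" v v'] by simp

lemma ceq_involution: "a @ [s, s] @ b \<sim> a @ b"
  using coxeter_eq.rel[of T s s 1 a b] by (simp add: coxeter_matrix_def one_enat_def)

lemma ceq_rev_cancel: "rev u @ u \<sim> []"
proof (induction u)
  case (Cons s u)
  have "rev (s # u) @ s # u \<sim> rev u @ u" using ceq_involution[of "rev u" s u] by simp
  then show ?case using Cons ceq_trans by blast
qed simp

lemma ceq_cancel_rev: "u @ rev u \<sim> []"
  using ceq_rev_cancel[of "rev u"] by simp

lemma ceq_rev: "u \<sim> v \<Longrightarrow> rev u \<sim> rev v"
proof -
  assume uv: "u \<sim> v"
  have "rev u \<sim> rev u @ (v @ rev v)"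
    using ceq_append[OF ceq_refl ceq_sym[OF ceq_cancel_rev]] by force
  also have "rev u @ (v @ rev v) \<sim> rev u @ u @ rev v"
    by (rule ceq_cong[OF ceq_sym[OF uv]])
  also have "rev u @ u @ rev v \<sim> [] @ rev v"
    using ceq_append[OF ceq_rev_cancel ceq_refl, of u "rev v"] by simp
  finally show ?thesis by simp
qed

lemma ceq_rev_left: "rev u @ u @ v \<sim> v"
  using ceq_append[OF ceq_rev_cancel ceq_refl, of u v] by simp

lemma ceq_left_rev: "u @ rev u @ v \<sim> v"
  using ceq_rev_left[of "rev u" v] by simp

lemma ceq_move_left: "a @ u \<sim> v \<longleftrightarrow> u \<sim> rev a @ v"
proof
  assume "a @ u \<sim> v"
  then have "rev a @ a @ u \<sim> rev a @ v" by (rule ceq_append[OF ceq_refl])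
  then show "u \<sim> rev a @ v" using ceq_rev_left ceq_sym ceq_trans by blast
next
  assume "u \<sim> rev a @ v"
  then have "a @ u \<sim> a @ rev a @ v" by (rule ceq_append[OF ceq_refl])
  then show "a @ u \<sim> v" using ceq_left_rev ceq_trans by blast
qed

lemma ceq_cancel_left: "a @ u \<sim> a @ v \<longleftrightarrow> u \<sim> v"
  using ceq_move_left[of a u "a @ v"] ceq_rev_left[of a v] ceq_trans ceq_sym ceq_append ceq_refl
  by blast

lemma ceq_move_Cons: "s # u \<sim> v \<longleftrightarrow> u \<sim> s # v"
  using ceq_move_left[of "[s]" u v] by simp

lemma conj_ceq_iff: "s # r @ [s] \<sim> t \<longleftrightarrow> r \<sim> s # t @ [s]"
proof -
  have *: "r @ [s] \<sim> w \<longleftrightarrow> r \<sim> w @ [s]" for w r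
    using ceq_append[of "r @ [s]" w "[s]" "[s]"] ceq_append[of r "w @ [s]" "[s]" "[s]"]
      ceq_involution[of r s "[]"] ceq_involution[of w s "[]"]
    by (metis append.assoc append_Cons append_Nil append_Nil2 ceq_refl ceq_sym ceq_trans)
  show ?thesis using *[of r "s # t"] ceq_move_Cons[of s "r @ [s]" t] by simp
qed

text \<open>How often a gallery crosses the wall of \<open>t\<close>. Only its parity depends on the
  group element alone, and this parity replaces the sign of a root in the usual proof of the
  exchange condition.\<close>

definition cnt :: "'t list \<Rightarrow> 't list \<Rightarrow> nat" where
  "cnt u t = length (filter (\<lambda>r. r \<sim> t) (reflections u))"

lemma cnt_Nil [simp]: "cnt [] t = 0" by (simp add: cnt_def)

lemma cnt_Cons: "cnt (s # u) t = (if [s] \<sim> t then 1 else 0) + cnt u (s # t @ [s])"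
proof -
  have "length (filter (\<lambda>r. r \<sim> t) (map (\<lambda>r. s # r @ [s]) (reflections u))) =
      length (filter (\<lambda>r. r \<sim> s # t @ [s]) (reflections u))"
    by (simp add: filter_map o_def conj_ceq_iff)
  then show ?thesis by (simp add: cnt_def)
qed

lemma cnt_append: "cnt (u @ v) t = cnt u t + cnt v (rev u @ t @ u)"
  by (induction u arbitrary: t) (auto simp: cnt_Cons)

lemma cnt_cong: "t \<sim> t' \<Longrightarrow> cnt u t = cnt u t'"
  unfolding cnt_def by (metis ceq_sym ceq_trans)

text \<open>The reflections of the relator are the alternating words of odd length. They repeat, up
  to equality in the group, with period \<open>k\<close> in a list of length
  \<open>2 k\<close>.\<close>

lemma even_cnt_relator:
  assumes "coxeter_matrix T s t = enat k"
  shows "even (cnt (concat (replicate k [s, t])) r)"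
proof -
  define P where "P i \<longleftrightarrow> alt s t (2 * i + 1) \<sim> r" for i
  have shift: "P (i + k) = P i" for i
  proof -
    have "alt s t (2 * (i + k) + 1) = concat (replicate k [s, t]) @ alt s t (2 * i + 1)"
      using alt_add[of s t "2 * k" "2 * i + 1"] alt_double[of s t k] by (simp add: algebra_simps)
    moreover have "concat (replicate k [s, t]) @ alt s t (2 * i + 1) \<sim> alt s t (2 * i + 1)"
      using coxeter_eq.rel[OF assms, of "[]"] by simp
    ultimately show ?thesis unfolding P_def by (metis ceq_sym ceq_trans)
  qed
  have "cnt (concat (replicate k [s, t])) r = length (filter P [0..<2 * k])"
    unfolding cnt_def alt_double[symmetric] reflections_alt P_def by (simp add: filter_map o_def)
  also have "[0..<2 * k] = [0..<k] @ map (\<lambda>i. i + k) [0..<k]"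
    by (metis add_0 map_add_upt mult_2 upt_add_eq_append zero_le)
  also have "length (filter P \<dots>) = 2 * length (filter P [0..<k])"
    by (simp add: filter_map o_def shift)
  finally show ?thesis by simp
qed

lemma even_cnt_ceq: "u \<sim> v \<Longrightarrow> even (cnt u t) \<longleftrightarrow> even (cnt v t)"
proof (induction arbitrary: t rule: coxeter_eq.induct)
  case (rel s t' k u v)
  let ?c = "concat (replicate k [s, t'])"
  have c: "?c \<sim> []" using coxeter_eq.rel[OF rel, of "[]" "[]"] by simp
  have "rev ?c @ (rev u @ t @ u) @ ?c \<sim> [] @ (rev u @ t @ u) @ []"
    using ceq_append[OF ceq_rev[OF c] ceq_append[OF ceq_refl c]] by (metis rev.simps(1))
  then have "cnt v (rev ?c @ (rev u @ t @ u) @ ?c) = cnt v (rev u @ t @ u)"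
    using cnt_cong by (metis append_Nil append_Nil2)
  then show ?case using even_cnt_relator[OF rel, of "rev u @ t @ u"] by (simp add: cnt_append)
qed auto

text \<open>Multiplying by the reflection of the i-th prefix cancels the i-th letter. Keeping track
  of the letters makes the result usable inside parabolic subgroups.\<close>

lemma delete_of_reflection:
  "r \<in> set (reflections u) \<Longrightarrow> \<exists>v. r @ u \<sim> v \<and> length v < length u \<and> set v \<subseteq> set u"
proof (induction u arbitrary: r)
  case (Cons s u)
  show ?case
  proof (cases "r = [s]")
    case True
    have "[s] @ s # u \<sim> u" using ceq_involution[of "[]" s u] by simp
    then show ?thesis using True by (intro exI[of _ u]) auto
  next
    case False
    then obtain r' where r': "r' \<in> set (reflections u)" "r = s # r' @ [s]" using Cons.prems by auto
    obtain v where v: "r' @ u \<sim> v" "length v < length u" "set v \<subseteq> set u" using Cons.IH r' by blast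
    have "s # r' @ [s] @ s # u \<sim> s # r' @ u"
      using ceq_involution[of "s # r'" s u] by simp
    then have "r @ s # u \<sim> s # v" using r' v ceq_Cons ceq_trans by fastforce
    then show ?thesis using v by (intro exI[of _ "s # v"]) auto
  qed
qed simp

definition reduced :: "'t list \<Rightarrow> bool" where
  "reduced u \<longleftrightarrow> (\<forall>v. v \<sim> u \<longrightarrow> length u \<le> length v)"

lemma reduced_exists: "\<exists>v. v \<sim> u \<and> reduced v"
proof -
  obtain v where "v \<sim> u" "\<And>w. w \<sim> u \<Longrightarrow> length v \<le> length w"
    using arg_min_natI[of "\<lambda>v. v \<sim> u" u length] arg_min_nat_le[of "\<lambda>v. v \<sim> u" _ length]
    by (metis ceq_refl)
  then show ?thesis unfolding reduced_def by (meson ceq_trans)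
qed

lemma reduced_Cons: "reduced (s # u) \<Longrightarrow> reduced u"
  unfolding reduced_def using ceq_Cons by (metis Suc_le_mono length_Cons)

text \<open>Take \<open>v\<close> reduced for \<open>s u\<close>. If it crossed the wall of
  \<open>s\<close> an odd number of times, deleting a letter would write \<open>u\<close> more
  briefly than its length. So the parity is even in \<open>v\<close> and odd in \<open>s v\<close>,
  hence odd in \<open>u\<close>, and a letter of \<open>u\<close> can be deleted.\<close>

lemma exchange:
  assumes u: "reduced u" and "\<not> reduced (s # u)"
  shows "\<exists>v. s # u \<sim> v \<and> length v < length u \<and> set v \<subseteq> set u"
proof -
  obtain v where v: "v \<sim> s # u" "reduced v" using reduced_exists by blast
  obtain w where w: "w \<sim> s # u" "length w < Suc (length u)"
    using assms(2) unfolding reduced_def by (auto simp: not_le)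
  have "length v \<le> length w"
    using v(2) ceq_trans[OF w(1) ceq_sym[OF v(1)]] unfolding reduced_def by blast
  then have lv: "length v \<le> length u" using w(2) by simp
  have uv: "u \<sim> s # v" using ceq_sym[OF v(1)] by (simp add: ceq_move_Cons)
  have del: "\<exists>w'. s # w \<sim> w' \<and> length w' < length w \<and> set w' \<subseteq> set w" if odd_w: "odd (cnt w [s])" for w
  proof -
    from odd_w have "filter (\<lambda>r. r \<sim> [s]) (reflections w) \<noteq> []" unfolding cnt_def by auto
    then obtain r where r: "r \<in> set (reflections w)" "r \<sim> [s]"
      by (metis (no_types, lifting) filter_False)
    have "[s] @ w \<sim> r @ w" using r ceq_append ceq_sym ceq_refl by blast
    then show ?thesis using delete_of_reflection[OF r(1)] ceq_trans by fastforce
  qed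
  have "\<not> odd (cnt v [s])"
  proof
    assume "odd (cnt v [s])"
    then obtain w where "s # v \<sim> w" "length w < length v" using del by blast
    then have "length u \<le> length w"
      using u ceq_sym[OF ceq_trans[OF uv]] unfolding reduced_def by blast
    then show False using \<open>length w < length v\<close> lv by simp
  qed
  \<comment> \<open>Prefixing \<open>s\<close> conjugates the counted reflection, which fixes
    \<open>s\<close> itself and adds one crossing.\<close>
  moreover have "s # [s] @ [s] \<sim> [s]" using ceq_involution[of "[]" s "[s]"] by simp
  then have "cnt v (s # [s] @ [s]) = cnt v [s]" by (rule cnt_cong)
  ultimately have "odd (cnt (s # v) [s])" by (simp add: cnt_Cons)
  then have "odd (cnt u [s])" using even_cnt_ceq[OF uv] by blast
  then show ?thesis using del by blast
qed

text \<open>Words are shortened from the right by exchange, which introduces no letters; hence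
  reduced representatives stay in the given parabolic subgroup.\<close>

lemma reduced_subword: "\<exists>v. v \<sim> u \<and> reduced v \<and> set v \<subseteq> set u"
proof (induction "length u" arbitrary: u rule: less_induct)
  case less
  show ?case
  proof (cases u)
    case Nil
    then show ?thesis by (intro exI[of _ "[]"]) (auto simp: reduced_def)
  next
    case (Cons s u')
    obtain v where v: "v \<sim> u'" "reduced v" "set v \<subseteq> set u'" using less[of u'] Cons by auto
    have len: "length v \<le> length u'" using v unfolding reduced_def using ceq_sym by blast
    have su: "s # v \<sim> u" using ceq_Cons[OF v(1)] Cons by simp
    show ?thesis
    proof (cases "reduced (s # v)")
      case True
      then show ?thesis using su v Cons by (intro exI[of _ "s # v"]) auto
    next
      case False
      then obtain w where w: "s # v \<sim> w" "length w < length v" "set w \<subseteq> set v"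
        using exchange v by blast
      then obtain x where "x \<sim> w" "reduced x" "set x \<subseteq> set w"
        using less[of w] len Cons by auto
      moreover from this have "x \<sim> u" using ceq_trans[OF _ ceq_trans[OF ceq_sym[OF w(1)] su]] by blast
      ultimately show ?thesis using w v Cons by (intro exI[of _ x]) auto
    qed
  qed
qed

end

section \<open>The geometric representation\<close>

definition bform :: "'t::finite diagram \<Rightarrow> real^'t \<Rightarrow> real^'t \<Rightarrow> real" where
  "bform T x y = x \<bullet> (diagram_form T *v y)"

definition simple_root :: "'t::finite \<Rightarrow> real^'t" where
  "simple_root s = axis s 1"

definition simple_refl :: "'t::finite diagram \<Rightarrow> 't \<Rightarrow> real^'t \<Rightarrow> real^'t" where
  "simple_refl T s x = x - (2 * bform T (simple_root s) x) *\<^sub>R simple_root s"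

fun act :: "'t::finite diagram \<Rightarrow> 't list \<Rightarrow> real^'t \<Rightarrow> real^'t" where
  "act T [] = id"
| "act T (s # u) = simple_refl T s \<circ> act T u"

lemma act_append: "act T (u @ v) = act T u \<circ> act T v"
  by (induction u) auto

lemma act_replicate: "act T (concat (replicate k w)) = (act T w) ^^ k"
  by (induction k) (auto simp: act_append)

lemma bform_add_right: "bform T x (y + z) = bform T x y + bform T x z"
  and bform_scale_right: "bform T x (c *\<^sub>R y) = c * bform T x y"
  and bform_diff_right: "bform T x (y - z) = bform T x y - bform T x z"
  by (auto simp: bform_def matrix_vector_right_distrib matrix_vector_mult_diff_distrib
      matrix_vector_mult_scaleR inner_add_right inner_diff_right)

lemma bform_add_left: "bform T (x + y) z = bform T x z + bform T y z"
  and bform_scale_left: "bform T (c *\<^sub>R x) z = c * bform T x z"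
  by (auto simp: bform_def inner_add_left)

lemma linear_simple_refl: "linear (simple_refl T s)"
  by (rule linearI) (auto simp: simple_refl_def bform_add_right bform_scale_right algebra_simps)

lemma linear_act: "linear (act T u)"
proof (induction u)
  case (Cons s u)
  show ?case unfolding act.simps by (intro linear_compose Cons linear_simple_refl)
qed (auto simp: linear_iff)

lemma diagram_form_sym: "diagram_form T $ u $ v = diagram_form T $ v $ u"
  by (simp add: diagram_form_def insert_commute)

lemma bform_root: "bform T (simple_root u) (simple_root v) = diagram_form T $ u $ v"
  unfolding bform_def simple_root_def by (simp add: inner_axis' matrix_vector_mult_basis column_def)

lemma bform_root_left: "bform T (simple_root u) x = (\<Sum>v\<in>UNIV. diagram_form T $ u $ v * x $ v)"
  unfolding bform_def simple_root_def by (simp add: inner_axis' matrix_vector_mult_def)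

lemma bform_root_self [simp]: "bform T (simple_root u) (simple_root u) = 1"
  by (simp add: bform_root diagram_form_def)

lemma refl_root_self: "simple_refl T s (simple_root s) = - simple_root s"
  by (simp add: simple_refl_def algebra_simps scaleR_2)

lemma refl_involution: "simple_refl T s (simple_refl T s x) = x"
  by (simp add: simple_refl_def bform_diff_right bform_scale_right algebra_simps)

lemma root_nth: "simple_root s $ t = (if s = t then 1 else 0)"
  by (auto simp: simple_root_def axis_def)

lemma vec_sum_roots: "x = (\<Sum>s\<in>UNIV. x $ s *\<^sub>R simple_root s)"
  by (simp add: vec_eq_iff root_nth if_distrib[of "\<lambda>y. _ * y"] cong: if_cong)

lemma bform_edge:
  assumes "s \<noteq> t" "coxeter_matrix T s t = enat k"
  shows "diagram_form T $ s $ t = - cos (pi / real k)"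
  using assms by (auto simp: diagram_form_def coxeter_matrix_def numeral_eq_enat split: if_splits)

text \<open>The vectors of the circle on which the two reflections act as on the Euclidean unit circle,
  with \<open>simple_root s\<close> at angle \<open>0\<close> and \<open>simple_root t\<close> at angle \<open>\<pi> - \<theta>\<close>, rescaled by \<open>sin \<theta>\<close>.\<close>

definition circ :: "'t::finite \<Rightarrow> 't \<Rightarrow> real \<Rightarrow> real \<Rightarrow> real^'t" where
  "circ s t \<theta> \<phi> = sin (\<theta> + \<phi>) *\<^sub>R simple_root s + sin \<phi> *\<^sub>R simple_root t"

lemma refl_circ:
  assumes "s \<noteq> t" "coxeter_matrix T s t = enat k" "\<theta> = pi / real k"
  shows "simple_refl T s (circ s t \<theta> \<phi>) = circ s t \<theta> (pi - \<phi>)"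
    and "simple_refl T t (circ s t \<theta> \<phi>) = circ s t \<theta> (pi - 2 * \<theta> - \<phi>)"
proof -
  have b: "bform T (simple_root s) (simple_root t) = - cos \<theta>" "bform T (simple_root t) (simple_root s) = - cos \<theta>"
    using bform_edge[OF assms(1,2)] assms(3) diagram_form_sym[of T t s] by (auto simp: bform_root)
  have 1: "sin (\<theta> + (pi - \<phi>)) = - sin (\<theta> - \<phi>)"
    using sin_minus_pi[of "\<theta> - \<phi>"] sin_periodic_pi[of "\<theta> - \<phi>"] by (simp add: algebra_simps)
  have "bform T (simple_root s) (circ s t \<theta> \<phi>) = sin (\<theta> + \<phi>) - cos \<theta> * sin \<phi>"
    by (simp add: circ_def bform_add_right bform_scale_right b)
  then have c1: "bform T (simple_root s) (circ s t \<theta> \<phi>) = sin \<theta> * cos \<phi>" by (simp add: sin_add)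
  show "simple_refl T s (circ s t \<theta> \<phi>) = circ s t \<theta> (pi - \<phi>)"
    unfolding simple_refl_def c1 using assms(1)
    by (simp add: circ_def vec_eq_iff root_nth 1 sin_add sin_diff algebra_simps)
  have "bform T (simple_root t) (circ s t \<theta> \<phi>) = - cos \<theta> * sin (\<theta> + \<phi>) + sin \<phi>"
    by (simp add: circ_def bform_add_right bform_scale_right b)
  moreover have "sin (pi - 2 * \<theta> - \<phi>) = sin (2 * \<theta> + \<phi>)"
    using sin_pi_minus[of "2 * \<theta> + \<phi>"] by (simp add: algebra_simps)
  moreover have "sin (2 * \<theta> + \<phi>) + sin \<phi> = 2 * cos \<theta> * sin (\<theta> + \<phi>)"
    using sin_plus_sin[of "2 * \<theta> + \<phi>" \<phi>] by (simp add: algebra_simps add_divide_distrib)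
  moreover have "sin (\<theta> + (pi - 2 * \<theta> - \<phi>)) = sin (\<theta> + \<phi>)"
    using sin_pi_minus[of "\<theta> + \<phi>"] by (simp add: algebra_simps)
  ultimately show "simple_refl T t (circ s t \<theta> \<phi>) = circ s t \<theta> (pi - 2 * \<theta> - \<phi>)"
    unfolding simple_refl_def using assms(1)
    by (simp add: circ_def vec_eq_iff root_nth algebra_simps)
qed

lemma rotation_circ:
  assumes "s \<noteq> t" "coxeter_matrix T s t = enat k" "\<theta> = pi / real k"
  shows "((simple_refl T s \<circ> simple_refl T t) ^^ j) (circ s t \<theta> \<phi>) = circ s t \<theta> (\<phi> + 2 * real j * \<theta>)"
proof (induction j)
  case (Suc j)
  then show ?case using refl_circ[OF assms] by (simp add: algebra_simps)
qed simp

context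
  fixes T :: "'t::finite diagram"
  assumes T: "coxeter_diagram T"
begin

lemma coxeter_matrix_ge2: "s \<noteq> t \<Longrightarrow> 2 \<le> coxeter_matrix T s t"
  using T unfolding coxeter_diagram_def coxeter_matrix_def
  by (auto intro: order_trans[of _ "3::enat"])

lemma coxeter_matrix_ge2_enat: "s \<noteq> t \<Longrightarrow> coxeter_matrix T s t = enat k \<Longrightarrow> 2 \<le> k"
  using coxeter_matrix_ge2[of s t] by (simp add: numeral_eq_enat)

text \<open>The Gram determinant of the two roots is the squared sine of \<open>\<theta>\<close>,
  which is nonzero, so every vector splits into a part in their plane and a part fixed by both
  reflections. On the plane the product rotates by \<open>2 \<theta>\<close>.\<close>

lemma rotation_order:
  assumes st: "s \<noteq> t" and k: "coxeter_matrix T s t = enat k"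
  shows "(simple_refl T s \<circ> simple_refl T t) ^^ k = id"
proof
  fix x
  define \<theta> where "\<theta> = pi / real k"
  have k2: "2 \<le> k" using coxeter_matrix_ge2_enat[OF assms] .
  have \<theta>: "real k * \<theta> = pi" "0 < \<theta>" "\<theta> < pi" using k2 by (auto simp: \<theta>_def field_simps)
  have s0: "sin \<theta> > 0" using \<theta> sin_gt_zero by blast
  let ?R = "simple_refl T s \<circ> simple_refl T t"
  have lin: "linear (?R ^^ j)" for j
  proof (induction j)
    case (Suc j)
    show ?case unfolding funpow.simps by (intro linear_compose Suc linear_simple_refl)
  qed (auto simp: linear_iff)
  have b: "bform T (simple_root s) (simple_root t) = - cos \<theta>" "bform T (simple_root t) (simple_root s) = - cos \<theta>"
    using bform_edge[OF assms] diagram_form_sym[of T t s] by (auto simp: bform_root \<theta>_def)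
  have circ: "(?R ^^ k) (circ s t \<theta> \<phi>) = circ s t \<theta> \<phi>" for \<phi>
  proof -
    have "(?R ^^ k) (circ s t \<theta> \<phi>) = circ s t \<theta> (\<phi> + 2 * pi)"
      using rotation_circ[OF assms \<theta>_def, of k \<phi>] \<theta>(1) by (simp add: mult.assoc)
    also have "\<dots> = circ s t \<theta> \<phi>"
      using sin_periodic[of "\<theta> + \<phi>"] sin_periodic[of \<phi>] by (simp add: circ_def add.assoc)
    finally show ?thesis .
  qed
  define p r where "p = bform T (simple_root s) x" and "r = bform T (simple_root t) x"
  \<comment> \<open>The solution of the two-by-two Gram system that makes \<open>y\<close>
    orthogonal to both roots.\<close>
  define c d where "c = (p + r * cos \<theta>) / (sin \<theta>)\<^sup>2" and "d = (r + p * cos \<theta>) / (sin \<theta>)\<^sup>2"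
  define y where "y = x - c *\<^sub>R simple_root s - d *\<^sub>R simple_root t"
  have s2: "(sin \<theta>)\<^sup>2 = 1 - (cos \<theta>)\<^sup>2" by (simp add: sin_squared_eq)
  have nz: "(sin \<theta>)\<^sup>2 \<noteq> 0" using s0 by simp
  have "c - d * cos \<theta> = p * (1 - (cos \<theta>)\<^sup>2) / (sin \<theta>)\<^sup>2"
    unfolding c_def d_def by (simp add: diff_divide_distrib[symmetric] algebra_simps power2_eq_square)
  then have cd1: "c - d * cos \<theta> = p" using nz s2 by simp
  have "d - c * cos \<theta> = r * (1 - (cos \<theta>)\<^sup>2) / (sin \<theta>)\<^sup>2"
    unfolding c_def d_def by (simp add: diff_divide_distrib[symmetric] algebra_simps power2_eq_square)
  then have cd2: "d - c * cos \<theta> = r" using nz s2 by simp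
  have "bform T (simple_root s) y = 0" "bform T (simple_root t) y = 0"
    using cd1 cd2 unfolding y_def by (auto simp: bform_diff_right bform_scale_right b p_def[symmetric] r_def[symmetric])
  then have "?R y = y" by (simp add: simple_refl_def)
  then have fy: "(?R ^^ j) y = y" for j by (induction j) auto
  have e1: "sin \<theta> *\<^sub>R simple_root s = circ s t \<theta> 0" by (simp add: circ_def)
  have e2: "sin \<theta> *\<^sub>R simple_root t = circ s t \<theta> (pi - \<theta>)" by (simp add: circ_def)
  have "sin \<theta> *\<^sub>R (?R ^^ k) (simple_root s) = sin \<theta> *\<^sub>R simple_root s" "sin \<theta> *\<^sub>R (?R ^^ k) (simple_root t) = sin \<theta> *\<^sub>R simple_root t"
    using circ[of 0] circ[of "pi - \<theta>"] linear_scale[OF lin] e1 e2 by metis+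
  then have "(?R ^^ k) (simple_root s) = simple_root s" "(?R ^^ k) (simple_root t) = simple_root t" using s0 by auto
  moreover have "x = y + c *\<^sub>R simple_root s + d *\<^sub>R simple_root t" by (simp add: y_def)
  ultimately show "(?R ^^ k) x = id x"
    using fy by (simp add: linear_add[OF lin] linear_scale[OF lin])
qed

lemma act_ceq: "coxeter_eq T u v \<Longrightarrow> act T u = act T v"
proof (induction rule: coxeter_eq.induct)
  case (rel s t k u v)
  have "(simple_refl T s \<circ> simple_refl T t) ^^ k = id"
  proof (cases "s = t")
    case True
    then have "k = 1" using rel by (simp add: coxeter_matrix_def one_enat_def)
    then show ?thesis using True by (auto simp: refl_involution)
  qed (use rotation_order rel in auto)
  then show ?case by (simp add: act_append act_replicate)
qed auto

lemma ceq_parity: "coxeter_eq T u v \<Longrightarrow> even (length u) \<longleftrightarrow> even (length v)"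
proof (induction rule: coxeter_eq.induct)
  case (rel s t k u v)
  show ?case by (induction k) auto
qed auto

lemma not_singleton_ceq_Nil: "\<not> coxeter_eq T [s] []"
  using ceq_parity by fastforce

lemma singleton_ceq: "coxeter_eq T [s] [t] \<Longrightarrow> s = t"
proof (rule ccontr)
  assume a: "coxeter_eq T [s] [t]" "s \<noteq> t"
  have "simple_refl T s (simple_root s) = simple_refl T t (simple_root s)" using act_ceq[OF a(1)] by (simp add: fun_eq_iff)
  then have "(- simple_root s) $ s = simple_refl T t (simple_root s) $ s" by (simp add: refl_root_self)
  then show False using a(2) by (simp add: simple_refl_def root_nth)
qed

text \<open>The lower bound for the order of \<open>s t\<close>: its powers act as rotations by
  multiples of \<open>2 pi / n\<close>, and only full turns fix the vector at angle 0.\<close>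

lemma alt_ceq_Nil:
  assumes st: "s \<noteq> t" and n: "coxeter_matrix T s t = enat n" and k: "coxeter_eq T (alt s t k) []"
  shows "2 * n dvd k"
proof -
  have n2: "2 \<le> n" using coxeter_matrix_ge2_enat[OF st n] .
  define \<theta> where "\<theta> = pi / real n"
  have \<theta>: "real n * \<theta> = pi" "0 < \<theta>" "\<theta> < pi" using n2 by (auto simp: \<theta>_def field_simps)
  have "even k" using ceq_parity[OF k] by simp
  then obtain j where j: "k = 2 * j" by blast
  have "(simple_refl T s \<circ> simple_refl T t) ^^ j = id"
    using act_ceq[OF k] by (simp add: j alt_double act_replicate)
  then have "circ s t \<theta> (2 * real j * \<theta>) = circ s t \<theta> 0"
    using rotation_circ[OF st n \<theta>_def, of j 0] by simp
  then have "circ s t \<theta> (2 * real j * \<theta>) $ t = circ s t \<theta> 0 $ t"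
    "circ s t \<theta> (2 * real j * \<theta>) $ s = circ s t \<theta> 0 $ s" by simp_all
  then have eq: "sin (2 * real j * \<theta>) = 0" "sin (\<theta> + 2 * real j * \<theta>) = sin \<theta>"
    using st by (auto simp: circ_def root_nth)
  then have "sin \<theta> * cos (2 * real j * \<theta>) = sin \<theta>" by (simp add: sin_add)
  then have "cos (2 * real j * \<theta>) = 1" using sin_gt_zero[OF \<theta>(2,3)] by simp
  then obtain i :: int where "2 * real j * \<theta> = of_int i * 2 * pi"
    using cos_one_2pi_int by auto
  then have "real j = of_int i * real n" using \<theta> n2 by (simp add: \<theta>_def field_simps)
  then have "int j = i * int n" by (metis of_int_eq_iff of_int_mult of_int_of_nat_eq)
  then show ?thesis unfolding j by (metis dvd_triv_right int_dvd_int_iff mult_dvd_mono dvd_refl)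
qed

section \<open>Parabolic subgroups\<close>

text \<open>With \<open>s u\<close> reduced and equal to a reduced word \<open>w\<close> over
  \<open>K\<close>, prefixing \<open>s\<close> to \<open>w\<close> shortens it. Exchange then writes
  \<open>s\<close> as a product over \<open>K\<close>, and a generator lies in a parabolic subgroup
  only as one of its letters. The rest follows by induction.\<close>

lemma reduced_ceq_parabolic:
  "\<lbrakk>reduced T u; coxeter_eq T u v; v \<in> lists K\<rbrakk> \<Longrightarrow> u \<in> lists K"
proof (induction u arbitrary: v)
  case (Cons s u)
  obtain w where w: "coxeter_eq T w v" "reduced T w" "set w \<subseteq> set v"
    using reduced_subword[OF T] by blast
  have wK: "w \<in> lists K" using w(3) Cons.prems(3) by auto
  have uw: "coxeter_eq T (s # u) w" using ceq_trans[OF T Cons.prems(2) ceq_sym[OF T w(1)]] .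
  have lw: "length (s # u) \<le> length w"
    using Cons.prems(1) ceq_sym[OF T uw] unfolding reduced_def[OF T] by blast
  have usw: "coxeter_eq T u (s # w)" using uw unfolding ceq_move_Cons[OF T] .
  then have "\<not> reduced T (s # w)" using lw unfolding reduced_def[OF T] not_all not_imp not_le by (intro exI[of _ u]) simp
  then obtain x where x: "coxeter_eq T (s # w) x" "set x \<subseteq> set w" using exchange[OF T w(2)] by blast
  have xK: "x \<in> lists K" using x wK by auto
  have ux: "coxeter_eq T u x" using ceq_trans[OF T usw x(1)] .
  have sw: "coxeter_eq T (s # w @ rev w) (x @ rev w)"
    using ceq_append[OF T x(1) ceq_refl[OF T, of "rev w"]] by simp
  have "coxeter_eq T ([s] @ w @ rev w) ([s] @ [])"
    by (rule ceq_append[OF T ceq_refl[OF T] ceq_cancel_rev[OF T]])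
  then have "coxeter_eq T (s # w @ rev w) [s]" by simp
  then have sx: "coxeter_eq T [s] (x @ rev w)" by (rule ceq_trans[OF T ceq_sym[OF T] sw])
  obtain y where y: "coxeter_eq T y (x @ rev w)" "reduced T y" "set y \<subseteq> set (x @ rev w)"
    using reduced_subword[OF T] by blast
  have sy: "coxeter_eq T [s] y" using ceq_trans[OF T sx ceq_sym[OF T y(1)]] .
  then have "length y \<le> length [s]" using y(2) sy unfolding reduced_def[OF T] by blast
  moreover have "y \<noteq> []" using sy not_singleton_ceq_Nil by blast
  ultimately obtain k where "y = [k]" by (cases y) auto
  moreover from this have "s = k" using sy singleton_ceq by blast
  ultimately have "s \<in> K" using y(3) xK wK by auto
  then show ?case using Cons.IH[OF reduced_Cons[OF T Cons.prems(1)] ux xK] by simp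
qed simp

text \<open>A single reduced word of the element has its letters in every
  \<open>K i\<close>.\<close>

lemma parabolic_Inter:
  assumes "\<And>i. i \<in> I \<Longrightarrow> \<exists>v\<in>lists (K i). coxeter_eq T u v"
  shows "\<exists>v\<in>lists (\<Inter>i\<in>I. K i). coxeter_eq T u v"
proof -
  obtain v where v: "coxeter_eq T v u" "reduced T v" using reduced_exists[OF T] by blast
  have "v \<in> lists (K i)" if i: "i \<in> I" for i
  proof -
    obtain x where x: "x \<in> lists (K i)" "coxeter_eq T u x" using assms[OF i] by blast
    show ?thesis by (rule reduced_ceq_parabolic[OF v(2) ceq_trans[OF T v(1) x(2)] x(1)])
  qed
  then have "v \<in> lists (\<Inter>i\<in>I. K i)" unfolding in_lists_conv_set by blast
  then show ?thesis by (intro bexI[of _ v] ceq_sym[OF T v(1)])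
qed

lemma singleton_parabolic: "v \<in> lists K \<Longrightarrow> coxeter_eq T [s] v \<Longrightarrow> s \<in> K"
proof -
  assume v: "v \<in> lists K" "coxeter_eq T [s] v"
  have "reduced T [s]" unfolding reduced_def[OF T]
  proof (intro allI impI)
    fix w assume "coxeter_eq T w [s]"
    then have "w \<noteq> []" using not_singleton_ceq_Nil ceq_sym[OF T] by blast
    then show "length [s] \<le> length w" by (cases w) auto
  qed
  from reduced_ceq_parabolic[OF this v(2,1)] show ?thesis by simp
qed

end

section \<open>Coxeter complexes\<close>

lemma complex_iso_comp: "complex_iso f X Y \<Longrightarrow> complex_iso g Y Z \<Longrightarrow> complex_iso (g \<circ> f) X Z"
  unfolding complex_iso_def by (auto simp: image_comp o_def intro: bij_betw_trans[unfolded o_def])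

lemma complex_iso_inv:
  assumes "complex_iso f X Y"
  shows "complex_iso (the_inv_into (\<Union>X) f) Y X"
    and "v \<in> \<Union>X \<Longrightarrow> the_inv_into (\<Union>X) f (f v) = v"
    and "u \<in> \<Union>Y \<Longrightarrow> f (the_inv_into (\<Union>X) f u) = u"
proof -
  have bij: "bij_betw f (\<Union>X) (\<Union>Y)" and im: "(\<lambda>x. f ` x) ` X = Y"
    using assms by (auto simp: complex_iso_def)
  let ?g = "the_inv_into (\<Union>X) f"
  have "?g ` f ` x = x" if "x \<in> X" for x
  proof -
    have "?g ` f ` x = (\<lambda>v. v) ` x"
      unfolding image_image using that bij
      by (intro image_cong) (auto simp: bij_betw_def intro!: the_inv_into_f_f)
    then show ?thesis by simp
  qed
  then have "(\<lambda>y. ?g ` y) ` Y = X" unfolding im[symmetric] image_image by simp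
  then show "complex_iso ?g Y X" using bij by (simp add: complex_iso_def bij_betw_the_inv_into)
  show "v \<in> \<Union>X \<Longrightarrow> ?g (f v) = v" using bij by (simp add: bij_betw_def the_inv_into_f_f)
  show "u \<in> \<Union>Y \<Longrightarrow> f (?g u) = u" using bij by (simp add: bij_betw_def f_the_inv_into_f)
qed

lemma complex_isoD:
  assumes "complex_iso f X Y"
  shows "inj_on f (\<Union>X)" "f ` \<Union>X = \<Union>Y" "x \<in> X \<Longrightarrow> f ` x \<in> Y" "y \<in> Y \<Longrightarrow> \<exists>x\<in>X. f ` x = y"
  using assms unfolding complex_iso_def bij_betw_def by auto

abbreviation ver :: "'t::finite diagram \<Rightarrow> 't \<Rightarrow> 't list \<Rightarrow> 't list set" where
  "ver T i w \<equiv> standard_coset T (- {i}) w"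

definition chamber :: "'t::finite diagram \<Rightarrow> 't list \<Rightarrow> 't list set set" where
  "chamber T w = range (\<lambda>i. ver T i w)"

lemma coxeter_matrix_commute: "coxeter_matrix T s t = coxeter_matrix T t s"
  by (simp add: coxeter_matrix_def insert_commute)

lemma coxeter_complex_iff: "x \<in> coxeter_complex T \<longleftrightarrow> (\<exists>w J. x = (\<lambda>i. ver T i w) ` J)"
  by (auto simp: coxeter_complex_def)

lemma chamber_in_complex: "chamber T w \<in> coxeter_complex T"
  by (auto simp: coxeter_complex_iff chamber_def)

lemma ver_in_Union: "ver T i w \<in> \<Union>(coxeter_complex T)"
  using chamber_in_complex[of T w] unfolding chamber_def by blast

lemma Union_coxeter_complex: "v \<in> \<Union>(coxeter_complex T) \<longleftrightarrow> (\<exists>i w. v = ver T i w)"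
proof
  assume "v \<in> \<Union>(coxeter_complex T)"
  then show "\<exists>i w. v = ver T i w" unfolding coxeter_complex_def by blast
next
  assume "\<exists>i w. v = ver T i w"
  then show "v \<in> \<Union>(coxeter_complex T)" using ver_in_Union by metis
qed

context
  fixes T :: "'t::finite diagram"
  assumes T: "coxeter_diagram T"
begin

lemma mem_coset: "u \<in> standard_coset T K w \<longleftrightarrow> (\<exists>v\<in>lists K. coxeter_eq T u (w @ v))"
  by (simp add: standard_coset_def)

lemma coset_subset:
  assumes "v \<in> lists K" "coxeter_eq T w' (w @ v)"
  shows "standard_coset T K w' \<subseteq> standard_coset T K w"
proof
  fix u assume "u \<in> standard_coset T K w'"
  then obtain x where x: "x \<in> lists K" "coxeter_eq T u (w' @ x)" using mem_coset by blast
  have "coxeter_eq T (w' @ x) ((w @ v) @ x)" by (rule ceq_append[OF T assms(2) ceq_refl[OF T]])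
  then have "coxeter_eq T u (w @ (v @ x))" using ceq_trans[OF T x(2)] by simp
  moreover have "v @ x \<in> lists K" using x(1) assms(1) by simp
  ultimately show "u \<in> standard_coset T K w" unfolding mem_coset by (rule_tac bexI)
qed

lemma coset_eq_iff:
  "standard_coset T K w' = standard_coset T K w \<longleftrightarrow> (\<exists>v\<in>lists K. coxeter_eq T w' (w @ v))"
proof
  assume "standard_coset T K w' = standard_coset T K w"
  moreover have "w' \<in> standard_coset T K w'"
    unfolding mem_coset using ceq_refl[OF T] by (intro bexI[of _ "[]"]) auto
  ultimately show "\<exists>v\<in>lists K. coxeter_eq T w' (w @ v)" using mem_coset by blast
next
  assume "\<exists>v\<in>lists K. coxeter_eq T w' (w @ v)"
  then obtain v where v: "v \<in> lists K" "coxeter_eq T w' (w @ v)" by blast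
  have "coxeter_eq T (w' @ rev v) ((w @ v) @ rev v)" by (rule ceq_append[OF T v(2) ceq_refl[OF T]])
  moreover have "coxeter_eq T (w @ (v @ rev v)) (w @ [])"
    by (rule ceq_append[OF T ceq_refl[OF T] ceq_cancel_rev[OF T]])
  ultimately have "coxeter_eq T (w' @ rev v) w" using ceq_trans[OF T, of "w' @ rev v"] by simp
  then have "coxeter_eq T w (w' @ rev v)" by (rule ceq_sym[OF T])
  moreover have "rev v \<in> lists K" using v(1) by (simp add: in_lists_conv_set)
  ultimately show "standard_coset T K w' = standard_coset T K w"
    using coset_subset v by blast
qed

lemma coset_cong: "coxeter_eq T w' w \<Longrightarrow> standard_coset T K w' = standard_coset T K w"
  unfolding coset_eq_iff by (intro bexI[of _ "[]"]) auto

text \<open>Labels of vertices are well defined: the coset contains both \<open>w\<close> and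
  \<open>w\<close> followed by \<open>j\<close>, so its omitted generator cannot be \<open>j\<close>
  unless \<open>i = j\<close>.\<close>

lemma ver_type: "ver T i w = ver T j w' \<Longrightarrow> i = j"
proof (rule ccontr)
  assume e: "ver T i w = ver T j w'" and ij: "i \<noteq> j"
  have "w \<in> ver T i w" "w @ [j] \<in> ver T i w"
    unfolding mem_coset using ceq_refl[OF T] ij by (auto intro: bexI[of _ "[]"] bexI[of _ "[j]"])
  then obtain v v' where v: "v \<in> lists (- {j})" "coxeter_eq T w (w' @ v)"
      "v' \<in> lists (- {j})" "coxeter_eq T (w @ [j]) (w' @ v')"
    unfolding e mem_coset by blast
  have "coxeter_eq T [j] (rev w @ (w' @ v'))" using v(4) ceq_move_left[OF T] by blast
  moreover have "coxeter_eq T (rev w @ (w' @ v')) (rev (w' @ v) @ (w' @ v'))"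
    by (rule ceq_append[OF T ceq_rev[OF T v(2)] ceq_refl[OF T]])
  ultimately have "coxeter_eq T [j] (rev (w' @ v) @ (w' @ v'))" by (rule ceq_trans[OF T])
  then have 1: "coxeter_eq T [j] (rev v @ (rev w' @ w' @ v'))" by simp
  have "coxeter_eq T (rev v @ (rev w' @ w' @ v')) (rev v @ v')"
    by (rule ceq_append[OF T ceq_refl[OF T] ceq_rev_left[OF T]])
  then have "coxeter_eq T [j] (rev v @ v')" by (rule ceq_trans[OF T 1])
  moreover have "rev v @ v' \<in> lists (- {j})" using v(1,3) by (auto simp: in_lists_conv_set)
  ultimately show False using singleton_parabolic[OF T] by blast
qed

lemma inj_ver: "inj (\<lambda>i. ver T i w)"
  using ver_type by (auto simp: inj_def)

text \<open>The direction from left to right is where parabolic subgroups must intersect in the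
  parabolic subgroup of the common letters; it identifies the chambers sharing a face.\<close>

lemma ver_eq_iff: "(\<forall>i\<in>I. ver T i w' = ver T i w) \<longleftrightarrow> (\<exists>v\<in>lists (- I). coxeter_eq T w' (w @ v))"
proof
  assume a: "\<forall>i\<in>I. ver T i w' = ver T i w"
  have "\<exists>v\<in>lists (- {i}). coxeter_eq T (rev w @ w') v" if "i \<in> I" for i
    using a that unfolding coset_eq_iff ceq_move_left[OF T, of "rev w"] by simp
  from parabolic_Inter[OF T, of I "\<lambda>i. - {i}", OF this]
  obtain v where v: "v \<in> lists (\<Inter>i\<in>I. - {i})" "coxeter_eq T (rev w @ w') v" by blast
  moreover have "(\<Inter>i\<in>I. - {i}) = - I" by auto
  ultimately show "\<exists>v\<in>lists (- I). coxeter_eq T w' (w @ v)"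
    unfolding ceq_move_left[OF T, of "rev w"] by auto
next
  assume "\<exists>v\<in>lists (- I). coxeter_eq T w' (w @ v)"
  then obtain v where v: "v \<in> lists (- I)" "coxeter_eq T w' (w @ v)" by blast
  then have "v \<in> lists (- {i})" if "i \<in> I" for i using that by (auto simp: in_lists_conv_set)
  then show "\<forall>i\<in>I. ver T i w' = ver T i w" unfolding coset_eq_iff using v(2) by blast
qed

lemma card_face: "card ((\<lambda>i. ver T i w) ` J) = card J"
  by (rule card_image[OF inj_on_subset[OF inj_ver]]) simp

lemma card_chamber [simp]: "card (chamber T w) = CARD('t)"
  unfolding chamber_def by (rule card_face)

section \<open>Left translations and rigidity of the Coxeter complex\<close>

definition translate :: "'t list \<Rightarrow> 't list set \<Rightarrow> 't list set" where
  "translate w c = {u. \<exists>v\<in>c. coxeter_eq T u (w @ v)}"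

lemma translate_coset: "translate w (standard_coset T K u) = standard_coset T K (w @ u)"
proof (intro Set.set_eqI iffI)
  fix x assume "x \<in> translate w (standard_coset T K u)"
  then obtain y where "coxeter_eq T x (w @ y)" "y \<in> standard_coset T K u"
    unfolding translate_def by blast
  then obtain v where y: "coxeter_eq T x (w @ y)" "v \<in> lists K" "coxeter_eq T y (u @ v)"
    unfolding mem_coset by blast
  have "coxeter_eq T (w @ y) (w @ (u @ v))" by (rule ceq_append[OF T ceq_refl[OF T] y(3)])
  then have "coxeter_eq T x ((w @ u) @ v)" using ceq_trans[OF T y(1)] by simp
  then show "x \<in> standard_coset T K (w @ u)" unfolding mem_coset using y(2) by blast
next
  fix x assume "x \<in> standard_coset T K (w @ u)"
  then obtain v where "v \<in> lists K" "coxeter_eq T x ((w @ u) @ v)" unfolding mem_coset by blast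
  moreover from this have "u @ v \<in> standard_coset T K u"
    unfolding mem_coset by (intro bexI[of _ v] ceq_refl[OF T])
  ultimately show "x \<in> translate w (standard_coset T K u)"
    unfolding translate_def by auto
qed

lemma complex_iso_translate: "complex_iso (translate w) (coxeter_complex T) (coxeter_complex T)"
proof -
  have inv: "translate (rev w) (translate w v) = v" "translate w (translate (rev w) v) = v"
    if vU: "v \<in> \<Union>(coxeter_complex T)" for v
  proof -
    obtain i u where "v = ver T i u" using vU Union_coxeter_complex by metis
    then show "translate (rev w) (translate w v) = v" "translate w (translate (rev w) v) = v"
      using coset_cong[OF ceq_rev_left[OF T, of w u]] coset_cong[OF ceq_left_rev[OF T, of w u]]
      by (simp_all add: translate_coset)
  qed
  have mem: "translate x v \<in> \<Union>(coxeter_complex T)" if vU: "v \<in> \<Union>(coxeter_complex T)" for v x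
  proof -
    obtain i u where "v = ver T i u" using vU Union_coxeter_complex by metis
    then show ?thesis using ver_in_Union by (simp only: translate_coset)
  qed
  have bij: "bij_betw (translate w) (\<Union>(coxeter_complex T)) (\<Union>(coxeter_complex T))"
    by (rule bij_betwI[of _ _ _ "translate (rev w)"]) (intro Pi_I mem inv; assumption)+
  have im: "translate w ` (\<lambda>i. ver T i u) ` J = (\<lambda>i. ver T i (w @ u)) ` J" for w u J
    by (simp add: image_image translate_coset)
  have "(\<lambda>x. translate w ` x) ` coxeter_complex T = coxeter_complex T"
  proof (intro Set.set_eqI iffI)
    fix x assume "x \<in> coxeter_complex T"
    then obtain u J where x: "x = (\<lambda>i. ver T i u) ` J" unfolding coxeter_complex_iff by blast
    have "translate w ` (\<lambda>i. ver T i (rev w @ u)) ` J = x"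
      unfolding im x using coset_cong[OF ceq_left_rev[OF T, of w u]] by simp
    then show "x \<in> (\<lambda>x. translate w ` x) ` coxeter_complex T"
      using coxeter_complex_iff[of _ T] by blast
  next
    fix x assume "x \<in> (\<lambda>x. translate w ` x) ` coxeter_complex T"
    then obtain y where y: "y \<in> coxeter_complex T" "x = translate w ` y" by blast
    from y(1) obtain u J where "y = (\<lambda>i. ver T i u) ` J" unfolding coxeter_complex_iff by blast
    then have "x = (\<lambda>i. ver T i (w @ u)) ` J" using y(2) im by simp
    then show "x \<in> coxeter_complex T" unfolding coxeter_complex_iff by blast
  qed
  then show ?thesis using bij by (simp add: complex_iso_def)
qed

lemma lists_singleton_ceq: "v \<in> lists {s} \<Longrightarrow> coxeter_eq T v [] \<or> coxeter_eq T v [s]"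
proof (induction v)
  case (Cons a v)
  then have a: "a = s" and v: "coxeter_eq T v [] \<or> coxeter_eq T v [s]" by auto
  from v show ?case
  proof
    assume "coxeter_eq T v []"
    then show ?thesis using ceq_Cons[OF T, of v "[]" s] a by simp
  next
    assume "coxeter_eq T v [s]"
    then have "coxeter_eq T (s # v) (s # [s])" by (rule ceq_Cons[OF T])
    moreover have "coxeter_eq T (s # [s]) []" using ceq_involution[OF T, of "[]" s "[]"] by simp
    ultimately show ?thesis using a ceq_trans[OF T] by blast
  qed
qed (simp add: ceq_refl[OF T])

lemma ver_other: "i \<noteq> s \<Longrightarrow> ver T i (w @ [s]) = ver T i w"
  unfolding coset_eq_iff by (intro bexI[of _ "[s]"]) (auto simp: ceq_refl[OF T])

lemma ver_same: "ver T s (w @ [s]) \<noteq> ver T s w"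
proof
  assume "ver T s (w @ [s]) = ver T s w"
  then obtain v where v: "v \<in> lists (- {s})" "coxeter_eq T (w @ [s]) (w @ v)"
    unfolding coset_eq_iff by blast
  then have "coxeter_eq T [s] v" using ceq_cancel_left[OF T] by blast
  then show False using singleton_parabolic[OF T v(1)] by blast
qed

text \<open>A panel lies in only two chambers, so the fixed chambers of an automorphism
  propagate along galleries.\<close>

lemma automorphism_rigid:
  assumes g: "complex_iso g (coxeter_complex T) (coxeter_complex T)"
    and fix0: "\<And>i. g (ver T i w) = ver T i w"
  shows "g (ver T i (w @ u)) = ver T i (w @ u)"
proof (induction u arbitrary: i rule: rev_induct)
  case Nil
  then show ?case using fix0 by simp
next
  case (snoc s u)
  define z where "z = w @ u"
  have fixz: "g (ver T i z) = ver T i z" for i using snoc z_def by simp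
  have inj: "x = y" if "g x = g y" "x \<in> \<Union>(coxeter_complex T)" "y \<in> \<Union>(coxeter_complex T)" for x y
    using complex_isoD(1)[OF g] that by (auto dest: inj_onD)
  have "g ` chamber T (z @ [s]) \<in> coxeter_complex T"
    using complex_isoD(3)[OF g chamber_in_complex] .
  then obtain w' J where J: "g ` chamber T (z @ [s]) = (\<lambda>i. ver T i w') ` J"
    unfolding coxeter_complex_iff by blast
  have mem: "g (ver T i (z @ [s])) \<in> (\<lambda>i. ver T i w') ` J" for i
    using J unfolding chamber_def by blast
  have other: "ver T i w' = ver T i z" if i: "i \<noteq> s" for i
  proof -
    have "ver T i z \<in> (\<lambda>i. ver T i w') ` J" using mem[of i] ver_other[OF i] fixz by simp
    then obtain j where "ver T i z = ver T j w'" by blast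
    then show ?thesis using ver_type by metis
  qed
  obtain j where j: "g (ver T s (z @ [s])) = ver T j w'" using mem[of s] by blast
  have "j = s"
  proof (rule ccontr)
    assume js: "j \<noteq> s"
    then have "g (ver T s (z @ [s])) = g (ver T j z)" using j other fixz by simp
    then have "ver T s (z @ [s]) = ver T j z" by (rule inj[OF _ ver_in_Union ver_in_Union])
    then show False using ver_type js by blast
  qed
  have "\<forall>i\<in>- {s}. ver T i w' = ver T i z" using other by simp
  then obtain v where v: "v \<in> lists (- (- {s}))" "coxeter_eq T w' (z @ v)"
    unfolding ver_eq_iff by blast
  have "coxeter_eq T v [] \<or> coxeter_eq T v [s]" using lists_singleton_ceq v(1) by simp
  \<comment> \<open>Only the two chambers of the panel are possible; the first would give two
    vertices the same image.\<close>
  then have "ver T s w' = ver T s (z @ [s])"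
  proof
    assume "coxeter_eq T v []"
    then have "coxeter_eq T (z @ v) (z @ [])" by (rule ceq_append[OF T ceq_refl[OF T]])
    then have "coxeter_eq T w' z" using ceq_trans[OF T v(2)] by simp
    then have "ver T s w' = ver T s z" by (rule coset_cong)
    then have "g (ver T s (z @ [s])) = g (ver T s z)" using j \<open>j = s\<close> fixz by simp
    then have "ver T s (z @ [s]) = ver T s z" by (rule inj[OF _ ver_in_Union ver_in_Union])
    then show ?thesis using ver_same by blast
  next
    assume "coxeter_eq T v [s]"
    then have "coxeter_eq T (z @ v) (z @ [s])" by (rule ceq_append[OF T ceq_refl[OF T]])
    then show ?thesis using coset_cong ceq_trans[OF T v(2)] by blast
  qed
  then have "g (ver T i (z @ [s])) = ver T i (z @ [s])"
    using j \<open>j = s\<close> ver_other fixz by (cases "i = s") auto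
  then show ?case by (simp add: z_def)
qed

section \<open>Dihedral links\<close>

lemma alt_period:
  assumes "coxeter_matrix T s t = enat n"
  shows "coxeter_eq T (alt s t (2 * n)) []"
  using coxeter_eq.rel[OF assms, of "[]" "[]"] by (simp add: alt_double)

lemma alt_add_period:
  assumes "coxeter_matrix T s t = enat n"
  shows "coxeter_eq T (alt s t (k + 2 * n)) (alt s t k)"
proof -
  have "alt s t (2 * n + k) = alt s t (2 * n) @ alt s t k" using alt_add[of s t "2 * n" k] by simp
  then show ?thesis using ceq_append[OF T alt_period[OF assms] ceq_refl[OF T, of "alt s t k"]]
    by (simp add: add.commute)
qed

lemma alt_mod:
  assumes "coxeter_matrix T s t = enat n"
  shows "coxeter_eq T (alt s t k) (alt s t (k mod (2 * n)))"
proof -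
  have "coxeter_eq T (alt s t (l + 2 * n * j)) (alt s t l)" for l j :: nat
  proof (induction j)
    case (Suc j)
    have "coxeter_eq T (alt s t ((l + 2 * n * j) + 2 * n)) (alt s t (l + 2 * n * j))"
      by (rule alt_add_period[OF assms])
    then show ?case using ceq_trans[OF T _ Suc] by (simp add: algebra_simps)
  qed (simp add: ceq_refl[OF T])
  from this[of "k mod (2 * n)" "k div (2 * n)"] show ?thesis by simp
qed

lemma alt_ceq_iff:
  assumes st: "s \<noteq> t" and n: "coxeter_matrix T s t = enat n"
  shows "coxeter_eq T (alt s t k) (alt s t l) \<longleftrightarrow> k mod (2 * n) = l mod (2 * n)"
proof
  have le: "k mod (2 * n) = l mod (2 * n)" if kl: "k \<le> l" "coxeter_eq T (alt s t k) (alt s t l)" for k l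
  proof -
    define x y where "x = (if even k then s else t)" and "y = (if even k then t else s)"
    have "alt s t l = alt s t k @ alt x y (l - k)"
      using alt_add[of s t k "l - k"] kl(1) by (simp add: x_def y_def)
    then have "coxeter_eq T (alt s t k @ []) (alt s t k @ alt x y (l - k))" using kl(2) by simp
    then have "coxeter_eq T (alt x y (l - k)) []" using ceq_cancel_left[OF T] ceq_sym[OF T] by blast
    moreover have "x \<noteq> y" "coxeter_matrix T x y = enat n"
      using st n coxeter_matrix_commute[of T s t] by (auto simp: x_def y_def)
    ultimately have "2 * n dvd l - k" using alt_ceq_Nil[OF T] by blast
    then show ?thesis using kl(1) by (metis mod_eq_dvd_iff_nat)
  qed
  assume "coxeter_eq T (alt s t k) (alt s t l)"
  then show "k mod (2 * n) = l mod (2 * n)"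
    using le[of k l] le[of l k] ceq_sym[OF T] nat_le_linear[of k l] by metis
next
  assume "k mod (2 * n) = l mod (2 * n)"
  then show "coxeter_eq T (alt s t k) (alt s t l)"
    using alt_mod[OF n, of k] ceq_sym[OF T alt_mod[OF n, of l]] ceq_trans[OF T] by metis
qed

lemma dihedral_word:
  assumes st: "s \<noteq> t" and n: "coxeter_matrix T s t = enat n" and v: "v \<in> lists {s, t}"
  shows "\<exists>k. coxeter_eq T v (alt s t k)"
  using v
proof (induction v rule: rev_induct)
  case Nil
  show ?case by (intro exI[of _ 0]) (simp add: ceq_refl[OF T])
next
  case (snoc x v)
  have n2: "2 \<le> n" using coxeter_matrix_ge2_enat[OF T st n] .
  obtain k0 where "coxeter_eq T v (alt s t k0)" using snoc by auto
  \<comment> \<open>Adding a period ensures a last letter, which cancels when the appended letter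
    repeats it.\<close>
  then have "coxeter_eq T v (alt s t (k0 + 2 * n))"
    using ceq_trans[OF T _ ceq_sym[OF T alt_add_period[OF n]]] by blast
  moreover obtain k where "k0 + 2 * n = Suc k" using n2 by (cases "k0 + 2 * n") auto
  ultimately have k: "coxeter_eq T v (alt s t (Suc k))" by metis
  have vx: "coxeter_eq T (v @ [x]) (alt s t (Suc k) @ [x])"
    by (rule ceq_append[OF T k ceq_refl[OF T]])
  have x: "x \<in> {s, t}" using snoc by auto
  show ?case
  proof (cases "x = (if even k then s else t)")
    case True
    have "coxeter_eq T (alt s t k @ [x, x] @ []) (alt s t k @ [])" by (rule ceq_involution[OF T])
    then have "coxeter_eq T (alt s t (Suc k) @ [x]) (alt s t k)"
      using True by (simp add: alt_snoc del: alt.simps)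
    then show ?thesis using ceq_trans[OF T vx] by blast
  next
    case False
    then have "alt s t (Suc k) @ [x] = alt s t (Suc (Suc k))"
      using x alt_snoc[of s t "Suc k"] by auto
    then show ?thesis using vx by metis
  qed
qed

text \<open>The vertices of the \<open>2n\<close>-cycle that is the link of the base face of cotype \<open>{s, t}\<close>.\<close>

definition cyc :: "'t \<Rightarrow> 't \<Rightarrow> nat \<Rightarrow> 't list set" where
  "cyc s t k = ver T (if even k then s else t) (alt s t k)"

lemma cyc_Suc: "s \<noteq> t \<Longrightarrow> cyc s t (Suc k) = ver T (if even k then t else s) (alt s t k)"
  using ver_other[of t s "alt s t k"] ver_other[of s t "alt s t k"]
  by (auto simp: cyc_def alt_snoc simp del: alt.simps)

lemma cyc_pair:
  assumes "s \<noteq> t"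
  shows "{cyc s t k, cyc s t (Suc k)} = {ver T s (alt s t k), ver T t (alt s t k)}"
  unfolding cyc_Suc[OF assms] cyc_def[of s t k] by (simp add: insert_commute)

text \<open>If two vertices agree, the quotient of their words lies in the subgroup of
  \<open>s\<close> and \<open>t\<close> and in the one omitting the vertex type, hence is trivial or
  a single generator. Even length rules out the generator, and the order of \<open>s t\<close>
  finishes.\<close>

lemma cyc_eq_iff:
  assumes st: "s \<noteq> t" and n: "coxeter_matrix T s t = enat n"
  shows "cyc s t k = cyc s t l \<longleftrightarrow> k mod (2 * n) = l mod (2 * n)"
proof
  assume e: "cyc s t k = cyc s t l"
  then have p: "even k \<longleftrightarrow> even l" using ver_type[OF e[unfolded cyc_def]] st by (auto split: if_splits)
  define x where "x = (if even k then s else t)"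
  define y where "y = (if even k then t else s)"
  have "ver T x (alt s t k) = ver T x (alt s t l)" using e p by (simp add: cyc_def x_def)
  then obtain v where v: "v \<in> lists (- {x})" "coxeter_eq T (alt s t k) (alt s t l @ v)"
    unfolding coset_eq_iff by blast
  define u where "u = rev (alt s t l) @ alt s t k"
  have u1: "coxeter_eq T u v" using v(2) ceq_move_left[OF T, of "rev (alt s t l)"] by (simp add: u_def)
  have u2: "u \<in> lists {s, t}" using set_alt[of s t k] set_alt[of s t l] by (auto simp: u_def in_lists_conv_set)
  have "\<exists>v\<in>lists (if b then - {x} else {s, t}). coxeter_eq T u v" for b
    using u1 u2 v(1) ceq_refl[OF T] by (cases b) auto
  from parabolic_Inter[OF T, of UNIV "\<lambda>b. if b then - {x} else {s, t}", OF this]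
  obtain w where w: "w \<in> lists (\<Inter>b. if b then - {x} else {s, t})" "coxeter_eq T u w" by auto
  have "(\<Inter>b. if b then - {x} else {s, t}) \<subseteq> {y}" by (auto simp: x_def y_def split: if_splits)
  then have "w \<in> lists {y}" using w(1) lists_mono by blast
  then have "coxeter_eq T w [] \<or> coxeter_eq T w [y]" by (rule lists_singleton_ceq)
  moreover have "even (length w)" using ceq_parity[OF T w(2)] p by (simp add: u_def)
  ultimately have "coxeter_eq T w []" using ceq_parity[OF T] by fastforce
  then have "coxeter_eq T (rev (alt s t l) @ alt s t k) []" using ceq_trans[OF T w(2)] u_def by simp
  then have "coxeter_eq T (alt s t k) (alt s t l)" using ceq_move_left[OF T] by fastforce
  then show "k mod (2 * n) = l mod (2 * n)" using alt_ceq_iff[OF st n] by blast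
next
  assume a: "k mod (2 * n) = l mod (2 * n)"
  then have "even k \<longleftrightarrow> even l" by (metis dvd_triv_left mod_mod_cancel dvd_mod_iff)
  moreover have "coxeter_eq T (alt s t k) (alt s t l)" using a alt_ceq_iff[OF st n] by blast
  ultimately show "cyc s t k = cyc s t l" unfolding cyc_def using coset_cong by simp
qed

lemma cyc_edge:
  assumes st: "s \<noteq> t" and n: "coxeter_matrix T s t = enat n"
    and w: "\<And>i. i \<noteq> s \<Longrightarrow> i \<noteq> t \<Longrightarrow> ver T i w = ver T i []"
  shows "\<exists>k. {ver T s w, ver T t w} = {cyc s t k, cyc s t (Suc k)}"
proof -
  have "\<forall>i\<in>- {s, t}. ver T i w = ver T i []" using w by simp
  then obtain v where v: "v \<in> lists (- (- {s, t}))" "coxeter_eq T w ([] @ v)"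
    unfolding ver_eq_iff by blast
  then have "v \<in> lists {s, t}" by simp
  then obtain k where "coxeter_eq T v (alt s t k)" using dihedral_word[OF st n] by blast
  then have "coxeter_eq T w (alt s t k)" using ceq_trans[OF T v(2)] by simp
  then have "ver T i w = ver T i (alt s t k)" for i by (rule coset_cong)
  then show ?thesis unfolding cyc_pair[OF st] by (intro exI[of _ k]) simp
qed

lemma cyc_chamber:
  assumes st: "s \<noteq> t"
  shows "\<exists>w. {ver T s w, ver T t w} = {cyc s t k, cyc s t (Suc k)} \<and>
    (\<forall>i. i \<noteq> s \<longrightarrow> i \<noteq> t \<longrightarrow> ver T i w = ver T i [])"
proof -
  have "alt s t k \<in> lists (- (- {s, t}))" using set_alt[of s t k] by (auto simp: in_lists_conv_set)
  then have "\<exists>v\<in>lists (- (- {s, t})). coxeter_eq T (alt s t k) ([] @ v)"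
    using ceq_refl[OF T] by (metis append_Nil)
  then have "\<forall>i\<in>- {s, t}. ver T i (alt s t k) = ver T i []" unfolding ver_eq_iff .
  then show ?thesis unfolding cyc_pair[OF st] by (intro exI[of _ "alt s t k"]) simp
qed

end

section \<open>Retractions of buildings\<close>

locale labelled_building =
  fixes T :: "'t::finite diagram" and Y :: "'b set set" and E :: "'b set set set" and \<sigma> :: "'b \<Rightarrow> 't"
  assumes building: "building T Y E" and labelling: "building_labelling T E \<sigma>"
begin

lemma diagram: "coxeter_diagram T" using building by (simp add: building_def)

lemma complex: "abstract_complex Y" using building by (simp add: building_def)

lemma apartment_complex: "A \<in> E \<Longrightarrow> abstract_complex A" using building by (simp add: building_def)

lemma apartment_subset: "A \<in> E \<Longrightarrow> A \<subseteq> Y" using building by (auto simp: building_def)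

lemma common_apartment: "x \<in> Y \<Longrightarrow> y \<in> Y \<Longrightarrow> \<exists>A\<in>E. x \<in> A \<and> y \<in> A"
  using building by (simp add: building_def)

lemma apartment_iso:
  "\<lbrakk>A \<in> E; A' \<in> E; x \<in> A; x \<in> A'; y \<in> A; y \<in> A'\<rbrakk>
    \<Longrightarrow> \<exists>f. complex_iso f A A' \<and> (\<forall>v\<in>x \<union> y. f v = v)"
  using building unfolding building_def by blast

lemma subface: "x \<in> Y \<Longrightarrow> y \<subseteq> x \<Longrightarrow> y \<in> Y"
  using complex by (auto simp: abstract_complex_def)

lemma finite_face: "x \<in> Y \<Longrightarrow> finite x"
  using complex by (auto simp: abstract_complex_def)

lemma vertex_face: "v \<in> \<Union>Y \<Longrightarrow> {v} \<in> Y"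
  using subface by blast

definition typed :: "'b set set \<Rightarrow> ('b \<Rightarrow> 't list set) \<Rightarrow> bool" where
  "typed A f \<longleftrightarrow> complex_iso f A (coxeter_complex T) \<and> (\<forall>v\<in>\<Union>A. \<exists>w. f v = ver T (\<sigma> v) w)"

lemma typed_exists: "A \<in> E \<Longrightarrow> \<exists>f. typed A f"
  using labelling unfolding building_labelling_def typed_def by blast

lemma typed_iso: "typed A f \<Longrightarrow> complex_iso f A (coxeter_complex T)"
  by (simp add: typed_def)

lemma typed_ver: "typed A f \<Longrightarrow> v \<in> \<Union>A \<Longrightarrow> f v = ver T i w \<Longrightarrow> i = \<sigma> v"
  unfolding typed_def using ver_type[OF diagram] by metis

lemma typed_inj: "typed A f \<Longrightarrow> u \<in> \<Union>A \<Longrightarrow> v \<in> \<Union>A \<Longrightarrow> f u = f v \<Longrightarrow> u = v"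
  by (rule inj_onD[OF complex_isoD(1)[OF typed_iso]])

lemma typed_face:
  assumes "typed A f" "x \<in> A"
  shows "\<exists>w. \<forall>v\<in>x. f v = ver T (\<sigma> v) w"
proof -
  have "f ` x \<in> coxeter_complex T" using complex_isoD(3)[OF typed_iso] assms by blast
  then obtain w J where J: "f ` x = (\<lambda>i. ver T i w) ` J" unfolding coxeter_complex_iff by blast
  have "f v = ver T (\<sigma> v) w" if v: "v \<in> x" for v
  proof -
    have "f v \<in> (\<lambda>i. ver T i w) ` J" using v unfolding J[symmetric] by (rule imageI)
    then obtain j where "f v = ver T j w" by blast
    moreover from this have "j = \<sigma> v" using typed_ver[OF assms(1)] v assms(2) by blast
    ultimately show ?thesis by simp
  qed
  then show ?thesis by blast
qed

lemma inj_on_label: assumes "x \<in> Y" shows "inj_on \<sigma> x"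
proof -
  obtain A where A: "A \<in> E" "x \<in> A" using common_apartment[OF assms assms] by blast
  obtain f where f: "typed A f" using typed_exists[OF A(1)] by blast
  obtain w where w: "\<forall>v\<in>x. f v = ver T (\<sigma> v) w" using typed_face[OF f A(2)] by blast
  show ?thesis
  proof (rule inj_onI)
    fix u v assume uv: "u \<in> x" "v \<in> x" "\<sigma> u = \<sigma> v"
    then have "f u = f v" using w by simp
    then show "u = v" using typed_inj[OF f] A(2) uv by blast
  qed
qed

lemma card_label: "x \<in> Y \<Longrightarrow> card (\<sigma> ` x) = card x"
  using card_image[OF inj_on_label] .

lemma card_le: "x \<in> Y \<Longrightarrow> card x \<le> CARD('t)"
  using card_label card_mono[of UNIV "\<sigma> ` x"] by fastforce

lemma chamber_label: "c \<in> Y \<Longrightarrow> card c = CARD('t) \<Longrightarrow> \<sigma> ` c = UNIV"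
  using card_label card_subset_eq[of UNIV "\<sigma> ` c"] by fastforce

lemma typed_chamber:
  assumes "typed A f" "A \<in> E"
  shows "\<exists>c\<in>A. card c = CARD('t) \<and> (\<forall>v\<in>c. f v = ver T (\<sigma> v) w) \<and> f ` c = chamber T w"
proof -
  obtain c where c: "c \<in> A" "f ` c = chamber T w"
    using complex_isoD(4)[OF typed_iso[OF assms(1)] chamber_in_complex] by blast
  have "inj_on f c" using complex_isoD(1)[OF typed_iso[OF assms(1)]] c(1) by (auto intro: inj_on_subset)
  then have card: "card c = CARD('t)" using card_image c(2) card_chamber[OF diagram] by metis
  have "f v = ver T (\<sigma> v) w" if v: "v \<in> c" for v
  proof -
    have "f v \<in> chamber T w" using v c(2) by blast
    then obtain j where "f v = ver T j w" unfolding chamber_def by blast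
    moreover from this have "j = \<sigma> v" using typed_ver[OF assms(1)] v c(1) by blast
    ultimately show ?thesis by simp
  qed
  then show ?thesis using c card by blast
qed

lemma apartment_face_in_chamber:
  assumes "A \<in> E" "x \<in> A"
  shows "\<exists>c\<in>A. card c = CARD('t) \<and> x \<subseteq> c"
proof -
  obtain f where f: "typed A f" using typed_exists[OF assms(1)] by blast
  obtain w where w: "\<forall>v\<in>x. f v = ver T (\<sigma> v) w" using typed_face[OF f assms(2)] by blast
  obtain c where c: "c \<in> A" "card c = CARD('t)" "f ` c = chamber T w"
    using typed_chamber[OF f assms(1), of w] by blast
  have "x \<subseteq> c"
  proof
    fix v assume v: "v \<in> x"
    then have "f v \<in> f ` c" using w c(3) by (simp add: chamber_def)
    then obtain u where "u \<in> c" "f u = f v" by auto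
    then show "v \<in> c" using typed_inj[OF f] v assms(2) c(1) by blast
  qed
  then show ?thesis using c by blast
qed

lemma face_in_chamber: "x \<in> Y \<Longrightarrow> \<exists>c\<in>Y. card c = CARD('t) \<and> x \<subseteq> c"
  using common_apartment[of x x] apartment_face_in_chamber apartment_subset by blast

lemma dimension_eq: "dimension Y = CARD('t) - 1"
proof -
  have "{} \<in> Y" using complex by (simp add: abstract_complex_def)
  then obtain c where c: "c \<in> Y" "card c = CARD('t)" using face_in_chamber by metis
  have sub: "card ` Y \<subseteq> {..CARD('t)}" using card_le by blast
  have "Max (card ` Y) = CARD('t)"
  proof (rule Max_eqI)
    show "finite (card ` Y)" by (rule finite_subset[OF sub]) simp
    show "k \<le> CARD('t)" if "k \<in> card ` Y" for k using that sub by blast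
    show "CARD('t) \<in> card ` Y" using c by force
  qed
  then show ?thesis by (simp add: dimension_def)
qed

lemma faces_dimension: "faces Y (dimension Y) = {c \<in> Y. card c = CARD('t)}"
  by (simp add: faces_def dimension_eq)

subsection \<open>Coordinates centred at a chamber\<close>

text \<open>A label-preserving chart of the apartment \<open>A\<close> that places \<open>C\<close>
  at the base chamber, the coset of the empty word.\<close>

definition coord :: "'b set set \<Rightarrow> 'b set \<Rightarrow> ('b \<Rightarrow> 't list set) \<Rightarrow> bool" where
  "coord A C f \<longleftrightarrow> A \<in> E \<and> C \<in> A \<and> card C = CARD('t) \<and> typed A f \<and> (\<forall>v\<in>C. f v = ver T (\<sigma> v) [])"

lemma coord_exists:
  assumes A: "A \<in> E" "C \<in> A" "card C = CARD('t)"
  shows "\<exists>f. coord A C f"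
proof -
  obtain f where f: "typed A f" using typed_exists[OF A(1)] by blast
  obtain w where w: "\<forall>v\<in>C. f v = ver T (\<sigma> v) w" using typed_face[OF f A(2)] by blast
  define g where "g = translate T (rev w) \<circ> f"
  have "complex_iso g A (coxeter_complex T)"
    unfolding g_def by (rule complex_iso_comp[OF typed_iso[OF f] complex_iso_translate[OF diagram]])
  moreover have "\<exists>u. g v = ver T (\<sigma> v) u" if "v \<in> \<Union>A" for v
  proof -
    have "\<exists>u. f v = ver T (\<sigma> v) u" using f that unfolding typed_def by blast
    then show ?thesis by (auto simp: g_def translate_coset[OF diagram])
  qed
  moreover have "g v = ver T (\<sigma> v) []" if "v \<in> C" for v
    using w that coset_cong[OF diagram ceq_rev_cancel[OF diagram, of w]]
    by (simp add: g_def translate_coset[OF diagram])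
  moreover from calculation(1,2) have "typed A g" unfolding typed_def by blast
  ultimately show ?thesis using A by (intro exI[of _ g]) (simp add: coord_def)
qed

text \<open>Going from one chart to the other through an apartment isomorphism fixing
  \<open>C\<close> and \<open>v\<close> gives an automorphism of the Coxeter complex fixing the base
  chamber, which is the identity. This makes the retraction independent of the apartment.\<close>

lemma coord_unique:
  assumes f: "coord A C f" and f': "coord A' C f'" and v: "v \<in> \<Union>A" "v \<in> \<Union>A'"
  shows "f v = f' v"
proof -
  have A: "A \<in> E" "C \<in> A" "card C = CARD('t)" "typed A f" "\<And>v. v \<in> C \<Longrightarrow> f v = ver T (\<sigma> v) []"
    using f by (auto simp: coord_def)
  have A': "A' \<in> E" "C \<in> A'" "typed A' f'" "\<And>v. v \<in> C \<Longrightarrow> f' v = ver T (\<sigma> v) []"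
    using f' by (auto simp: coord_def)
  have "{v} \<in> A" "{v} \<in> A'"
    using v apartment_complex[OF A(1)] apartment_complex[OF A'(1)] by (auto simp: abstract_complex_def)
  then obtain \<psi> where \<psi>: "complex_iso \<psi> A A'" "\<forall>u\<in>C \<union> {v}. \<psi> u = u"
    using apartment_iso[OF A(1) A'(1) A(2) A'(2)] by blast
  note iso = typed_iso[OF A(4)]
  define h where "h = the_inv_into (\<Union>A) f"
  have hf: "h (f u) = u" if "u \<in> \<Union>A" for u
    using complex_iso_inv(2)[OF iso that] by (simp add: h_def)
  define g where "g = f' \<circ> (\<psi> \<circ> h)"
  have g: "complex_iso g (coxeter_complex T) (coxeter_complex T)"
    unfolding g_def h_def
    by (intro complex_iso_comp[OF _ typed_iso[OF A'(3)]] complex_iso_comp[OF _ \<psi>(1)] complex_iso_inv(1)[OF iso])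
  have "g (ver T i []) = ver T i []" for i
  proof -
    have "i \<in> \<sigma> ` C" using chamber_label[of C] A apartment_subset by blast
    then obtain u where u: "u \<in> C" "i = \<sigma> u" by blast
    have "h (f u) = u" using u(1) A(2) by (intro hf) blast
    moreover have "\<psi> u = u" using u(1) \<psi>(2) by blast
    ultimately have "g (f u) = f u" using A(5)[OF u(1)] A'(4)[OF u(1)] by (simp add: g_def)
    then show ?thesis using u A(5) by simp
  qed
  from automorphism_rigid[OF diagram g this]
  have "g (ver T i u) = ver T i u" for i u by simp
  moreover obtain w where "f v = ver T (\<sigma> v) w" using A(4) v(1) unfolding typed_def by blast
  ultimately have "g (f v) = f v" by simp
  then show ?thesis using hf[OF v(1)] \<psi>(2) by (simp add: g_def)
qed

definition retraction :: "'b set \<Rightarrow> 'b \<Rightarrow> 't list set" where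
  "retraction C v = (THE z. \<exists>A f. coord A C f \<and> v \<in> \<Union>A \<and> z = f v)"

lemma retraction_eq: "coord A C f \<Longrightarrow> v \<in> \<Union>A \<Longrightarrow> retraction C v = f v"
  unfolding retraction_def using coord_unique by (intro the_equality) blast+

lemma common_coord:
  assumes "C \<in> Y" "card C = CARD('t)" "x \<in> Y"
  shows "\<exists>A f. coord A C f \<and> x \<in> A"
  using common_apartment[OF assms(1,3)] coord_exists assms(2) by blast

lemma retraction_face:
  assumes "C \<in> Y" "card C = CARD('t)" "x \<in> Y"
  shows "\<exists>w. \<forall>v\<in>x. retraction C v = ver T (\<sigma> v) w"
proof -
  obtain A f where A: "coord A C f" "x \<in> A" using common_coord[OF assms] by blast
  then have "typed A f" by (simp add: coord_def)
  from typed_face[OF this A(2)] obtain w where "\<forall>v\<in>x. f v = ver T (\<sigma> v) w" by blast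
  then show ?thesis using retraction_eq[OF A(1)] A(2) by (intro exI[of _ w]) auto
qed

lemma retraction_base:
  assumes "C \<in> Y" "card C = CARD('t)" "v \<in> C"
  shows "retraction C v = ver T (\<sigma> v) []"
proof -
  obtain A f where A: "coord A C f" using common_coord[OF assms(1,2,1)] by blast
  then show ?thesis using retraction_eq[OF A, of v] assms(3) by (auto simp: coord_def)
qed

text \<open>A chart of an apartment containing both chambers is injective, so only the centre lies
  over the base chamber.\<close>

lemma retraction_base_unique:
  assumes "C \<in> Y" "card C = CARD('t)" "D \<in> Y" "card D = CARD('t)"
    and D: "\<And>v. v \<in> D \<Longrightarrow> retraction C v = ver T (\<sigma> v) []"
  shows "D = C"
proof -
  obtain A f where A: "coord A C f" "D \<in> A" using common_coord[OF assms(1-3)] by blast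
  then have f: "typed A f" "C \<in> A" "\<And>v. v \<in> C \<Longrightarrow> f v = ver T (\<sigma> v) []" by (auto simp: coord_def)
  have "D \<subseteq> C"
  proof
    fix v assume v: "v \<in> D"
    then have fv: "f v = ver T (\<sigma> v) []" using D retraction_eq[OF A(1), of v] A(2) by fastforce
    have "\<sigma> v \<in> \<sigma> ` C" using chamber_label[OF assms(1,2)] by simp
    then obtain u where u: "u \<in> C" "\<sigma> u = \<sigma> v" by force
    then have "f u = f v" using f(3) fv by simp
    then show "v \<in> C" using typed_inj[OF f(1)] u v f(2) A(2) by blast
  qed
  then show ?thesis using assms(2,4) card_subset_eq[OF finite_face[OF assms(1)]] by simp
qed

subsection \<open>Gallery connectedness of stars\<close>

text \<open>In an apartment containing \<open>C\<close> and \<open>D\<close>, a word avoiding the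
  types of \<open>x\<close> leads from one to the other. Its gallery stays in the star of
  \<open>x\<close>, so \<open>h\<close> is carried along from chamber to chamber.\<close>

lemma star_connected:
  assumes x: "card x + 2 \<le> CARD('t)"
    and h: "\<And>c u v. \<lbrakk>c \<in> Y; card c = CARD('t); x \<subseteq> c; u \<in> c - x; v \<in> c - x\<rbrakk> \<Longrightarrow> h u = h v"
    and C: "C \<in> Y" "card C = CARD('t)" "x \<subseteq> C" "u \<in> C - x"
    and D: "D \<in> Y" "card D = CARD('t)" "x \<subseteq> D" "v \<in> D - x"
  shows "h u = h v"
proof -
  obtain A f where A: "coord A C f" "D \<in> A" using common_coord[OF C(1,2) D(1)] by blast
  then have f: "typed A f" "C \<in> A" "A \<in> E" "\<And>v. v \<in> C \<Longrightarrow> f v = ver T (\<sigma> v) []" by (auto simp: coord_def)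
  define I where "I = \<sigma> ` x"
  have I: "card I + 2 \<le> CARD('t)" using x card_label[OF subface[OF C(1,3)]] by (simp add: I_def)
  obtain w where w: "\<forall>v\<in>D. f v = ver T (\<sigma> v) w" using typed_face[OF f(1) A(2)] by blast
  have "\<forall>i\<in>I. ver T i w = ver T i []"
    using w f(4) C(3) D(3) unfolding I_def by (metis image_iff subsetD)
  then obtain z where z: "z \<in> lists (- I)" "coxeter_eq T w ([] @ z)"
    unfolding ver_eq_iff[OF diagram] by blast
  have wz: "ver T i w = ver T i z" for i using coset_cong[OF diagram z(2)] by simp
  have ex: "\<exists>c\<in>A. card c = CARD('t) \<and> x \<subseteq> c \<and> (\<forall>v\<in>c. f v = ver T (\<sigma> v) y)"
    if y: "y \<in> lists (- I)" for y
  proof -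
    obtain c where c: "c \<in> A" "card c = CARD('t)" "\<forall>v\<in>c. f v = ver T (\<sigma> v) y" "f ` c = chamber T y"
      using typed_chamber[OF f(1,3), of y] by blast
    have "\<exists>v\<in>lists (- I). coxeter_eq T y ([] @ v)" using y ceq_refl[OF diagram] by (metis append_Nil)
    then have yI: "\<forall>i\<in>I. ver T i y = ver T i []" unfolding ver_eq_iff[OF diagram] .
    have "x \<subseteq> c"
    proof
      fix v assume v: "v \<in> x"
      then have "f v = ver T (\<sigma> v) y" using f(4) C(3) yI by (auto simp: I_def)
      then have "f v \<in> f ` c" unfolding c(4) chamber_def by blast
      then obtain u where "u \<in> c" "f u = f v" by auto
      then show "v \<in> c" using typed_inj[OF f(1)] v C(3) f(2) c(1) by blast
    qed
    then show ?thesis using c by blast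
  qed
  have AY: "c \<in> Y" if "c \<in> A" for c using apartment_subset[OF f(3)] that by blast
  have "\<forall>c\<in>A. card c = CARD('t) \<longrightarrow> x \<subseteq> c \<longrightarrow> (\<forall>v\<in>c. f v = ver T (\<sigma> v) y) \<longrightarrow> (\<forall>v\<in>c - x. h v = h u)"
    if "y \<in> lists (- I)" for y
    using that
  proof (induction y rule: rev_induct)
    case Nil
    show ?case
    proof (intro ballI impI)
      fix c v assume c: "c \<in> A" "card c = CARD('t)" "x \<subseteq> c" "\<forall>v\<in>c. f v = ver T (\<sigma> v) []" and v: "v \<in> c - x"
      have "c = C"
      proof (rule retraction_base_unique[OF C(1,2) AY[OF c(1)] c(2)])
        fix v assume "v \<in> c"
        then show "retraction C v = ver T (\<sigma> v) []"
          using retraction_eq[OF A(1), of v] c(1,4) by auto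
      qed
      then show "h v = h u" using h[OF C(1-3)] v C(4) by blast
    qed
  next
    case (snoc s y)
    then have y: "y \<in> lists (- I)" and s: "s \<notin> I" by auto
    obtain b where b: "b \<in> A" "card b = CARD('t)" "x \<subseteq> b" "\<forall>v\<in>b. f v = ver T (\<sigma> v) y"
      using ex[OF y] by blast
    \<comment> \<open>Codimension at least two leaves a type \<open>j\<close> outside both
      \<open>x\<close> and the crossed panel's cotype; the two adjacent chambers share that vertex
      off \<open>x\<close>.\<close>
    have "card (insert s I) < CARD('t)" using I card_insert_le_m1[of "card I + 1" I s] by (simp add: card_insert_if)
    then have "insert s I \<noteq> UNIV" by auto
    then obtain j where j: "j \<notin> I" "j \<noteq> s" by auto
    have "j \<in> \<sigma> ` b" using chamber_label[OF AY[OF b(1)] b(2)] by simp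
    then obtain a where a: "a \<in> b" "\<sigma> a = j" by blast
    have ax: "a \<notin> x" using a j by (auto simp: I_def)
    then have ha: "h a = h u" using snoc.IH[OF y] b a by blast
    show ?case
    proof (intro ballI impI)
      fix c v assume c: "c \<in> A" "card c = CARD('t)" "x \<subseteq> c" "\<forall>v\<in>c. f v = ver T (\<sigma> v) (y @ [s])" and v: "v \<in> c - x"
      have "j \<in> \<sigma> ` c" using chamber_label[OF AY[OF c(1)] c(2)] by simp
      then obtain a' where a': "a' \<in> c" "\<sigma> a' = j" by blast
      have "f a' = f a" using a a' b(4) c(4) ver_other[OF diagram j(2)] by simp
      then have "a' = a" using typed_inj[OF f(1)] a(1) a'(1) b(1) c(1) by blast
      then have "h v = h a" using h[OF AY[OF c(1)] c(2,3), of v a] v a' ax by blast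
      then show "h v = h u" using ha by simp
    qed
  qed
  from this[OF z(1)] have "\<forall>v\<in>D - x. h v = h u" using A(2) D(2,3) w wz by simp
  then show ?thesis using D(4) by simp
qed

end

section \<open>Links of codimension two\<close>

context labelled_building
begin

definition chambers :: "'b set set" where
  "chambers = {c \<in> Y. card c = CARD('t)}"

definition link_vertices :: "'b set \<Rightarrow> 'b set" where
  "link_vertices y = {v. v \<notin> y \<and> insert v y \<in> Y}"

definition link_adj :: "'b set \<Rightarrow> 'b \<Rightarrow> 'b \<Rightarrow> bool" where
  "link_adj y u v \<longleftrightarrow> u \<notin> y \<and> v \<notin> y \<and> u \<noteq> v \<and> {u, v} \<union> y \<in> Y"

lemma link_adj_sym: "link_adj y u v \<Longrightarrow> link_adj y v u"
  by (auto simp: link_adj_def insert_commute)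

lemma link_adj_vertex: "link_adj y u v \<Longrightarrow> u \<in> link_vertices y"
  by (auto simp: link_adj_def link_vertices_def intro: subface)

lemma star_chambers: "star chambers y = {c \<in> Y. card c = CARD('t) \<and> y \<subseteq> c}"
  by (auto simp: star_def chambers_def)

lemma link_vertex_iff: "v \<in> link_vertices y \<longleftrightarrow> v \<in> \<Union>(star chambers y) - y"
proof
  assume "v \<in> link_vertices y"
  then have "v \<notin> y" "insert v y \<in> Y" by (auto simp: link_vertices_def)
  moreover from this(2) obtain c where "c \<in> Y" "card c = CARD('t)" "insert v y \<subseteq> c"
    using face_in_chamber by meson
  ultimately show "v \<in> \<Union>(star chambers y) - y" by (auto simp: star_chambers)
next
  assume "v \<in> \<Union>(star chambers y) - y"
  then obtain c where "c \<in> Y" "insert v y \<subseteq> c" "v \<notin> y" by (auto simp: star_chambers)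
  then show "v \<in> link_vertices y" using subface by (auto simp: link_vertices_def)
qed

context
  fixes y :: "'b set" and s t :: 't
  assumes y: "y \<in> Y" and cotype: "- (\<sigma> ` y) = {s, t}" and st: "s \<noteq> t"
begin

lemma card_cotype: "card y + 2 = CARD('t)"
proof -
  have "card (\<sigma> ` y) + card (- (\<sigma> ` y)) = CARD('t)"
    using card_Un_disjoint[of "\<sigma> ` y" "- (\<sigma> ` y)"] by simp
  then show ?thesis using card_label[OF y] cotype st by simp
qed

lemma label_face: "a \<in> y \<Longrightarrow> \<sigma> a \<noteq> s \<and> \<sigma> a \<noteq> t"
  using cotype by blast

lemma label_vertex: assumes "v \<in> link_vertices y" shows "\<sigma> v = s \<or> \<sigma> v = t"
proof -
  have v: "v \<notin> y" "insert v y \<in> Y" using assms by (auto simp: link_vertices_def)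
  have "\<sigma> v \<notin> \<sigma> ` y" using inj_on_label[OF v(2)] v(1) by (auto simp: inj_on_def)
  then show ?thesis using cotype by blast
qed

lemma adj_card: assumes "link_adj y u v" shows "card ({u, v} \<union> y) = CARD('t)"
  using assms finite_face[OF y] card_cotype by (auto simp: link_adj_def)

lemma adj_label: assumes "link_adj y u v" shows "{\<sigma> u, \<sigma> v} = {s, t}"
proof -
  have "\<sigma> u \<noteq> \<sigma> v" using assms inj_on_label[of "{u, v} \<union> y"] by (auto simp: link_adj_def inj_on_def)
  then show ?thesis
    using label_vertex[OF link_adj_vertex[OF assms]] label_vertex[OF link_adj_vertex[OF link_adj_sym[OF assms]]]
    by auto
qed

lemma chamber_split:
  assumes c: "c \<in> Y" "card c = CARD('t)" "y \<subseteq> c"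
  shows "\<exists>u v. \<sigma> u = s \<and> \<sigma> v = t \<and> link_adj y u v \<and> c = {u, v} \<union> y"
proof -
  have "s \<in> \<sigma> ` c" "t \<in> \<sigma> ` c" using chamber_label[OF c(1,2)] by auto
  then obtain u v where uv: "u \<in> c" "\<sigma> u = s" "v \<in> c" "\<sigma> v = t" by blast
  have "u \<notin> y" "v \<notin> y" "u \<noteq> v" using label_face uv st by auto
  moreover have "card ({u, v} \<union> y) = CARD('t)"
    using calculation finite_face[OF y] card_cotype by auto
  then have "{u, v} \<union> y = c" using card_subset_eq[OF finite_face[OF c(1)], of "{u, v} \<union> y"] uv c by simp
  ultimately have "link_adj y u v" using c(1) by (simp add: link_adj_def)
  then show ?thesis using uv \<open>{u, v} \<union> y = c\<close> by metis
qed

lemma link_nbr: assumes v: "v \<in> link_vertices y" shows "\<exists>w. link_adj y v w"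
proof -
  obtain c where c: "c \<in> Y" "card c = CARD('t)" "y \<subseteq> c" "v \<in> c" "v \<notin> y"
    using v by (auto simp: link_vertex_iff star_chambers)
  from chamber_split[OF c(1-3)] obtain u w where "link_adj y u w" "c = {u, w} \<union> y" by blast
  then show ?thesis using c(4,5) link_adj_sym by blast
qed

text \<open>The retraction centred at \<open>C\<close> sends the link of \<open>y\<close> to the
  link of the base face of cotype \<open>{s, t}\<close>, and \<open>cyc\<close> numbers the latter
  by the \<open>2 n\<close>-cycle.\<close>

lemma folding_exists:
  assumes n: "coxeter_matrix T s t = enat n"
    and e: "link_adj y u0 u1" "\<sigma> u0 = s" "\<sigma> u1 = t"
  shows "\<exists>r. folding_map (link_vertices y) (link_adj y) n u0 u1 r"
proof -
  note D = diagram
  define C where "C = {u0, u1} \<union> y"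
  have C: "C \<in> Y" "card C = CARD('t)" using e(1) adj_card[OF e(1)] by (auto simp: C_def link_adj_def)
  have n2: "2 \<le> n" using coxeter_matrix_ge2_enat[OF D st n] .
  define r where "r v = (SOME k. k < 2 * n \<and> retraction C v = cyc T s t k)" for v
  have r_unique: "r v = k mod (2 * n)" if k: "retraction C v = cyc T s t k" for v k
  proof -
    have "cyc T s t k = cyc T s t (k mod (2 * n))" using cyc_eq_iff[OF D st n] by simp
    then have "k mod (2 * n) < 2 * n \<and> retraction C v = cyc T s t (k mod (2 * n))" using k n2 by simp
    then have "r v < 2 * n \<and> retraction C v = cyc T s t (r v)" unfolding r_def by (rule someI)
    then have "r v mod (2 * n) = k mod (2 * n)" "r v < 2 * n" using k cyc_eq_iff[OF D st n] by auto
    then show ?thesis by simp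
  qed
  have base: "retraction C a = ver T (\<sigma> a) []" if "a \<in> C" for a using retraction_base[OF C that] .
  have edge: "\<exists>k. {retraction C v, retraction C w} = {cyc T s t k, cyc T s t (Suc k)}"
    if vw: "link_adj y v w" for v w
  proof -
    have F: "{v, w} \<union> y \<in> Y" using vw by (simp add: link_adj_def)
    obtain z where z: "\<forall>a\<in>{v, w} \<union> y. retraction C a = ver T (\<sigma> a) z" using retraction_face[OF C F] by blast
    have "ver T i z = ver T i []" if i: "i \<noteq> s" "i \<noteq> t" for i
    proof -
      have "i \<in> \<sigma> ` y" using i cotype by blast
      then obtain a where a: "a \<in> y" "i = \<sigma> a" by blast
      then show ?thesis using z base[of a] by (simp add: C_def)
    qed
    from cyc_edge[OF D st n this] obtain k where k: "{ver T s z, ver T t z} = {cyc T s t k, cyc T s t (Suc k)}" by metis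
    have "{retraction C v, retraction C w} = (\<lambda>i. ver T i z) ` {\<sigma> v, \<sigma> w}" using z by simp
    also have "\<dots> = {ver T s z, ver T t z}" unfolding adj_label[OF vw] by simp
    finally show ?thesis unfolding k by (rule exI)
  qed
  have rho: "\<exists>k. retraction C v = cyc T s t k" if v: "v \<in> link_vertices y" for v
  proof -
    obtain w where "link_adj y v w" using link_nbr[OF v] by blast
    from edge[OF this] show ?thesis by (metis doubleton_eq_iff)
  qed
  have r_lt: "r v < 2 * n" if "v \<in> link_vertices y" for v
    using rho[OF that] r_unique[of v] n2 by fastforce
  have r_rho: "retraction C v = cyc T s t (r v)" if v: "v \<in> link_vertices y" for v
  proof -
    obtain k where k: "retraction C v = cyc T s t k" using rho[OF v] by metis
    then have "r v = k mod (2 * n)" by (rule r_unique)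
    then show ?thesis using k cyc_eq_iff[OF D st n, of "r v" k] by simp
  qed
  have ru0: "r u0 = 0"
    using r_unique[of u0 0] base[of u0] e(2) by (simp add: C_def cyc_def[OF D])
  have ru1: "r u1 = 1"
    using r_unique[of u1 1] base[of u1] e(3) cyc_Suc[OF D st, of 0] n2 by (simp add: C_def)
  have hom: "r w = Suc (r v) mod (2 * n) \<or> r v = Suc (r w) mod (2 * n)" if vw: "link_adj y v w" for v w
  proof -
    obtain k where "{retraction C v, retraction C w} = {cyc T s t k, cyc T s t (Suc k)}" using edge[OF vw] by metis
    then consider "retraction C v = cyc T s t k" "retraction C w = cyc T s t (Suc k)"
      | "retraction C w = cyc T s t k" "retraction C v = cyc T s t (Suc k)" by (metis doubleton_eq_iff)
    then show ?thesis
    proof cases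
      case 1
      then show ?thesis using r_unique by (simp add: mod_Suc_eq)
    next
      case 2
      then show ?thesis using r_unique by (simp add: mod_Suc_eq)
    qed
  qed
  \<comment> \<open>An edge over the base edge, together with \<open>y\<close>, is a chamber over
    the base chamber, hence \<open>C\<close>.\<close>
  have uniq: "w = u0 \<and> w' = u1" if ww: "link_adj y w w'" "r w = 0" "r w' = 1" for w w'
  proof -
    define F where "F = {w, w'} \<union> y"
    have F: "F \<in> Y" "card F = CARD('t)" using ww(1) adj_card[OF ww(1)] by (auto simp: F_def link_adj_def)
    obtain z where z: "\<forall>a\<in>F. retraction C a = ver T (\<sigma> a) z" using retraction_face[OF C F(1)] by blast
    have V: "w \<in> link_vertices y" "w' \<in> link_vertices y"
      using link_adj_vertex ww(1) link_adj_sym by blast+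
    have w1: "retraction C w = ver T s []" using r_rho[OF V(1)] ww(2) by (simp add: cyc_def[OF D])
    have w2: "retraction C w' = ver T t []" using r_rho[OF V(2)] ww(3) cyc_Suc[OF D st, of 0] by simp
    have l: "\<sigma> w = s" "\<sigma> w' = t"
      using w1 w2 z ver_type[OF D] by (metis F_def UnI1 insertI1 insertI2)+
    have "F = C"
    proof (rule retraction_base_unique[OF C F])
      fix a assume "a \<in> F"
      then consider "a = w" | "a = w'" | "a \<in> y" by (auto simp: F_def)
      then show "retraction C a = ver T (\<sigma> a) []"
        using w1 w2 l base[of a] by cases (auto simp: C_def)
    qed
    then have "w \<in> {u0, u1} \<union> y" "w' \<in> {u0, u1} \<union> y" by (auto simp: F_def C_def)
    then show ?thesis using l e(2,3) st ww(1) by (auto simp: link_adj_def)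
  qed
  \<comment> \<open>An apartment containing \<open>C\<close> and \<open>v\<close> contains the whole
    cycle around \<open>y\<close>; pulling it back through the chart gives the walk.\<close>
  have lift: "\<exists>\<gamma>. (\<forall>k. link_adj y (\<gamma> k) (\<gamma> (Suc k)) \<and> r (\<gamma> k) = k mod (2 * n)) \<and> \<gamma> (r v) = v"
    if v: "v \<in> link_vertices y" for v
  proof -
    have vY: "insert v y \<in> Y" using v by (simp add: link_vertices_def)
    obtain A f where A: "coord A C f" "insert v y \<in> A" using common_coord[OF C vY] by blast
    have f: "typed A f" "A \<in> E" "C \<in> A" "\<And>a. a \<in> C \<Longrightarrow> f a = ver T (\<sigma> a) []" using A(1) by (auto simp: coord_def)
    define \<gamma> where "\<gamma> k = the_inv_into (\<Union>A) f (cyc T s t k)" for k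
    have inv: "the_inv_into (\<Union>A) f (f a) = a" if "a \<in> \<Union>A" for a
      using complex_iso_inv(2)[OF typed_iso[OF f(1)] that] .
    have step: "link_adj y (\<gamma> k) (\<gamma> (Suc k)) \<and> r (\<gamma> k) = k mod (2 * n)" for k
    proof -
      obtain z where z: "{ver T s z, ver T t z} = {cyc T s t k, cyc T s t (Suc k)}"
        "\<forall>i. i \<noteq> s \<longrightarrow> i \<noteq> t \<longrightarrow> ver T i z = ver T i []" using cyc_chamber[OF D st, of k] by metis
      obtain c where c: "c \<in> A" "card c = CARD('t)" "\<forall>v\<in>c. f v = ver T (\<sigma> v) z" "f ` c = chamber T z"
        using typed_chamber[OF f(1,2), of z] by blast
      have cY: "c \<in> Y" using apartment_subset[OF f(2)] c(1) by blast
      have "y \<subseteq> c"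
      proof
        fix a assume a: "a \<in> y"
        then have "f a = ver T (\<sigma> a) z" using f(4)[of a] z(2) label_face[OF a] by (simp add: C_def)
        then have "f a \<in> f ` c" unfolding c(4) chamber_def by blast
        then obtain a' where "a' \<in> c" "f a' = f a" by auto
        moreover have "a \<in> \<Union>A" using a f(3) unfolding C_def by blast
        ultimately show "a \<in> c" using typed_inj[OF f(1), of a' a] c(1) by blast
      qed
      from chamber_split[OF cY c(2) this]
      obtain u w where uw: "\<sigma> u = s" "\<sigma> w = t" "link_adj y u w" "c = {u, w} \<union> y" by blast
      have fu: "f u = ver T s z" "f w = ver T t z" using c(3) uw by auto
      have uA: "u \<in> \<Union>A" "w \<in> \<Union>A" using uw(4) c(1) by auto
      have "{f u, f w} = {cyc T s t k, cyc T s t (Suc k)}" using fu z(1) by simp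
      then consider "f u = cyc T s t k" "f w = cyc T s t (Suc k)" | "f w = cyc T s t k" "f u = cyc T s t (Suc k)"
        by (metis doubleton_eq_iff)
      then show ?thesis
      proof cases
        case 1
        then have g: "\<gamma> k = u" "\<gamma> (Suc k) = w" using inv[OF uA(1)] inv[OF uA(2)] by (simp_all add: \<gamma>_def)
        have "retraction C u = cyc T s t k" using retraction_eq[OF A(1) uA(1)] 1 by simp
        then show ?thesis using g uw(3) r_unique by simp
      next
        case 2
        then have g: "\<gamma> k = w" "\<gamma> (Suc k) = u" using inv[OF uA(1)] inv[OF uA(2)] by (simp_all add: \<gamma>_def)
        have "retraction C w = cyc T s t k" using retraction_eq[OF A(1) uA(2)] 2 by simp
        then show ?thesis using g link_adj_sym[OF uw(3)] r_unique by simp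
      qed
    qed
    have vA: "v \<in> \<Union>A" using A(2) by blast
    have "f v = cyc T s t (r v)" using retraction_eq[OF A(1) vA] r_rho[OF v] by simp
    then have "\<gamma> (r v) = v" using inv[OF vA] by (simp add: \<gamma>_def)
    then show ?thesis using step by blast
  qed
  have "folding_map (link_vertices y) (link_adj y) n u0 u1 r"
    unfolding folding_map_def using ru0 ru1 r_lt hom uniq lift by blast
  then show ?thesis by blast
qed

end

lemma link_folded:
  assumes y: "y \<in> Y" and cotype: "- (\<sigma> ` y) = {s, t}" and st: "s \<noteq> t"
    and n: "coxeter_matrix T s t = enat n" and fin: "finite (star chambers y)"
  shows "folded_graph (link_vertices y) (link_adj y) (\<lambda>v. \<sigma> v = s) n"
proof
  have "finite (\<Union>(star chambers y))" using fin finite_face by (auto simp: star_chambers)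
  then show "finite (link_vertices y)" by (rule finite_subset[rotated]) (auto simp: link_vertex_iff)
  show "2 \<le> n" by (rule coxeter_matrix_ge2_enat[OF diagram st n])
  show "u \<in> link_vertices y" if "link_adj y u v" for u v using link_adj_vertex[OF that] .
  show "link_adj y v u" if "link_adj y u v" for u v using link_adj_sym[OF that] .
  show "(\<sigma> u = s) \<noteq> (\<sigma> v = s)" if "link_adj y u v" for u v
    using adj_label[OF y cotype st that] st by (metis doubleton_eq_iff)
  show "\<exists>v. link_adj y u v" if "u \<in> link_vertices y" for u using link_nbr[OF y cotype st that] .
  show "\<exists>r. folding_map (link_vertices y) (link_adj y) n u0 u1 r" if e: "link_adj y u0 u1" for u0 u1
  proof -
    consider "\<sigma> u0 = s" "\<sigma> u1 = t" | "\<sigma> u0 = t" "\<sigma> u1 = s"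
      using adj_label[OF y cotype st e] by (metis doubleton_eq_iff)
    then show ?thesis
    proof cases
      case 1
      then show ?thesis using folding_exists[OF y cotype st n e] by blast
    next
      case 2
      \<comment> \<open>The base edge may start at either type; swapping \<open>s\<close> and
        \<open>t\<close> covers the second orientation.\<close>
      have "- (\<sigma> ` y) = {t, s}" "t \<noteq> s" "coxeter_matrix T t s = enat n"
        using cotype st n coxeter_matrix_commute[of T s t] by auto
      from folding_exists[OF y this e] 2 show ?thesis by blast
    qed
  qed
qed

end

section \<open>Finite quotients of buildings\<close>

context labelled_building
begin

lemma chambers_iff: "c \<in> chambers \<longleftrightarrow> c \<in> Y \<and> card c = CARD('t)"
  by (simp add: chambers_def)

lemma finite_star_mono: "finite (star chambers y) \<Longrightarrow> y \<subseteq> z \<Longrightarrow> finite (star chambers z)"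
  by (erule finite_subset[rotated]) (auto simp: star_def)

text \<open>Both faces are extended to chambers, one chamber is moved to the other, and preservation
  of labels carries the face along because labels are injective on a chamber.\<close>

lemma type_preserving_face:
  assumes strong: "strongly_transitive Y E \<sigma>" and z: "z \<in> Y" "z' \<in> Y" and types: "\<sigma> ` z = \<sigma> ` z'"
  shows "\<exists>g. complex_iso g Y Y \<and> g ` z = z'"
proof -
  obtain G where G: "\<forall>g\<in>G. complex_iso g Y Y \<and> (\<forall>v\<in>\<Union>Y. \<sigma> (g v) = \<sigma> v) \<and> (\<forall>A\<in>E. (\<lambda>x. g ` x) ` A \<in> E)"
    "\<forall>A\<in>E. \<forall>A'\<in>E. \<forall>x\<in>faces A (dimension Y). \<forall>x'\<in>faces A' (dimension Y).
       \<exists>g\<in>G. (\<lambda>y. g ` y) ` A = A' \<and> g ` x = x'"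
    using strong unfolding strongly_transitive_def by (elim exE conjE) (rule that)
  have ex: "\<exists>A\<in>E. \<exists>C\<in>faces A (dimension Y). x \<subseteq> C" if x: "x \<in> Y" for x
  proof -
    obtain A where A: "A \<in> E" "x \<in> A" using common_apartment[OF x x] by blast
    obtain c where "c \<in> A" "card c = CARD('t)" "x \<subseteq> c" using apartment_face_in_chamber[OF A] by blast
    moreover from this have "c \<in> faces A (dimension Y)" by (simp add: faces_def dimension_eq)
    ultimately show ?thesis using A(1) by blast
  qed
  obtain A C where A: "A \<in> E" "C \<in> faces A (dimension Y)" "z \<subseteq> C" using ex[OF z(1)] by blast
  obtain A' C' where A': "A' \<in> E" "C' \<in> faces A' (dimension Y)" "z' \<subseteq> C'" using ex[OF z(2)] by blast
  obtain g where g: "g \<in> G" "g ` C = C'"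
    using G(2)[rule_format, OF A(1) A'(1) A(2) A'(2)] by blast
  have iso: "complex_iso g Y Y" and lab: "\<And>v. v \<in> \<Union>Y \<Longrightarrow> \<sigma> (g v) = \<sigma> v" using G(1) g(1) by auto
  have C': "C' \<in> Y" using A' apartment_subset by (auto simp: faces_def)
  have sub: "g ` z \<subseteq> z'"
  proof
    fix w assume "w \<in> g ` z"
    then obtain v where v: "v \<in> z" "w = g v" by blast
    have "\<sigma> w = \<sigma> v" using lab[of v] v z(1) by blast
    then obtain w' where w': "w' \<in> z'" "\<sigma> w' = \<sigma> w" using types v(1) by (metis imageE imageI)
    have "w \<in> C'" "w' \<in> C'" using v A(3) g(2) w'(1) A'(3) by blast+
    then show "w \<in> z'" using inj_on_label[OF C'] w' by (auto dest: inj_onD)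
  qed
  have "inj_on g z" using complex_isoD(1)[OF iso] z(1) by (auto intro: inj_on_subset)
  then have "card (g ` z) = card z'" using card_image card_label[OF z(1)] card_label[OF z(2)] types by metis
  then have "g ` z = z'" using card_subset_eq[OF finite_face[OF z(2)] sub] by blast
  then show ?thesis using iso by blast
qed

lemma card_star_type:
  assumes strong: "strongly_transitive Y E \<sigma>" and z: "z \<in> Y" "z' \<in> Y" and types: "\<sigma> ` z = \<sigma> ` z'"
    and fin: "finite (star chambers z)" "finite (star chambers z')"
  shows "card (star chambers z) = card (star chambers z')"
proof -
  have le: "card (star chambers z) \<le> card (star chambers z')"
    if z: "z \<in> Y" "z' \<in> Y" "\<sigma> ` z = \<sigma> ` z'" and f: "finite (star chambers z')" for z z'
  proof -
    obtain g where g: "complex_iso g Y Y" "g ` z = z'" using type_preserving_face[OF strong z] by blast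
    note inj = complex_isoD(1)[OF g(1)]
    have "inj_on ((`) g) (star chambers z)"
    proof (rule inj_onI)
      fix c c' assume c: "c \<in> star chambers z" "c' \<in> star chambers z" "g ` c = g ` c'"
      have "c \<subseteq> \<Union>Y" "c' \<subseteq> \<Union>Y" using c(1,2) by (auto simp: star_chambers)
      then show "c = c'" using inj_on_image_eq_iff[OF inj] c(3) by blast
    qed
    moreover have "(`) g ` star chambers z \<subseteq> star chambers z'"
    proof
      fix d assume "d \<in> (`) g ` star chambers z"
      then obtain c where c: "c \<in> Y" "card c = CARD('t)" "z \<subseteq> c" "d = g ` c" by (auto simp: star_chambers)
      have "inj_on g c" using inj c(1) by (auto intro: inj_on_subset)
      then have "card d = CARD('t)" using c by (simp add: card_image)
      moreover have "d \<in> Y" using complex_isoD(3)[OF g(1) c(1)] c(4) by simp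
      moreover have "z' \<subseteq> d" using c(3,4) g(2) by blast
      ultimately show "d \<in> star chambers z'" by (simp add: star_chambers)
    qed
    ultimately show ?thesis using card_inj_on_le f by blast
  qed
  show ?thesis using le[OF z types fin(2)] le[OF z(2,1) types[symmetric] fin(1)] by simp
qed

lemma card_link_nbrs:
  assumes y: "y \<in> Y" "- (\<sigma> ` y) = {s, t}" "s \<noteq> t" and u: "u \<in> link_vertices y"
  shows "card {v. link_adj y u v} = card (star chambers (insert u y))"
proof (rule bij_betw_same_card[of "\<lambda>v. {u, v} \<union> y"])
  have uy: "u \<notin> y" using u by (simp add: link_vertices_def)
  show "bij_betw (\<lambda>v. {u, v} \<union> y) {v. link_adj y u v} (star chambers (insert u y))"
  proof (rule bij_betw_imageI)
    show "inj_on (\<lambda>v. {u, v} \<union> y) {v. link_adj y u v}" by (auto simp: inj_on_def link_adj_def)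
    show "(\<lambda>v. {u, v} \<union> y) ` {v. link_adj y u v} = star chambers (insert u y)"
    proof (intro Set.set_eqI iffI)
      fix c assume "c \<in> (\<lambda>v. {u, v} \<union> y) ` {v. link_adj y u v}"
      then obtain v where v: "link_adj y u v" "c = {u, v} \<union> y" by blast
      then show "c \<in> star chambers (insert u y)"
        using adj_card[OF y v(1)] by (auto simp: star_chambers link_adj_def)
    next
      fix c assume "c \<in> star chambers (insert u y)"
      then have c: "c \<in> Y" "card c = CARD('t)" "insert u y \<subseteq> c" by (auto simp: star_chambers)
      then obtain a b where ab: "link_adj y a b" "c = {a, b} \<union> y" using chamber_split[OF y c(1,2)] by blast
      then consider "u = a" | "u = b" using c(3) uy by blast
      then show "c \<in> (\<lambda>v. {u, v} \<union> y) ` {v. link_adj y u v}"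
      proof cases
        case 1
        then show ?thesis using ab by blast
      next
        case 2
        then have "link_adj y u a" "c = {u, a} \<union> y" using ab link_adj_sym by auto
        then show ?thesis by blast
      qed
    qed
  qed
qed

text \<open>The degree of a link vertex is the number of chambers on a panel. Transitivity makes it
  depend on the type of the panel alone, and thickness bounds it below by \<open>q\<close>.\<close>

lemma link_polygon:
  assumes y: "y \<in> Y" "- (\<sigma> ` y) = {s, t}" "s \<noteq> t"
    and n: "coxeter_matrix T s t = enat n" and finS: "finite (star chambers y)"
    and strong: "strongly_transitive Y E \<sigma>" and thick: "thick q Y" and q: "1 \<le> q"
  shows "\<exists>d a b. gen_polygon (link_vertices y) (link_adj y) (\<lambda>v. \<sigma> v = s) n d a b \<and> q \<le> a \<and> q \<le> b"
proof -
  interpret folded_graph "link_vertices y" "link_adj y" "\<lambda>v. \<sigma> v = s" n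
    by (rule link_folded[OF y n finS])
  obtain c where c: "c \<in> Y" "card c = CARD('t)" "y \<subseteq> c" using face_in_chamber[OF y(1)] by blast
  obtain u0 u1 where u: "\<sigma> u0 = s" "\<sigma> u1 = t" "link_adj y u0 u1" using chamber_split[OF y c] by blast
  have uV: "u0 \<in> link_vertices y" "u1 \<in> link_vertices y" using u(3) adj_V adj_V' by blast+
  have face: "insert u y \<in> Y" "u \<notin> y" if "u \<in> link_vertices y" for u using that by (auto simp: link_vertices_def)
  have thk: "q \<le> card (star chambers (insert u y))" if "u \<in> link_vertices y" for u
  proof -
    have "card (insert u y) = dimension Y"
      using face[OF that] finite_face[OF y(1)] card_cotype[OF y] by (simp add: dimension_eq)
    moreover have "{c \<in> faces Y (dimension Y). insert u y \<subseteq> c} = star chambers (insert u y)"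
      by (auto simp: faces_dimension star_chambers)
    moreover have "finite (star chambers (insert u y))" using finite_star_mono[OF finS] by blast
    ultimately show ?thesis using thick face[OF that] unfolding thick_def by auto
  qed
  have fi: "finite (star chambers (insert u y))" for u by (rule finite_star_mono[OF finS]) auto
  have deg: "card {v. link_adj y u v} =
      (if \<sigma> u = s then card (star chambers (insert u0 y)) else card (star chambers (insert u1 y)))"
    if uL: "u \<in> link_vertices y" for u
  proof -
    have eq: "card (star chambers (insert u y)) = card (star chambers (insert w y))"
      if "w \<in> link_vertices y" "\<sigma> u = \<sigma> w" for w
      using that(2) by (intro card_star_type[OF strong face(1)[OF uL] face(1)[OF that(1)] _ fi fi]) simp
    show ?thesis
      unfolding card_link_nbrs[OF y uL] using label_vertex[OF y uL] y(3) eq[OF uV(1)] eq[OF uV(2)] u by auto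
  qed
  have "gen_polygon (link_vertices y) (link_adj y) (\<lambda>v. \<sigma> v = s) n dist_adj
     (card (star chambers (insert u0 y))) (card (star chambers (insert u1 y)))"
    using thk[OF uV(1)] thk[OF uV(2)] q by (intro gen_polygon deg) auto
  then show ?thesis using thk uV by blast
qed

lemma link_spectral_bound:
  assumes y: "y \<in> Y" "- (\<sigma> ` y) = {s, t}" "s \<noteq> t"
    and n: "coxeter_matrix T s t = enat n" and finS: "finite (star chambers y)"
    and strong: "strongly_transitive Y E \<sigma>" and thick: "thick q Y" and q: "1 \<le> q"
  shows "spectral_bound chambers y (1 + sqrt (real n - 2) / sqrt (real q))"
proof -
  obtain d a b where poly: "gen_polygon (link_vertices y) (link_adj y) (\<lambda>v. \<sigma> v = s) n d a b"
    and ab: "q \<le> a" "q \<le> b" using link_polygon[OF assms] by blast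
  interpret gen_polygon "link_vertices y" "link_adj y" "\<lambda>v. \<sigma> v = s" n d a b by (rule poly)
  have ss: "star (star chambers y) y = star chambers y" by (auto simp: star_def)
  have card2: "card (c - y) = Suc 1" if "c \<in> star chambers y" for c
    using that card_cotype[OF y] finite_face[OF y(1)] card_Diff_subset[of y c] by (auto simp: star_chambers)
  \<comment> \<open>The building may have infinitely many chambers, so the system is formed from the
    finite star of \<open>y\<close>, which has the same star at \<open>y\<close>.\<close>
  interpret S: star_system "star chambers y" y 1
    using finS finite_face card2 ss by unfold_locales (auto simp: star_chambers)
  have VL: "S.V = link_vertices y"
    unfolding S.V_def ss using link_vertex_iff by blast
  have Sv: "{c \<in> star (star chambers y) y. v \<in> c} = (\<lambda>w. {v, w} \<union> y) ` {w. link_adj y v w}"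
    and inj: "inj_on (\<lambda>w. {v, w} \<union> y) {w. link_adj y v w}" if v: "v \<in> link_vertices y" for v
  proof -
    show "inj_on (\<lambda>w. {v, w} \<union> y) {w. link_adj y v w}" by (auto simp: inj_on_def link_adj_def)
    have vy: "v \<notin> y" using v by (simp add: link_vertices_def)
    show "{c \<in> star (star chambers y) y. v \<in> c} = (\<lambda>w. {v, w} \<union> y) ` {w. link_adj y v w}"
      unfolding ss
    proof (intro Set.set_eqI iffI)
      fix c assume "c \<in> {c \<in> star chambers y. v \<in> c}"
      then have c: "c \<in> Y" "card c = CARD('t)" "y \<subseteq> c" "v \<in> c" by (auto simp: star_chambers)
      then obtain a b where ab: "link_adj y a b" "c = {a, b} \<union> y" using chamber_split[OF y c(1-3)] by blast
      then consider "v = a" | "v = b" using c(4) vy by blast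
      then show "c \<in> (\<lambda>w. {v, w} \<union> y) ` {w. link_adj y v w}"
      proof cases
        case 1
        then show ?thesis using ab by blast
      next
        case 2
        then have "link_adj y v a" "c = {v, a} \<union> y" using ab link_adj_sym by auto
        then show ?thesis by blast
      qed
    next
      fix c assume "c \<in> (\<lambda>w. {v, w} \<union> y) ` {w. link_adj y v w}"
      then obtain w where w: "link_adj y v w" "c = {v, w} \<union> y" by blast
      then show "c \<in> {c \<in> star chambers y. v \<in> c}"
        using adj_card[OF y w(1)] by (auto simp: star_chambers link_adj_def)
    qed
  qed
  have Ndg: "S.N v = real (dg v)" if v: "v \<in> link_vertices y" for v
    unfolding S.N_def Sv[OF v] card_image[OF inj[OF v]] using card_nbrs[OF v] by simp
  have "spectral_bound (star chambers y) y (1 + sqrt (real n - 2) / sqrt (real q))"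
  proof (rule S.spectral_boundI)
    fix f t'
    assume nz: "\<exists>v\<in>S.V. f v \<noteq> 0" and mean: "(\<Sum>c\<in>star (star chambers y) y. \<Sum>v\<in>c - y. f v) = 0"
      and eig: "\<And>v. v \<in> S.V \<Longrightarrow> (\<Sum>c | c \<in> star (star chambers y) y \<and> v \<in> c. \<Sum>u\<in>c - y. f u) = t' * S.N v * f v"
    have "t' - 1 \<le> sqrt (real n - 2) / sqrt (real q)"
    proof (rule eigenvalue_bound[OF q ab])
      show "\<exists>v\<in>link_vertices y. f v \<noteq> 0" using nz VL by simp
      show "(\<Sum>v\<in>link_vertices y. real (dg v) * f v) = 0"
        using mean S.sum_single[of f] VL Ndg by (simp cong: sum.cong)
      show "(\<Sum>w | link_adj y v w. f w) = (t' - 1) * real (dg v) * f v" if v: "v \<in> link_vertices y" for v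
      proof -
        have "t' * S.N v * f v = (\<Sum>c | c \<in> star (star chambers y) y \<and> v \<in> c. \<Sum>u\<in>c - y. f u)"
          using eig v VL by simp
        also have "\<dots> = (\<Sum>w | link_adj y v w. \<Sum>u\<in>({v, w} \<union> y) - y. f u)"
          unfolding Sv[OF v] sum.reindex[OF inj[OF v]] by (simp only: o_def)
        also have "\<dots> = (\<Sum>w | link_adj y v w. f v + f w)"
        proof (intro sum.cong HOL.refl)
          fix w assume "w \<in> {w. link_adj y v w}"
          then have "({v, w} \<union> y) - y = {v, w}" "v \<noteq> w" by (auto simp: link_adj_def)
          then show "(\<Sum>u\<in>({v, w} \<union> y) - y. f u) = f v + f w" by simp
        qed
        also have "\<dots> = real (dg v) * f v + (\<Sum>w | link_adj y v w. f w)"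
          using card_nbrs[OF v] by (simp add: sum.distrib)
        finally show ?thesis using Ndg[OF v] by (simp add: algebra_simps)
      qed
    qed
    then show "t' \<le> 1 + sqrt (real n - 2) / sqrt (real q)" by simp
  qed
  then show ?thesis unfolding spectral_bound_def ss .
qed

end

text \<open>Treats both cases at once, with the identity as covering in the spherical one. For two
  labels the codimension-two face is empty, so its star must also map bijectively; this is true of
  the identity, and an affine building of dimension at least two has more labels.\<close>

locale covered_building = labelled_building T Y E \<sigma>
  for T :: "'t::finite diagram" and Y :: "'b set set" and E \<sigma> +
  fixes X :: "'a set set" and p :: "'b \<Rightarrow> 'a" and \<tau> :: "'a \<Rightarrow> 't" and q :: nat
  assumes finX: "finite X" and complexX: "abstract_complex X"
    and cover: "(\<lambda>y. p ` y) ` Y = X"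
    and local_iso: "\<And>y. \<lbrakk>y \<in> Y; y \<noteq> {} \<or> CARD('t) = 2\<rbrakk> \<Longrightarrow>
      bij_betw (\<lambda>z. p ` z) {z \<in> Y. y \<subseteq> z} {x \<in> X. p ` y \<subseteq> x}"
    and \<tau>: "\<And>v. v \<in> \<Union>Y \<Longrightarrow> \<tau> (p v) = \<sigma> v"
    and strong: "strongly_transitive Y E \<sigma>" and thick: "thick q Y" and q: "1 \<le> q"
    and rank2: "2 \<le> CARD('t)"
begin

text \<open>If \<open>p\<close> identified two vertices of a face, the faces \<open>{u}\<close> and
  \<open>{u, v}\<close> in the star of \<open>u\<close> would have the same image.\<close>

lemma inj_cover: assumes z: "z \<in> Y" shows "inj_on p z"
proof (rule inj_onI)
  fix u v assume uv: "u \<in> z" "v \<in> z" "p u = p v"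
  have "p ` {u} = p ` {u, v}" using uv(3) by auto
  moreover have Y: "{u} \<in> Y" "{u, v} \<in> Y" using uv by (intro subface[OF z]; simp)+
  have "inj_on (\<lambda>z. p ` z) {z \<in> Y. {u} \<subseteq> z}" using local_iso[OF Y(1)] by (simp add: bij_betw_def)
  ultimately have "{u} = {u, v}" using Y by (elim inj_onD) simp_all
  then show "u = v" by auto
qed

lemma lift_face: assumes "x \<in> X" shows "\<exists>y\<in>Y. p ` y = x \<and> card y = card x"
proof -
  obtain y where "y \<in> Y" "p ` y = x" using assms cover by blast
  then show ?thesis using card_image[OF inj_cover] by metis
qed

lemma image_face: "y \<in> Y \<Longrightarrow> p ` y \<in> X \<and> card (p ` y) = card y"
  using cover card_image[OF inj_cover] by blast

definition chambersX :: "'a set set" where "chambersX = {c \<in> X. card c = CARD('t)}"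

lemma finite_chambersX: "finite chambersX" using finX by (simp add: chambersX_def)

lemma finite_faceX: "x \<in> X \<Longrightarrow> finite x" using complexX by (simp add: abstract_complex_def)

lemma face_in_chamberX: assumes "x \<in> X" shows "\<exists>c\<in>chambersX. x \<subseteq> c"
proof -
  obtain y where y: "y \<in> Y" "p ` y = x" using lift_face[OF assms] by blast
  obtain c where "c \<in> Y" "card c = CARD('t)" "y \<subseteq> c" using face_in_chamber[OF y(1)] by blast
  then show ?thesis using image_face y(2) by (intro bexI[of _ "p ` c"]) (auto simp: chambersX_def)
qed

lemma dimensionX: "dimension X = CARD('t) - 1"
proof -
  have "card ` X = card ` Y"
    using lift_face image_face by (metis (no_types, lifting) image_cong image_image cover)
  then show ?thesis using dimension_eq by (simp add: dimension_def)
qed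

lemma pureX: "pure_complex X"
  unfolding pure_complex_def
proof
  fix x assume "x \<in> X"
  from face_in_chamberX[OF this] show "\<exists>y\<in>faces X (dimension X). x \<subseteq> y"
    by (auto simp: chambersX_def faces_def dimensionX)
qed

lemma inj_labelX: assumes "x \<in> X" shows "inj_on \<tau> x"
proof -
  obtain y where y: "y \<in> Y" "p ` y = x" using lift_face[OF assms] by blast
  show ?thesis
  proof (rule inj_onI)
    fix a b assume "a \<in> x" "b \<in> x" "\<tau> a = \<tau> b"
    then obtain u v where uv: "u \<in> y" "v \<in> y" "a = p u" "b = p v" using y(2) by blast
    then have "u \<in> \<Union>Y" "v \<in> \<Union>Y" using y(1) by blast+
    then have "\<sigma> u = \<sigma> v" using \<tau>[of u] \<tau>[of v] \<open>\<tau> a = \<tau> b\<close> uv(3,4) by simp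
    then have "u = v" using inj_on_label[OF y(1)] uv by (auto dest: inj_onD)
    then show "a = b" using uv by simp
  qed
qed

lemma star_bij:
  assumes y: "y \<in> Y" "y \<noteq> {} \<or> CARD('t) = 2"
  shows "bij_betw (\<lambda>z. p ` z) (star chambers y) (star chambersX (p ` y))"
proof -
  note bij = local_iso[OF y]
  have "(\<lambda>z. p ` z) ` star chambers y = star chambersX (p ` y)"
  proof (intro Set.set_eqI iffI)
    fix c assume "c \<in> (\<lambda>z. p ` z) ` star chambers y"
    then show "c \<in> star chambersX (p ` y)" using image_face by (auto simp: star_def chambers_iff chambersX_def)
  next
    fix c assume "c \<in> star chambersX (p ` y)"
    then have c: "c \<in> {x \<in> X. p ` y \<subseteq> x}" "card c = CARD('t)" by (auto simp: star_def chambersX_def)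
    then have "c \<in> (\<lambda>z. p ` z) ` {z \<in> Y. y \<subseteq> z}" using bij by (simp add: bij_betw_def)
    then obtain z where z: "z \<in> {z \<in> Y. y \<subseteq> z}" "c = p ` z" by (rule imageE)
    then have "z \<in> star chambers y" using image_face c(2) by (auto simp: star_chambers)
    then show "c \<in> (\<lambda>z. p ` z) ` star chambers y" using z(2) by blast
  qed
  moreover have "inj_on (\<lambda>z. p ` z) (star chambers y)"
    using bij unfolding bij_betw_def by (auto intro: inj_on_subset simp: star_chambers)
  ultimately show ?thesis by (simp add: bij_betw_def)
qed

lemma star_surj:
  assumes y: "y \<in> Y"
  shows "star chambersX (p ` y) = (\<lambda>z. p ` z) ` star chambers y"
proof (cases "y = {}")
  case True
  have "c \<in> (\<lambda>z. p ` z) ` chambers" if "c \<in> chambersX" for c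
    using that lift_face by (fastforce simp: chambersX_def chambers_iff)
  moreover have "p ` z \<in> chambersX" if "z \<in> chambers" for z
    using that image_face by (auto simp: chambersX_def chambers_iff)
  ultimately show ?thesis using True by (auto simp: star_def)
qed (use star_bij[OF y] in \<open>simp add: bij_betw_def\<close>)

lemma finite_star_chambers:
  assumes y: "y \<in> Y" "y \<noteq> {} \<or> CARD('t) = 2"
  shows "finite (star chambers y)"
proof -
  have "finite (star chambersX (p ` y))" using finite_chambersX by (simp add: star_def)
  then show ?thesis using bij_betw_finite[OF star_bij[OF y]] by simp
qed

lemma spectral_bound_cover:
  assumes y: "y \<in> Y" "y \<noteq> {} \<or> CARD('t) = 2" and M: "spectral_bound chambers y M"
  shows "spectral_bound chambersX (p ` y) M"
  unfolding spectral_bound_def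
proof (intro allI impI)
  fix f :: "'a \<Rightarrow> real"
  have inner: "(\<Sum>v\<in>p ` c - p ` y. g v) = (\<Sum>v\<in>c - y. g (p v))" if c: "c \<in> star chambers y" for c and g :: "'a \<Rightarrow> real"
  proof -
    have c': "inj_on p c" "y \<subseteq> c" using c inj_cover by (auto simp: star_chambers)
    have "p ` c - p ` y = p ` (c - y)" using c' by (auto dest: inj_onD)
    moreover have "inj_on p (c - y)" using c'(1) by (rule inj_on_subset) auto
    ultimately show ?thesis by (simp add: sum.reindex)
  qed
  have outer: "(\<Sum>c\<in>star chambersX (p ` y). h c) = (\<Sum>c\<in>star chambers y. h (p ` c))" for h :: "'a set \<Rightarrow> real"
    using sum.reindex_bij_betw[OF star_bij[OF y], of h] by simp
  assume "(\<Sum>c\<in>star chambersX (p ` y). \<Sum>v\<in>c - p ` y. f v) = 0"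
  then have "(\<Sum>c\<in>star chambers y. \<Sum>v\<in>c - y. f (p v)) = 0" by (simp add: outer inner)
  then have "(\<Sum>c\<in>star chambers y. (\<Sum>v\<in>c - y. f (p v))\<^sup>2) \<le> M * (\<Sum>c\<in>star chambers y. \<Sum>v\<in>c - y. (f (p v))\<^sup>2)"
    using M unfolding spectral_bound_def by (auto dest: spec[of _ "\<lambda>v. f (p v)"])
  then show "(\<Sum>c\<in>star chambersX (p ` y). (\<Sum>v\<in>c - p ` y. f v)\<^sup>2) \<le>
      M * (\<Sum>c\<in>star chambersX (p ` y). \<Sum>v\<in>c - p ` y. (f v)\<^sup>2)"
    by (simp add: outer inner)
qed

text \<open>Connectedness passes from the star in \<open>Y\<close> to its image. Surjectivity on
  stars suffices for this, so the empty face is included.\<close>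

lemma star_connectedX:
  fixes h :: "'a \<Rightarrow> real"
  assumes x: "star chambersX x \<noteq> {}" "card x + 2 \<le> CARD('t)"
    and h: "\<And>c u v. \<lbrakk>c \<in> star chambersX x; u \<in> c - x; v \<in> c - x\<rbrakk> \<Longrightarrow> h u = h v"
  shows "\<forall>u\<in>\<Union>(star chambersX x) - x. \<forall>v\<in>\<Union>(star chambersX x) - x. h u = h v"
proof -
  obtain c0 where "c0 \<in> X" "x \<subseteq> c0" using x(1) by (auto simp: star_def chambersX_def)
  then have "x \<in> X" using complexX by (auto simp: abstract_complex_def)
  then obtain y where y: "y \<in> Y" "p ` y = x" "card y = card x" using lift_face by blast
  have outside: "p u \<in> p ` c - x \<longleftrightarrow> u \<notin> y" if "c \<in> star chambers y" "u \<in> c" for c u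
    using that inj_cover[of c] y(2) by (auto simp: star_chambers inj_on_def)
  have "h a = h b" if ab: "a \<in> \<Union>(star chambersX x) - x" "b \<in> \<Union>(star chambersX x) - x" for a b
  proof -
    have lift: "\<exists>c u. c \<in> star chambers y \<and> u \<in> c - y \<and> a = p u" if a: "a \<in> \<Union>(star chambersX x) - x" for a
    proof -
      obtain c' where c': "c' \<in> star chambersX x" "a \<in> c'" "a \<notin> x" using a by blast
      have "c' \<in> (\<lambda>z. p ` z) ` star chambers y" using star_surj[OF y(1)] y(2) c'(1) by simp
      then obtain c where c: "c \<in> star chambers y" "c' = p ` c" by blast
      obtain u where u: "u \<in> c" "a = p u" using c'(2) c(2) by blast
      have "u \<notin> y" using u(2) c'(3) y(2) by blast
      then show ?thesis using c(1) u by blast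
    qed
    obtain C u where C: "C \<in> star chambers y" "u \<in> C - y" "a = p u" using lift[OF ab(1)] by blast
    obtain D v where D: "D \<in> star chambers y" "v \<in> D - y" "b = p v" using lift[OF ab(2)] by blast
    have "h (p u) = h (p v)"
    proof (rule star_connected[of y "\<lambda>u. h (p u)" C u D v])
      show "card y + 2 \<le> CARD('t)" using x(2) y(3) by simp
      show "h (p u) = h (p v)" if c: "c \<in> Y" "card c = CARD('t)" "y \<subseteq> c" "u \<in> c - y" "v \<in> c - y" for c u v
      proof -
        have cs: "c \<in> star chambers y" using c by (simp add: star_chambers)
        then have "p ` c \<in> star chambersX x" using star_surj[OF y(1)] y(2) by blast
        then show ?thesis using h[of "p ` c"] outside[OF cs] c(4,5) by blast
      qed
    qed (use C D in \<open>auto simp: star_chambers\<close>)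
    then show ?thesis using C D by simp
  qed
  then show ?thesis by blast
qed

lemma spectral_boundX:
  assumes m: "2 \<le> m" "\<And>s t. s \<noteq> t \<Longrightarrow> \<exists>n\<le>m. coxeter_matrix T s t = enat n"
    and qm: "(CARD('t) - 1)\<^sup>2 * (m - 2) \<le> q"
  shows "spectral_bound chambersX {} (1 + real (CARD('t) - 1) *
    (sqrt (real m - 2) / (sqrt (real q) - (real (CARD('t) - 1) - 1) * sqrt (real m - 2))))"
proof -
  define r where "r = CARD('t) - 1"
  define \<mu> where "\<mu> = sqrt (real m - 2) / sqrt (real q)"
  have r: "CARD('t) = Suc r" "1 \<le> r" using rank2 by (auto simp: r_def)
  have sq: "0 < sqrt (real q)" using q by simp
  have "real (r\<^sup>2 * (m - 2)) \<le> real q" using qm by (simp only: r_def of_nat_le_iff)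
  then have "(real r)\<^sup>2 * (real m - 2) \<le> real q" using m(1) by (simp add: of_nat_diff)
  then have "sqrt ((real r)\<^sup>2 * (real m - 2)) \<le> sqrt (real q)" by simp
  then have rs: "real r * sqrt (real m - 2) \<le> sqrt (real q)" by (simp add: real_sqrt_mult)
  have \<mu>0: "0 \<le> \<mu>" using m(1) by (simp add: \<mu>_def)
  \<comment> \<open>Strictness comes from the subtracted root when \<open>m > 2\<close>, and from
    \<open>q > 0\<close> when \<open>m = 2\<close>.\<close>
  have "(real r - 1) * sqrt (real m - 2) < sqrt (real q)"
  proof (cases "sqrt (real m - 2) = 0")
    case True
    then show ?thesis using sq by simp
  next
    case False
    then have "0 < sqrt (real m - 2)" using m(1) by simp
    then show ?thesis unfolding left_diff_distrib using rs by linarith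
  qed
  then have \<mu>1: "(real r - 1) * \<mu> < 1" using sq by (simp add: \<mu>_def divide_less_eq)
  have sb: "spectral_bound chambersX {} (1 + real r * (\<mu> / (1 - (real r - 1) * \<mu>)))"
  proof (rule trickling_down[OF finite_chambersX _ r(2) \<mu>0 \<mu>1])
    show "finite c \<and> card c = Suc r" if "c \<in> chambersX" for c
      using that r(1) finite_faceX by (auto simp: chambersX_def)
    show "chambersX \<noteq> {}" using face_in_chamberX[of "{}"] complexX by (auto simp: abstract_complex_def)
    show "\<forall>u\<in>\<Union>(star chambersX x) - x. \<forall>v\<in>\<Union>(star chambersX x) - x. h u = h v"
      if x: "star chambersX x \<noteq> {}" "card x + 1 \<le> r"
        and h: "\<And>c u v. \<lbrakk>c \<in> star chambersX x; u \<in> c - x; v \<in> c - x\<rbrakk> \<Longrightarrow> h u = h v" for x and h :: "'a \<Rightarrow> real"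
    proof -
      have "card x + 2 \<le> CARD('t)" using x(2) r(1) by simp
      from star_connectedX[OF x(1) this h] show ?thesis .
    qed
    show "spectral_bound chambersX x (1 + \<mu>)" if x: "star chambersX x \<noteq> {}" "card x + 1 = r" for x
    proof -
      obtain c0 where "c0 \<in> X" "x \<subseteq> c0" using x(1) by (auto simp: star_def chambersX_def)
      then have "x \<in> X" using complexX by (auto simp: abstract_complex_def)
      then obtain y where y: "y \<in> Y" "p ` y = x" "card y = card x" using lift_face by blast
      have y0: "y \<noteq> {} \<or> CARD('t) = 2" using y(3) x(2) r(1) by auto
      have "card (- (\<sigma> ` y)) = 2"
        using card_label[OF y(1)] y(3) x(2) r(1) by (simp add: Compl_eq_Diff_UNIV card_Diff_subset)
      then obtain s t where st: "- (\<sigma> ` y) = {s, t}" "s \<noteq> t" by (auto simp: card_2_iff)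
      obtain n where n: "n \<le> m" "coxeter_matrix T s t = enat n" using m(2)[OF st(2)] by blast
      have "spectral_bound chambers y (1 + sqrt (real n - 2) / sqrt (real q))"
        by (rule link_spectral_bound[OF y(1) st n(2) finite_star_chambers[OF y(1) y0] strong thick q])
      then have "spectral_bound chambersX x (1 + sqrt (real n - 2) / sqrt (real q))"
        using spectral_bound_cover[OF y(1) y0] y(2) by simp
      moreover have "sqrt (real n - 2) / sqrt (real q) \<le> \<mu>"
        unfolding \<mu>_def using n(1) sq by (intro divide_right_mono) auto
      ultimately show ?thesis using spectral_bound_mono by (metis add_left_mono)
    qed
  qed
  have eq: "\<mu> / (1 - (real r - 1) * \<mu>) = sqrt (real m - 2) / (sqrt (real q) - (real r - 1) * sqrt (real m - 2))"
  proof -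
    have "1 - (real r - 1) * \<mu> = (sqrt (real q) - (real r - 1) * sqrt (real m - 2)) / sqrt (real q)"
      using sq by (simp add: \<mu>_def diff_divide_distrib)
    then show ?thesis using sq by (simp add: \<mu>_def)
  qed
  show ?thesis using sb[unfolded eq] unfolding r_def .
qed

end

section \<open>Partite expansion\<close>

context covered_building
begin

lemma spectral_bound_partite_expander:
  assumes r: "r = CARD('t) - 1" and sb: "spectral_bound chambersX {} (1 + real r * l)"
  shows "partite_expander X (canonical_weight X) \<tau> (- (real r * l)) l"
  unfolding partite_expander_def
proof (intro allI impI)
  fix \<alpha>
  assume "\<exists>f\<in>diamond_space X (canonical_weight X) \<tau>. (\<exists>v\<in>faces X 0. f v \<noteq> 0) \<and>
    (\<forall>v\<in>faces X 0. adjacency X (canonical_weight X) f v = \<alpha> * f v)"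
  then obtain f where diamond: "f \<in> diamond_space X (canonical_weight X) \<tau>"
    and nz: "\<exists>v\<in>faces X 0. f v \<noteq> 0"
    and eig: "\<And>v. v \<in> faces X 0 \<Longrightarrow> adjacency X (canonical_weight X) f v = \<alpha> * f v" by blast
  let ?w = "canonical_weight X"
  have r1: "1 \<le> r" "CARD('t) = Suc r" using rank2 r by auto
  have dimX: "dimension X = r" using dimensionX r by simp
  have top: "faces X (dimension X) = chambersX" using r1(2) by (simp add: faces_def dimX chambersX_def)
  note topr = top[unfolded dimX]
  have chX: "c \<in> X" "finite c" "card c = Suc r" if "c \<in> chambersX" for c
    using that r1(2) finite_faceX by (auto simp: chambersX_def)
  have st: "star chambersX {} = chambersX" by (simp add: star_def)
  interpret S: star_system chambersX "{}" r
    using finite_chambersX chX by unfold_locales (auto simp: st)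
  define V where "V = S.V"
  have V_eq: "V = \<Union>chambersX" by (simp add: V_def S.V_def st)
  have fV: "finite V" using S.finite_V by (simp add: V_def)
  define N where "N v = real (card {c \<in> chambersX. v \<in> c})" for v
  have N_pos: "0 < N v" if "v \<in> V" for v using S.N_pos[of v] that by (simp add: N_def S.N_def st V_def)
  have swap: "(\<Sum>c\<in>chambersX. \<Sum>v\<in>c. h c v) = (\<Sum>v\<in>V. \<Sum>c | c \<in> chambersX \<and> v \<in> c. h c v)" for h :: "'a set \<Rightarrow> 'a \<Rightarrow> real"
    using S.swap[of h] by (simp add: st V_def)
  have single: "(\<Sum>c\<in>chambersX. \<Sum>v\<in>c. h v) = (\<Sum>v\<in>V. N v * h v)" for h :: "'a \<Rightarrow> real"
    using swap[of "\<lambda>c v. h v"] by (simp add: N_def)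
  have sub: "y \<in> X" if "x \<in> X" "y \<subseteq> x" for x y using complexX that by (auto simp: abstract_complex_def)
  have V_face: "{v} \<in> X \<longleftrightarrow> v \<in> V" for v
    using face_in_chamberX[of "{v}"] sub chX unfolding V_eq by blast
  have faces0: "faces X 0 = (\<lambda>v. {v}) ` V"
  proof (intro Set.set_eqI iffI)
    fix x assume "x \<in> faces X 0"
    then have "x \<in> X" "card x = 1" by (auto simp: faces_def)
    then obtain v where "x = {v}" by (auto simp: card_1_singleton_iff)
    then show "x \<in> (\<lambda>v. {v}) ` V" using V_face \<open>x \<in> X\<close> by blast
  next
    fix x assume "x \<in> (\<lambda>v. {v}) ` V"
    then show "x \<in> faces X 0" using V_face by (auto simp: faces_def)
  qed
  define g where "g v = f {v}" for v
  define F where "F c = (\<Sum>u\<in>c. g u)" for c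
  define K where "K = real (card chambersX)"
  have "chambersX \<noteq> {}" using face_in_chamberX[of "{}"] complexX by (auto simp: abstract_complex_def)
  then have K: "0 < K" using finite_chambersX by (simp add: K_def card_gt_0_iff)
  have w1: "?w {v} = N v / ((real r + 1) * K)" for v
    unfolding canonical_weight_def dimX topr by (simp add: N_def K_def field_simps)
  have w2: "?w e = real (card {c \<in> chambersX. e \<subseteq> c}) * 2 / ((real r + 1) * real r * K)" if "card e = 2" for e
  proof -
    have "2 * (Suc r choose 2) = Suc r * r" by (simp add: choose_two)
    then have "2 * real (Suc r choose 2) = (real r + 1) * real r"
      by (metis of_nat_Suc of_nat_mult of_nat_numeral add.commute)
    then have "real (Suc r choose 2) = (real r + 1) * real r / 2" by simp
    then have "real (r + 1 choose card e) = (real r + 1) * real r / 2" using that by simp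
    then show ?thesis unfolding canonical_weight_def dimX topr K_def by (simp only: inverse_divide times_divide_times_eq) (simp only: mult.commute)
  qed
  \<comment> \<open>In chamber sums a vertex also counts itself, and the two binomial coefficients
    in the weights leave a factor \<open>r\<close>: the eigenvalue \<open>\<alpha>\<close> becomes
    \<open>1 + r \<alpha>\<close>.\<close>
  have eigF: "(\<Sum>c | c \<in> chambersX \<and> v \<in> c. F c) = (1 + real r * \<alpha>) * N v * g v" if v: "v \<in> V" for v
  proof -
    define Es where "Es = {e. e \<in> faces X 1 \<and> {v} \<subseteq> e}"
    have fE: "finite Es" using finX by (simp add: Es_def faces_def)
    have c2: "card e = 2" if "e \<in> Es" for e using that by (simp add: Es_def faces_def)
    have quot: "a * 2 / ((\<rho> + 1) * \<rho> * K) / (2 * (n / ((\<rho> + 1) * K))) = a / (\<rho> * n)"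
      if "0 < \<rho>" "0 < n" for a \<rho> n :: real using that K by (simp add: divide_simps)
    have summand: "?w e / (2 * ?w {v}) = real (card {c \<in> chambersX. e \<subseteq> c}) / (real r * N v)" if "e \<in> Es" for e
      unfolding w1 w2[OF c2[OF that]] using quot N_pos[OF v] r1(1) by simp
    have "\<alpha> * g v = (\<Sum>e\<in>Es. ?w e / (2 * ?w {v}) * f (e - {v}))"
      using eig[of "{v}"] v faces0 by (simp add: adjacency_def g_def Es_def)
    also have "\<dots> = (\<Sum>e\<in>Es. real (card {c \<in> chambersX. e \<subseteq> c}) * f (e - {v})) / (real r * N v)"
      unfolding sum_divide_distrib using summand by (intro sum.cong HOL.refl) simp
    also have "(\<Sum>e\<in>Es. real (card {c \<in> chambersX. e \<subseteq> c}) * f (e - {v})) =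
        (\<Sum>e\<in>Es. \<Sum>c | c \<in> chambersX \<and> e \<subseteq> c. f (e - {v}))" by simp
    also have "\<dots> = (\<Sum>c\<in>chambersX. \<Sum>e | e \<in> Es \<and> e \<subseteq> c. f (e - {v}))"
      by (rule sum.swap_restrict[OF fE finite_chambersX])
    also have "\<dots> = (\<Sum>c\<in>chambersX. if v \<in> c then F c - g v else 0)"
    proof (intro sum.cong HOL.refl)
      fix c assume c: "c \<in> chambersX"
      show "(\<Sum>e | e \<in> Es \<and> e \<subseteq> c. f (e - {v})) = (if v \<in> c then F c - g v else 0)"
      proof (cases "v \<in> c")
        case True
        have im: "{e. e \<in> Es \<and> e \<subseteq> c} = (\<lambda>u. {u, v}) ` (c - {v})"
        proof (intro Set.set_eqI iffI)
          fix e assume "e \<in> {e. e \<in> Es \<and> e \<subseteq> c}"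
          then have e: "card e = 2" "v \<in> e" "e \<subseteq> c" using c2 by (auto simp: Es_def)
          then obtain x y where "e = {x, y}" "x \<noteq> y" by (auto simp: card_2_iff)
          then obtain u where "e = {u, v}" "u \<noteq> v" using e(2) by auto
          then show "e \<in> (\<lambda>u. {u, v}) ` (c - {v})" using e(3) by auto
        next
          fix e assume "e \<in> (\<lambda>u. {u, v}) ` (c - {v})"
          then obtain u where u: "u \<in> c" "u \<noteq> v" "e = {u, v}" by auto
          then have "e \<subseteq> c" using True by simp
          moreover from this have "e \<in> X" using sub[OF chX(1)[OF c]] by blast
          ultimately show "e \<in> {e. e \<in> Es \<and> e \<subseteq> c}" using u by (simp add: Es_def faces_def)
        qed
        have inj: "inj_on (\<lambda>u. {u, v}) (c - {v})" by (auto simp: inj_on_def doubleton_eq_iff)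
        have "(\<Sum>e | e \<in> Es \<and> e \<subseteq> c. f (e - {v})) = (\<Sum>u\<in>c - {v}. f ({u, v} - {v}))"
          unfolding im sum.reindex[OF inj] by (simp only: o_def)
        also have "\<dots> = (\<Sum>u\<in>c - {v}. g u)"
        proof (intro sum.cong HOL.refl)
          fix u assume "u \<in> c - {v}"
          then have "{u, v} - {v} = {u}" by auto
          then show "f ({u, v} - {v}) = g u" by (simp add: g_def)
        qed
        also have "\<dots> = F c - g v" using True chX(2)[OF c] by (simp add: sum_diff1 F_def)
        finally show ?thesis using True by simp
      next
        case False
        then have "{e. e \<in> Es \<and> e \<subseteq> c} = {}" by (auto simp: Es_def)
        then show ?thesis using False by (simp only: sum.empty if_False)
      qed
    qed
    also have "\<dots> = (\<Sum>c | c \<in> chambersX \<and> v \<in> c. F c - g v)"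
      using finite_chambersX by (simp add: sum.inter_filter[symmetric])
    also have "\<dots> = (\<Sum>c | c \<in> chambersX \<and> v \<in> c. F c) - N v * g v" by (simp add: sum_subtractf N_def)
    finally have "\<alpha> * g v * (real r * N v) = (\<Sum>c | c \<in> chambersX \<and> v \<in> c. F c) - N v * g v"
      using N_pos[OF v] r1(1) by (simp add: field_simps)
    then show ?thesis by (simp add: algebra_simps)
  qed
  \<comment> \<open>The component of \<open>g\<close> on part \<open>i\<close>. Orthogonality to the
    indicators means that every component has mean zero separately.\<close>
  define gi where "gi i v = (if \<tau> v = i then g v else 0)" for i v
  have mean: "(\<Sum>c\<in>chambersX. \<Sum>v\<in>c. gi i v) = 0" for i
  proof -
    define ind where "ind = (\<lambda>v. \<Sum>j\<in>UNIV. (if j = i then 1 else 0 :: real) * indicator (part X \<tau> j) v)"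
    have "ind \<in> part_span X \<tau>" unfolding part_span_def ind_def by (rule range_eqI[of _ _ "\<lambda>j. if j = i then 1 else 0"]) simp
    then have "weighted_inner X ?w f ind = 0" using diamond by (simp add: diamond_space_def)
    moreover have "ind x = indicator (part X \<tau> i) x" for x
      unfolding ind_def by (simp add: if_distrib[of "\<lambda>a. a * _"] cong: if_cong)
    moreover have "weighted_inner X ?w f (indicator (part X \<tau> i)) = (\<Sum>v\<in>V. N v * gi i v) / ((real r + 1) * K)"
    proof -
      have ip: "indicator (part X \<tau> i) {v} = (if \<tau> v = i then 1 else 0 :: real)" if "v \<in> V" for v
        using that faces0 by (auto simp: part_def indicator_def)
      have "weighted_inner X ?w f (indicator (part X \<tau> i)) = (\<Sum>v\<in>V. ?w {v} * f {v} * indicator (part X \<tau> i) {v})"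
        unfolding weighted_inner_def faces0 by (subst sum.reindex) (auto simp: inj_on_def)
      also have "\<dots> = (\<Sum>v\<in>V. N v * gi i v / ((real r + 1) * K))"
        using ip by (intro sum.cong) (auto simp: w1 gi_def g_def)
      finally show ?thesis by (simp add: sum_divide_distrib)
    qed
    ultimately have "(\<Sum>v\<in>V. N v * gi i v) / ((real r + 1) * K) = 0"
      by (simp add: weighted_inner_def)
    then have "(\<Sum>v\<in>V. N v * gi i v) = 0" using K by simp
    then show ?thesis by (simp add: single)
  qed
  define M where "M = 1 + real r * l"
  have bound: "(\<Sum>c\<in>chambersX. (\<Sum>v\<in>c. h v)\<^sup>2) \<le> M * (\<Sum>c\<in>chambersX. \<Sum>v\<in>c. (h v)\<^sup>2)"
    if "(\<Sum>c\<in>chambersX. \<Sum>v\<in>c. h v) = 0" for h :: "'a \<Rightarrow> real"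
    using sb that unfolding spectral_bound_def st M_def by simp
  have gsum: "g v = (\<Sum>i\<in>UNIV. gi i v)" for v by (simp add: gi_def)
  define R where "R = (\<Sum>v\<in>V. N v * (g v)\<^sup>2)"
  have R: "0 < R"
  proof -
    obtain v where v: "v \<in> V" "g v \<noteq> 0" using nz faces0 by (auto simp: g_def)
    have "0 < N v * (g v)\<^sup>2" using N_pos[OF v(1)] v(2) by simp
    also have "\<dots> \<le> R" unfolding R_def
      using N_pos by (intro member_le_sum[OF v(1)] fV) (simp add: less_imp_le)
    finally show ?thesis .
  qed
  have Q: "(\<Sum>c\<in>chambersX. (F c)\<^sup>2) = (1 + real r * \<alpha>) * R"
  proof -
    have "(\<Sum>c\<in>chambersX. (F c)\<^sup>2) = (\<Sum>c\<in>chambersX. \<Sum>v\<in>c. g v * F c)"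
      by (simp add: F_def power2_eq_square sum_distrib_right)
    also have "\<dots> = (\<Sum>v\<in>V. g v * (\<Sum>c | c \<in> chambersX \<and> v \<in> c. F c))" by (simp add: swap sum_distrib_left)
    also have "\<dots> = (\<Sum>v\<in>V. (1 + real r * \<alpha>) * (N v * (g v)\<^sup>2))"
      by (intro sum.cong HOL.refl) (simp add: eigF power2_eq_square)
    finally show ?thesis by (simp add: R_def sum_distrib_left)
  qed
  have G: "(\<Sum>c\<in>chambersX. \<Sum>v\<in>c. (g v)\<^sup>2) = R" by (simp add: single R_def)
  have upper: "\<alpha> \<le> l"
  proof -
    have "(\<Sum>c\<in>chambersX. \<Sum>v\<in>c. g v) = (\<Sum>i\<in>UNIV. \<Sum>c\<in>chambersX. \<Sum>v\<in>c. gi i v)"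
      unfolding gsum by (subst sum.swap) (intro sum.cong HOL.refl, subst sum.swap, simp)
    then have "(\<Sum>c\<in>chambersX. \<Sum>v\<in>c. g v) = 0" using mean by simp
    from bound[OF this] have "(1 + real r * \<alpha>) * R \<le> M * R" using Q G by (simp add: F_def)
    then have "1 + real r * \<alpha> \<le> 1 + real r * l" using R by (simp add: M_def)
    then show ?thesis using r1(1) by simp
  qed
  have lower: "- (real r * l) \<le> \<alpha>"
  proof -
    define A where "A c i = (\<Sum>v\<in>c. gi i v)" for c i
    have FA: "F c = (\<Sum>i\<in>UNIV. A c i)" for c unfolding F_def A_def gsum by (rule sum.swap)
    \<comment> \<open>A chamber meets each part in at most one vertex, so \<open>A c i\<close> is a
      single value of \<open>g\<close> or zero.\<close>
    have A2: "(A c i)\<^sup>2 = (\<Sum>v\<in>c. (gi i v)\<^sup>2)" if c: "c \<in> chambersX" for c i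
    proof (cases "\<exists>v\<in>c. \<tau> v = i")
      case True
      then obtain v where v: "v \<in> c" "\<tau> v = i" by blast
      have other: "gi i u = 0" if "u \<in> c - {v}" for u
        using inj_labelX[OF chX(1)[OF c]] v that by (auto simp: gi_def inj_on_def)
      have "(\<Sum>u\<in>c. h (gi i u)) = h (gi i v) + (\<Sum>u\<in>c - {v}. h (gi i u))" for h :: "real \<Rightarrow> real"
        using sum.remove[OF chX(2)[OF c] v(1)] by simp
      from this[of "\<lambda>a. a"] this[of "\<lambda>a. a\<^sup>2"] show ?thesis using other by (simp add: A_def)
    next
      case False
      then have "gi i v = 0" if "v \<in> c" for v using that by (auto simp: gi_def)
      then show ?thesis by (simp add: A_def)
    qed
    have GA: "(\<Sum>v\<in>c. (g v)\<^sup>2) = (\<Sum>i\<in>UNIV. (A c i)\<^sup>2)" if c: "c \<in> chambersX" for c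
    proof -
      have "(g v)\<^sup>2 = (\<Sum>i\<in>UNIV. (gi i v)\<^sup>2)" for v by (simp add: gi_def if_distrib[of "\<lambda>a. a\<^sup>2"] cong: if_cong)
      then have "(\<Sum>v\<in>c. (g v)\<^sup>2) = (\<Sum>i\<in>UNIV. \<Sum>v\<in>c. (gi i v)\<^sup>2)" by (subst sum.swap) simp
      then show ?thesis using A2[OF c] by simp
    qed
    have pair: "(\<Sum>c\<in>chambersX. (A c i - A c j)\<^sup>2) \<le> M * (\<Sum>c\<in>chambersX. (A c i)\<^sup>2 + (A c j)\<^sup>2)"
      if ij: "j \<in> UNIV - {i}" for i j
    proof -
      have d: "(\<Sum>v\<in>c. gi i v - gi j v) = A c i - A c j" for c by (simp add: A_def sum_subtractf)
      have "(\<Sum>c\<in>chambersX. \<Sum>v\<in>c. gi i v - gi j v) = 0" using mean[of i] mean[of j] by (simp add: sum_subtractf)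
      from bound[OF this] have "(\<Sum>c\<in>chambersX. (A c i - A c j)\<^sup>2) \<le> M * (\<Sum>c\<in>chambersX. \<Sum>v\<in>c. (gi i v - gi j v)\<^sup>2)"
        by (simp only: d)
      also have "(\<Sum>c\<in>chambersX. \<Sum>v\<in>c. (gi i v - gi j v)\<^sup>2) = (\<Sum>c\<in>chambersX. (A c i)\<^sup>2 + (A c j)\<^sup>2)"
      proof (intro sum.cong HOL.refl)
        fix c assume c: "c \<in> chambersX"
        have "(gi i v - gi j v)\<^sup>2 = (gi i v)\<^sup>2 + (gi j v)\<^sup>2" for v using ij by (auto simp: gi_def)
        then show "(\<Sum>v\<in>c. (gi i v - gi j v)\<^sup>2) = (A c i)\<^sup>2 + (A c j)\<^sup>2" by (simp add: sum.distrib A2[OF c])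
      qed
      finally show ?thesis .
    qed
    have off: "(\<Sum>j\<in>UNIV - {i}. h j) = (\<Sum>j\<in>UNIV. h j) - h i" for i :: 't and h :: "'t \<Rightarrow> real"
      by (simp add: sum_diff1)
    have "(\<Sum>i\<in>UNIV. \<Sum>j\<in>UNIV - {i}. \<Sum>c\<in>chambersX. (A c i - A c j)\<^sup>2) \<le>
        (\<Sum>i\<in>UNIV. \<Sum>j\<in>UNIV - {i}. M * (\<Sum>c\<in>chambersX. (A c i)\<^sup>2 + (A c j)\<^sup>2))"
      using pair by (intro sum_mono) auto
    moreover have "(\<Sum>i\<in>UNIV. \<Sum>j\<in>UNIV - {i}. \<Sum>c\<in>chambersX. (A c i - A c j)\<^sup>2) =
        2 * (real r + 1) * R - 2 * ((1 + real r * \<alpha>) * R)"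
    proof -
      \<comment> \<open>The squared differences over all ordered pairs of parts bring in the squared
        chamber sum with a negative sign; this is what turns upper bounds into a lower bound for
        \<open>\<alpha>\<close>.\<close>
      have each: "(\<Sum>i\<in>UNIV. \<Sum>j\<in>UNIV. (A c i - A c j)\<^sup>2) = 2 * (real r + 1) * (\<Sum>v\<in>c. (g v)\<^sup>2) - 2 * (F c)\<^sup>2"
        if c: "c \<in> chambersX" for c
      proof -
        have "(\<Sum>j\<in>UNIV. (A c i - A c j)\<^sup>2) = (real r + 1) * (A c i)\<^sup>2 - 2 * A c i * F c + (\<Sum>v\<in>c. (g v)\<^sup>2)" for i
          unfolding GA[OF c] FA power2_diff
          by (simp add: sum.distrib sum_subtractf sum_distrib_left r1(2) add.commute)
        then have "(\<Sum>i\<in>UNIV. \<Sum>j\<in>UNIV. (A c i - A c j)\<^sup>2) =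
            (real r + 1) * (\<Sum>i\<in>UNIV. (A c i)\<^sup>2) - 2 * (\<Sum>i\<in>UNIV. A c i) * F c + (real r + 1) * (\<Sum>v\<in>c. (g v)\<^sup>2)"
          by (simp add: sum.distrib sum_subtractf sum_distrib_left sum_distrib_right r1(2) add.commute)
        then show ?thesis unfolding GA[OF c, symmetric] FA[symmetric] by (simp add: power2_eq_square)
      qed
      have "(\<Sum>i\<in>UNIV. \<Sum>j\<in>UNIV - {i}. \<Sum>c\<in>chambersX. (A c i - A c j)\<^sup>2) = (\<Sum>i\<in>UNIV. \<Sum>j\<in>UNIV. \<Sum>c\<in>chambersX. (A c i - A c j)\<^sup>2)"
        unfolding off by simp
      also have "\<dots> = (\<Sum>c\<in>chambersX. \<Sum>i\<in>UNIV. \<Sum>j\<in>UNIV. (A c i - A c j)\<^sup>2)"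
        unfolding sum.swap[where A = UNIV and B = chambersX] by (rule HOL.refl)
      also have "\<dots> = (\<Sum>c\<in>chambersX. 2 * (real r + 1) * (\<Sum>v\<in>c. (g v)\<^sup>2) - 2 * (F c)\<^sup>2)"
        using each by (rule sum.cong[OF HOL.refl])
      finally show ?thesis by (simp add: sum_subtractf sum_distrib_left[symmetric] G Q)
    qed
    moreover have "(\<Sum>i\<in>UNIV. \<Sum>j\<in>UNIV - {i}. M * (\<Sum>c\<in>chambersX. (A c i)\<^sup>2 + (A c j)\<^sup>2)) = M * (2 * real r * R)"
    proof -
      define B where "B i = (\<Sum>c\<in>chambersX. (A c i)\<^sup>2)" for i
      have BR: "(\<Sum>i\<in>UNIV. B i) = R" unfolding B_def by (subst sum.swap) (simp add: GA[symmetric] G)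
      have "(\<Sum>i\<in>UNIV. \<Sum>j\<in>UNIV - {i}. M * (\<Sum>c\<in>chambersX. (A c i)\<^sup>2 + (A c j)\<^sup>2)) =
          M * (\<Sum>i\<in>UNIV. \<Sum>j\<in>UNIV - {i}. B i + B j)"
        unfolding B_def sum.distrib[where A = chambersX] sum_distrib_left by (rule HOL.refl)
      also have "(\<Sum>i\<in>UNIV. \<Sum>j\<in>UNIV - {i}. B i + B j) = (\<Sum>i\<in>UNIV. real r * B i + R - B i)"
        unfolding off by (simp add: sum.distrib BR r1(2) algebra_simps)
      also have "\<dots> = 2 * real r * R"
        by (simp add: sum.distrib sum_subtractf sum_distrib_left[symmetric] BR r1(2)) (simp add: algebra_simps)
      finally show ?thesis by simp
    qed
    \<comment> \<open>Each part occurs in \<open>2 r\<close> ordered pairs. Division by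
      \<open>2 r R\<close> leaves \<open>1 - \<alpha> \<le> M\<close>.\<close>
    ultimately have "2 * (real r + 1) * R - 2 * ((1 + real r * \<alpha>) * R) \<le> M * (2 * real r * R)" by simp
    then have "(2 * (real r - real r * \<alpha>)) * R \<le> (2 * (M * real r)) * R" by (simp add: algebra_simps)
    then have "real r - real r * \<alpha> \<le> M * real r" using R by simp
    then have "real r * (1 - \<alpha>) \<le> real r * M" by (simp add: algebra_simps)
    then have "1 - \<alpha> \<le> M" using r1(1) by simp
    then show ?thesis by (simp add: M_def)
  qed
  show "\<alpha> \<in> {- (real r * l)..l}" using upper lower by simp
qed

end

section \<open>Labels of affine diagrams\<close>

text \<open>The sum of all elements of a finite parabolic subgroup kills its roots, hence the whole
  space that they span, but it multiplies the vectors in the radical by the group order.\<close>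

lemma finite_parabolic_nondegenerate:
  assumes fin: "finite (act T ` lists J)" and supp: "\<And>s. s \<notin> J \<Longrightarrow> z $ s = 0"
    and rad: "\<And>s. s \<in> J \<Longrightarrow> bform T (simple_root s) z = 0"
  shows "z = 0"
proof -
  define G where "G = act T ` lists J"
  define P where "P x = (\<Sum>g\<in>G. g x)" for x
  have lin: "linear g" if "g \<in> G" for g using that linear_act by (auto simp: G_def)
  have linP: "linear P" unfolding P_def by (rule linear_compose_sum) (use lin in blast)
  have root0: "P (simple_root s) = 0" if s: "s \<in> J" for s
  proof -
    have closed: "g \<circ> simple_refl T s \<in> G" if g: "g \<in> G" for g
    proof -
      obtain u where u: "u \<in> lists J" "g = act T u" using g by (auto simp: G_def)
      have "g \<circ> simple_refl T s = act T (u @ [s])" using u(2) by (simp add: act_append)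
      moreover have "u @ [s] \<in> lists J" using u(1) s by simp
      ultimately show ?thesis by (auto simp: G_def)
    qed
    have inv: "(g \<circ> simple_refl T s) \<circ> simple_refl T s = g" for g :: "real^'a \<Rightarrow> real^'a"
      by (simp add: fun_eq_iff refl_involution)
    have "P (simple_refl T s (simple_root s)) = (\<Sum>g\<in>G. (g \<circ> simple_refl T s) (simple_root s))" by (simp add: P_def)
    also have "\<dots> = P (simple_root s)" unfolding P_def
      by (rule sum.reindex_bij_witness[of _ "\<lambda>g. g \<circ> simple_refl T s" "\<lambda>g. g \<circ> simple_refl T s"])
        (use closed inv in auto)
    finally have "- P (simple_root s) = P (simple_root s)" by (simp only: refl_root_self linear_neg[OF linP])
    then have "2 *\<^sub>R P (simple_root s) = 0" by (simp only: scaleR_2) (simp add: add_eq_0_iff)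
    then show ?thesis by simp
  qed
  have fix_refl: "simple_refl T s z = z" if "s \<in> J" for s using rad[OF that] by (simp add: simple_refl_def)
  have fixz: "act T u z = z" if "u \<in> lists J" for u
    using that by (induction u) (auto simp: fix_refl)
  have "P z = P (\<Sum>s\<in>UNIV. z $ s *\<^sub>R simple_root s)" using vec_sum_roots[of z] by simp
  also have "\<dots> = (\<Sum>s\<in>UNIV. z $ s *\<^sub>R P (simple_root s))" by (simp add: linear_sum[OF linP] linear_scale[OF linP])
  also have "\<dots> = 0" by (intro sum.neutral ballI) (use root0 supp in auto)
  finally have "P z = 0" .
  moreover have "P z = real (card G) *\<^sub>R z"
  proof -
    have "P z = (\<Sum>g\<in>G. z)" unfolding P_def by (rule sum.cong) (use fixz in \<open>auto simp: G_def\<close>)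
    then show ?thesis by (simp only: sum_constant_scaleR)
  qed
  moreover have "card G \<noteq> 0" using fin by (auto simp: G_def)
  ultimately show ?thesis by simp
qed

lemma diagram_form_nonpos:
  assumes T: "coxeter_diagram T" and "u \<noteq> v"
  shows "diagram_form T $ u $ v \<le> 0" and "{u, v} \<in> edges T \<Longrightarrow> diagram_form T $ u $ v \<le> - (1 / 2)"
proof -
  have edge: "diagram_form T $ u $ v \<le> - (1 / 2)" if e: "{u, v} \<in> edges T"
  proof (cases "label T {u, v}")
    case (enat k)
    then have k: "3 \<le> k" using T e by (auto simp: coxeter_diagram_def numeral_eq_enat)
    have "cos (pi / 3) \<le> cos (pi / real k)" using k by (intro cos_monotone_0_pi_le) (auto simp: field_simps)
    then show ?thesis using assms(2) e enat by (simp add: diagram_form_def cos_60)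
  qed (use assms(2) e in \<open>simp add: diagram_form_def\<close>)
  show "{u, v} \<in> edges T \<Longrightarrow> diagram_form T $ u $ v \<le> - (1 / 2)" by (rule edge)
  show "diagram_form T $ u $ v \<le> 0"
    using edge assms(2) by (cases "{u, v} \<in> edges T") (auto simp: diagram_form_def)
qed

text \<open>The constant \<open>3 / 4\<close> is the squared cosine of \<open>pi / 6\<close>, the
  value at label 6; larger labels exceed it strictly.\<close>

lemma large_label_form:
  assumes "u \<noteq> v" "{u, v} \<in> edges T" and large: "\<not> label T {u, v} \<le> 6"
  shows "\<exists>\<beta>>0. diagram_form T $ u $ v = - \<beta> \<and> 3 / 4 < \<beta>\<^sup>2"
proof (cases "label T {u, v}")
  case (enat k)
  then have k: "7 \<le> k" using large by (auto simp: numeral_eq_enat)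
  have "cos (pi / 6) < cos (pi / real k)" using k by (intro cos_monotone_0_pi) (auto simp: field_simps)
  then have "sqrt 3 / 2 < cos (pi / real k)" by (simp add: cos_30)
  moreover from this have "0 < cos (pi / real k)" by (rule less_trans[rotated]) simp
  moreover have "(sqrt 3 / 2)\<^sup>2 < (cos (pi / real k))\<^sup>2" by (rule power_strict_mono) (use calculation in simp_all)
  ultimately show ?thesis using assms(1,2) enat by (intro exI[of _ "cos (pi / real k)"]) (simp add: diagram_form_def power_divide)
next
  case infinity
  then show ?thesis using assms(1,2) by (intro exI[of _ 1]) (simp add: diagram_form_def power2_eq_square)
qed

text \<open>On the test vector with coefficients 1, \<open>\<beta>\<close> and \<open>1 / 2\<close>,
  the form is at most \<open>3 / 4\<close> minus the square of \<open>\<beta>\<close>. Here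
  \<open>\<beta>\<close> is the best coefficient for \<open>v\<close>, and \<open>1 / 2\<close>
  suits an edge of the smallest label 3.\<close>

lemma large_label_isolated:
  assumes T: "coxeter_diagram T" and psd: "\<And>x. 0 \<le> bform T x x"
    and uv: "u \<noteq> v" "{u, v} \<in> edges T" and large: "\<not> label T {u, v} \<le> 6"
    and w: "w \<noteq> u" "w \<noteq> v"
  shows "diagram_form T $ u $ w = 0"
proof (rule ccontr)
  assume "diagram_form T $ u $ w \<noteq> 0"
  then have "{u, w} \<in> edges T" using w(1) by (simp add: diagram_form_def split: if_splits)
  then have uw: "diagram_form T $ u $ w \<le> - (1 / 2)" using diagram_form_nonpos(2)[OF T] w(1) by metis
  have vw: "diagram_form T $ v $ w \<le> 0" using diagram_form_nonpos(1)[OF T] w(2) by metis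
  obtain \<beta> where \<beta>: "0 < \<beta>" "diagram_form T $ u $ v = - \<beta>" "3 / 4 < \<beta>\<^sup>2" using large_label_form[OF uv large] by blast
  define x where "x = simple_root u + \<beta> *\<^sub>R simple_root v + (1 / 2) *\<^sub>R simple_root w"
  have diag: "diagram_form T $ s $ s = 1" for s by (simp add: diagram_form_def)
  have "bform T x x = 1 + \<beta>\<^sup>2 + 1 / 4 - 2 * \<beta>\<^sup>2 + diagram_form T $ u $ w + \<beta> * diagram_form T $ v $ w"
    by (simp add: x_def bform_add_left bform_add_right bform_scale_left bform_scale_right bform_root \<beta>(2)
        diagram_form_sym[of T v u] diagram_form_sym[of T w u] diagram_form_sym[of T w v] diag power2_eq_square)
      (simp add: field_simps)
  moreover have "\<beta> * diagram_form T $ v $ w \<le> 0" using \<beta>(1) vw by (simp add: mult_nonneg_nonpos)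
  ultimately have "bform T x x < 0" using \<beta>(3) uw by linarith
  then show False using psd[of x] by simp
qed

lemma affine_diagram_label_le_6:
  fixes T :: "'t::finite diagram"
  assumes T: "coxeter_diagram T" and affine: "affine_diagram T" and rank3: "3 \<le> CARD('t)"
    and nondeg: "\<And>s z. \<lbrakk>z $ s = 0; \<And>t. t \<noteq> s \<Longrightarrow> bform T (simple_root t) z = 0\<rbrakk> \<Longrightarrow> z = 0"
    and e: "e \<in> edges T"
  shows "label T e \<le> 6"
proof (rule ccontr)
  assume large: "\<not> label T e \<le> 6"
  have psd: "0 \<le> bform T x x" for x using affine by (simp add: affine_diagram_def bform_def)
  obtain u v where uv: "e = {u, v}" "u \<noteq> v" using T e by (auto simp: coxeter_diagram_def card_2_iff)
  have iso: "diagram_form T $ u $ w = 0" "diagram_form T $ v $ w = 0" if "w \<noteq> u" "w \<noteq> v" for w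
    using large_label_isolated[OF T psd uv(2) _ _ that] large_label_isolated[OF T psd uv(2)[symmetric] _ _ that(2,1)]
      e large uv(1) by (auto simp: insert_commute)
  have "card {u, v} < CARD('t)" using rank3 uv(2) by simp
  then have "{u, v} \<noteq> UNIV" by auto
  then obtain w where w: "w \<noteq> u" "w \<noteq> v" by auto
  have "rank (diagram_form T) \<noteq> CARD('t)" using affine rank3 by (auto simp: affine_diagram_def)
  then obtain z where z: "z \<noteq> 0" "diagram_form T *v z = 0" using matrix_nonfull_linear_equations_eq by blast
  have bz: "bform T x z = 0" for x by (simp add: bform_def z(2))
  \<comment> \<open>The form is block diagonal along \<open>{u, v}\<close> and its complement, so
    this block of a radical vector is again in the radical.\<close>
  define y :: "real^'t" where "y = (\<chi> s. if s = u \<or> s = v then z $ s else 0)"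
  have "bform T (simple_root t) y = 0" for t
  proof (cases "t = u \<or> t = v")
    case True
    then have "bform T (simple_root t) y = bform T (simple_root t) z"
      unfolding bform_root_left using iso by (intro sum.cong) (auto simp: y_def)
    then show ?thesis using bz by simp
  next
    case False
    then have "diagram_form T $ t $ u = 0" "diagram_form T $ t $ v = 0"
      using iso diagram_form_sym[of T t] by auto
    then show ?thesis unfolding bform_root_left by (intro sum.neutral) (auto simp: y_def)
  qed
  moreover have "y $ w = 0" using w by (simp add: y_def)
  ultimately have "y = 0" using nondeg by blast
  \<comment> \<open>Now \<open>z\<close> itself vanishes at a vertex, so nondegeneracy off that
    vertex applies to it.\<close>
  then have "z $ u = 0" by (simp add: y_def vec_eq_iff split: if_splits) metis
  then show False using nondeg bz z(1) by blast
qed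

text \<open>In a chart with \<open>v\<close> in the base chamber, each element of the parabolic
  subgroup gives a chamber of the apartment that contains \<open>v\<close>. Distinct elements give
  distinct chambers, and the star of \<open>v\<close> is finite.\<close>

lemma (in labelled_building) finite_parabolic:
  assumes v: "v \<in> \<Union>Y" and fin: "finite (star chambers {v})"
  shows "finite (act T ` lists (- {\<sigma> v}))"
proof -
  obtain C where C: "C \<in> Y" "card C = CARD('t)" "v \<in> C"
    using face_in_chamber[OF vertex_face[OF v]] by blast
  obtain A f where A: "coord A C f" using common_coord[OF C(1,2,1)] by blast
  then have f: "typed A f" "A \<in> E" "C \<in> A" "f v = ver T (\<sigma> v) []" using C(3) by (auto simp: coord_def)
  define h where "h c = act T (SOME u. f ` c = chamber T u)" for c
  have "act T u \<in> h ` star chambers {v}" if u: "u \<in> lists (- {\<sigma> v})" for u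
  proof -
    obtain c where c: "c \<in> A" "card c = CARD('t)" "\<forall>x\<in>c. f x = ver T (\<sigma> x) u" "f ` c = chamber T u"
      using typed_chamber[OF f(1,2), of u] by blast
    have cY: "c \<in> Y" using apartment_subset f(2) c(1) by blast
    have "\<sigma> v \<in> \<sigma> ` c" using chamber_label[OF cY c(2)] by simp
    then obtain x where x: "x \<in> c" "\<sigma> x = \<sigma> v" by force
    have "\<forall>i\<in>{\<sigma> v}. ver T i u = ver T i []"
      unfolding ver_eq_iff[OF diagram] using u by (intro bexI[of _ u]) (auto intro: coxeter_eq.refl)
    then have "f x = f v" using c(3) x f(4) by simp
    then have "x = v" using typed_inj[OF f(1)] x(1) c(1) C(3) f(3) by blast
    then have mem: "c \<in> star chambers {v}" using x(1) cY c(2) by (simp add: star_def chambers_iff)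
    define u' where "u' = (SOME u. f ` c = chamber T u)"
    have "f ` c = chamber T u'" unfolding u'_def using c(4) by (rule someI)
    then have eq: "chamber T u = chamber T u'" using c(4) by simp
    have "ver T i u = ver T i u'" for i
    proof -
      have "ver T i u \<in> chamber T u" unfolding chamber_def by (rule rangeI)
      then have "ver T i u \<in> chamber T u'" by (simp only: eq)
      then obtain j where "ver T i u = ver T j u'" by (auto simp: chamber_def)
      then show ?thesis using ver_type[OF diagram] by metis
    qed
    then have "\<forall>i\<in>UNIV. ver T i u = ver T i u'" by blast
    then have "coxeter_eq T u u'" unfolding ver_eq_iff[OF diagram] by simp
    then have "act T u = h c" unfolding h_def u'_def[symmetric] by (rule act_ceq[OF diagram])
    then show ?thesis using mem by blast
  qed
  then have "act T ` lists (- {\<sigma> v}) \<subseteq> h ` star chambers {v}" by blast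
  then show ?thesis using fin finite_subset by blast
qed

lemma (in covered_building) affine_label_le_6:
  assumes affine: "affine_diagram T" and rank3: "3 \<le> CARD('t)" and e: "e \<in> edges T"
  shows "label T e \<le> 6"
proof (rule affine_diagram_label_le_6[OF diagram affine rank3 _ e])
  fix s z
  assume z: "z $ s = 0" "\<And>t. t \<noteq> s \<Longrightarrow> bform T (simple_root t) z = 0"
  obtain c where c: "c \<in> Y" "card c = CARD('t)"
    using face_in_chamber[of "{}"] complex by (auto simp: abstract_complex_def)
  have "s \<in> \<sigma> ` c" using chamber_label[OF c] by simp
  then obtain v where v: "v \<in> c" "\<sigma> v = s" by force
  have "{v} \<in> Y" using subface[OF c(1)] v(1) by simp
  then have "finite (star chambers {v})" by (rule finite_star_chambers) simp
  then have "finite (act T ` lists (- {s}))" using finite_parabolic[of v] v c(1) by blast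
  then show "z = 0" by (rule finite_parabolic_nondegenerate) (use z in auto)
qed

section \<open>Diagram labels\<close>

lemma finite_edges: "finite (edges (T :: 't::finite diagram))"
  by (rule finite_subset[of _ UNIV]) auto

lemma label_le_diagram_max: "e \<in> edges T \<Longrightarrow> label T e \<le> diagram_max T"
  unfolding diagram_max_def using finite_edges by (intro Max_ge) auto

lemma diagram_max_ge_2: "2 \<le> diagram_max T"
  unfolding diagram_max_def using finite_edges by (intro Max_ge) auto

lemma diagram_max_le: "2 \<le> k \<Longrightarrow> (\<And>e. e \<in> edges T \<Longrightarrow> label T e \<le> k) \<Longrightarrow> diagram_max T \<le> k"
  unfolding diagram_max_def using finite_edges by (intro Max.boundedI) auto

lemma diagram_max_mem: "diagram_max T = 2 \<or> (\<exists>e\<in>edges T. diagram_max T = label T e)"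
  using Max_in[of "{2} \<union> label T ` edges T"] finite_edges unfolding diagram_max_def by auto

lemma coxeter_matrix_le_diagram_max:
  assumes "diagram_max T = enat m" "s \<noteq> t"
  shows "\<exists>n\<le>m. coxeter_matrix T s t = enat n"
proof -
  have "coxeter_matrix T s t \<le> enat m"
    using label_le_diagram_max[of "{s, t}" T] diagram_max_ge_2[of T] assms by (simp add: coxeter_matrix_def)
  then show ?thesis using enat_ile by fastforce
qed

text \<open>An infinite label makes the form vanish on the sum of its two simple roots.\<close>

lemma spherical_label_finite:
  assumes T: "coxeter_diagram T" and sph: "spherical_diagram T" and e: "e \<in> edges T"
  shows "label T e \<noteq> \<infinity>"
proof
  assume inf: "label T e = \<infinity>"
  obtain s t where st: "e = {s, t}" "s \<noteq> t" using T e by (auto simp: coxeter_diagram_def card_2_iff)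
  have "diagram_form T $ s $ t = -1" "diagram_form T $ t $ s = -1"
    using e inf st by (auto simp: diagram_form_def insert_commute)
  then have "bform T (simple_root s + simple_root t) (simple_root s + simple_root t) = 0"
    by (simp add: bform_add_left bform_add_right bform_root[of T s t] bform_root[of T t s])
  moreover have "(simple_root s + simple_root t) $ s = 1" using st(2) by (simp add: root_nth)
  then have "simple_root s + simple_root t \<noteq> 0" by (metis zero_index zero_neq_one)
  ultimately show False using sph by (force simp: spherical_diagram_def bform_def)
qed

context covered_building
begin

lemma label_le_8:
  assumes q3: "3 \<le> q" and e: "e \<in> edges T" "label T e = enat n"
  shows "n \<le> 8"
proof -
  obtain s t where st: "e = {s, t}" "s \<noteq> t"
    using diagram e(1) by (auto simp: coxeter_diagram_def card_2_iff)
  have n: "coxeter_matrix T s t = enat n" using st e by (simp add: coxeter_matrix_def)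
  obtain c where c: "c \<in> Y" "card c = CARD('t)"
    using face_in_chamber[of "{}"] complex by (auto simp: abstract_complex_def)
  \<comment> \<open>Removing the vertices of types \<open>s\<close> and \<open>t\<close> from a
    chamber leaves a face whose link is an \<open>n\<close>-gon.\<close>
  define y where "y = {v \<in> c. \<sigma> v \<noteq> s \<and> \<sigma> v \<noteq> t}"
  have y: "y \<in> Y" using subface[OF c(1)] by (simp add: y_def)
  have sc: "\<sigma> ` c = UNIV" by (rule chamber_label[OF c])
  have cotype: "- (\<sigma> ` y) = {s, t}"
  proof -
    have "\<sigma> ` y = \<sigma> ` c - {s, t}" by (auto simp: y_def)
    then show ?thesis using sc by auto
  qed
  have "y \<noteq> {} \<or> CARD('t) = 2" using card_cotype[OF y cotype st(2)] by auto
  then have fin: "finite (star chambers y)" by (rule finite_star_chambers[OF y])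
  obtain d a b where poly: "gen_polygon (link_vertices y) (link_adj y) (\<lambda>v. \<sigma> v = s) n d a b"
    and ab: "q \<le> a" "q \<le> b" using link_polygon[OF y cotype st(2) n fin strong thick q] by blast
  have "s \<in> \<sigma> ` c" using sc by simp
  then obtain v where v: "v \<in> c" "\<sigma> v = s" by force
  then have "v \<in> link_vertices y" using subface[OF c(1), of "insert v y"] by (auto simp: link_vertices_def y_def)
  then show ?thesis using gen_polygon.feit_higman[OF poly] ab q3 by auto
qed

lemma partite_expanderX:
  assumes m: "diagram_max T = enat m" and r: "dimension X = r" and qm: "r\<^sup>2 * (m - 2) \<le> q"
    and l: "l = sqrt (real m - 2) / (sqrt (real q) - (real r - 1) * sqrt (real m - 2))"
  shows "partite_expander X (canonical_weight X) \<tau> (- (real r * l)) l"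
proof -
  have "2 \<le> m" using diagram_max_ge_2[of T] m by (simp add: numeral_eq_enat)
  then have "spectral_bound chambersX {} (1 + real r * l)"
    using spectral_boundX[OF _ coxeter_matrix_le_diagram_max[OF m]] qm
    unfolding dimensionX[symmetric] r l by blast
  then show ?thesis using spectral_bound_partite_expander r dimensionX by blast
qed

lemma partite_complexX: "dimension X = r \<Longrightarrow> partite_complex (r + 1) X \<tau>"
  using inj_labelX dimensionX rank2 by (auto simp: partite_complex_def)

end

lemma covered_building_spherical:
  assumes X: "finite X" "1 \<le> dimension X" and q: "1 \<le> q" and "spherical_case q T X \<tau>"
  shows "\<exists>E. covered_building T X E \<tau> X (\<lambda>v. v) \<tau> q"
proof -
  obtain E where E: "building T X E" "building_labelling T E \<tau>" "thick q X" "strongly_transitive X E \<tau>"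
    using assms(4) by (auto simp: spherical_case_def thick_strongly_transitive_building_def)
  interpret labelled_building T X E \<tau> using E by unfold_locales
  have "covered_building T X E \<tau> X (\<lambda>v. v) \<tau> q"
  proof unfold_locales
    show "2 \<le> CARD('b)" using X(2) dimension_eq by simp
  qed (use X q E complex in \<open>simp_all add: bij_betw_def\<close>)
  then show ?thesis by blast
qed

lemma covered_building_affine:
  fixes T :: "'t::finite diagram"
  assumes X: "finite X" and q: "1 \<le> q" and affine: "affine_case q T X \<tau> p Y \<sigma>"
  shows "\<exists>E. covered_building T Y E \<sigma> X p \<tau> q" and "3 \<le> CARD('t)"
proof -
  obtain E where E: "building T Y E" "building_labelling T E \<sigma>" "thick q Y" "strongly_transitive Y E \<sigma>"
    using affine by (auto simp: affine_case_def thick_strongly_transitive_building_def)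
  interpret labelled_building T Y E \<sigma> using E by unfold_locales
  have p: "simplicial_covering p Y X" using affine by (simp add: affine_case_def universal_covering_def)
  have "2 \<le> dimension Y" using affine by (simp add: affine_case_def)
  then show rank3: "3 \<le> CARD('t)" using dimension_eq by simp
  have "covered_building T Y E \<sigma> X p \<tau> q"
  proof unfold_locales
    fix y assume "y \<in> Y" "y \<noteq> {} \<or> CARD('t) = 2"
    then show "bij_betw ((`) p) {z \<in> Y. y \<subseteq> z} {x \<in> X. p ` y \<subseteq> x}"
      using p rank3 by (auto simp: simplicial_covering_def)
  qed (use X q E p rank3 affine in \<open>auto simp: simplicial_covering_def affine_case_def\<close>)
  then show "\<exists>E. covered_building T Y E \<sigma> X p \<tau> q" by blast
qed

lemma spherical_diagram_max_finite:
  assumes "coxeter_diagram T" "spherical_diagram T"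
  shows "\<exists>m. diagram_max T = enat m"
  using diagram_max_mem[of T] spherical_label_finite[OF assms] by (auto simp: numeral_eq_enat)

text \<open>In the spherical clause the bound 8 is tied to \<open>q \<ge> 3\<close> or to the
  expansion condition, because thin buildings, with \<open>q \<le> 2\<close>, realize dihedral
  diagrams of every finite label.\<close>

theorem theorem7p2:
  fixes X :: "'a set set" and r q :: nat
    and T :: "'t::finite diagram" and \<tau> :: "'a \<Rightarrow> 't"
    and p :: "'b \<Rightarrow> 'a" and Y :: "'b set set" and \<sigma> :: "'b \<Rightarrow> 't"
    and m :: enat and l :: real
  assumes "abstract_complex X" and "finite X" and "dimension X = r"
    and "r \<ge> 1" and "q \<ge> 1"
    and "spherical_case q T X \<tau> \<or> affine_case q T X \<tau> p Y \<sigma>"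
    and "m = diagram_max T"
    and "l = sqrt (real (the_enat m) - 2) /
             (sqrt (real q) - (real r - 1) * sqrt (real (the_enat m) - 2))"
  shows "pure_complex X \<and> partite_complex (r + 1) X \<tau> \<and>
    (enat q \<ge> enat (r\<^sup>2) * (m - 2) \<longrightarrow>
       partite_expander X (canonical_weight X) \<tau> (- (real r * l)) l) \<and>
    (spherical_case q T X \<tau> \<and> (q \<ge> 3 \<or> enat q \<ge> enat (r\<^sup>2) * (m - 2)) \<longrightarrow> m \<le> 8) \<and>
    (affine_case q T X \<tau> p Y \<sigma> \<longrightarrow> m \<le> 6)"
proof -
  have q_iff: "enat q \<ge> enat (r\<^sup>2) * (enat k - 2) \<longleftrightarrow> r\<^sup>2 * (k - 2) \<le> q" for k
    by (simp add: numeral_eq_enat)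
  have spherical: "(\<exists>k. m = enat k) \<and> (q \<ge> 3 \<or> enat q \<ge> enat (r\<^sup>2) * (m - 2) \<longrightarrow> m \<le> 8)"
    if sph: "spherical_case q T X \<tau>"
  proof -
    obtain E where "covered_building T X E \<tau> X (\<lambda>v. v) \<tau> q"
      using covered_building_spherical[OF assms(2) _ assms(5) sph] assms(3,4) by auto
    then interpret S: covered_building T X E \<tau> X "\<lambda>v. v" \<tau> q .
    have "spherical_diagram T" using sph by (simp add: spherical_case_def)
    then obtain k where k: "m = enat k" using spherical_diagram_max_finite[OF S.diagram] assms(7) by auto
    have bound: "k \<le> 8" if q3: "3 \<le> q"
      using diagram_max_mem[of T] S.label_le_8[OF q3] k assms(7) by (auto simp: numeral_eq_enat)
    have "k \<le> 8" if q: "r\<^sup>2 * (k - 2) \<le> q"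
    proof (rule ccontr)
      assume k8: "\<not> k \<le> 8"
      \<comment> \<open>With \<open>k > 8\<close> the expansion condition forces
        \<open>q \<ge> 7\<close>, so the links are thick enough for the theorem on polygons.\<close>
      have "1 * (k - 2) \<le> r\<^sup>2 * (k - 2)" using assms(4) by (intro mult_right_mono) auto
      then have "3 \<le> q" using q k8 by linarith
      then show False using bound k8 by blast
    qed
    then show ?thesis using bound q_iff k by (auto simp: numeral_eq_enat)
  qed
  have affine: "m \<le> 6" if aff: "affine_case q T X \<tau> p Y \<sigma>"
  proof -
    obtain E where "covered_building T Y E \<sigma> X p \<tau> q"
      using covered_building_affine(1)[OF assms(2,5) aff] by blast
    then interpret S: covered_building T Y E \<sigma> X p \<tau> q .
    have "affine_diagram T" using aff by (simp add: affine_case_def)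
    then show ?thesis
      unfolding assms(7) using S.affine_label_le_6 covered_building_affine(2)[OF assms(2,5) aff]
      by (intro diagram_max_le) (auto simp: numeral_eq_enat)
  qed
  \<comment> \<open>In both cases the largest label is finite, so \<open>the_enat m\<close> has its
    intended value and the condition on \<open>q\<close> can be read in natural numbers.\<close>
  obtain k where k: "m = enat k" using assms(6) spherical affine enat_ile by (metis numeral_eq_enat)
  have concl: "pure_complex X \<and> partite_complex (r + 1) X \<tau> \<and>
    (enat q \<ge> enat (r\<^sup>2) * (m - 2) \<longrightarrow> partite_expander X (canonical_weight X) \<tau> (- (real r * l)) l)"
    if cov: "covered_building T Z E \<rho> X f \<tau> q" for Z :: "'c set set" and E \<rho> f
  proof -
    interpret covered_building T Z E \<rho> X f \<tau> q by (rule cov)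
    have "partite_expander X (canonical_weight X) \<tau> (- (real r * l)) l" if "r\<^sup>2 * (k - 2) \<le> q"
      by (rule partite_expanderX[OF _ assms(3) that])
        (use k assms(7) in simp, use assms(8) in \<open>simp only: k the_enat.simps\<close>)
    then show ?thesis using pureX partite_complexX[OF assms(3)] unfolding k q_iff by blast
  qed
  from assms(6) have "pure_complex X \<and> partite_complex (r + 1) X \<tau> \<and>
    (enat q \<ge> enat (r\<^sup>2) * (m - 2) \<longrightarrow> partite_expander X (canonical_weight X) \<tau> (- (real r * l)) l)"
  proof
    assume "spherical_case q T X \<tau>"
    then show ?thesis using covered_building_spherical[OF assms(2) _ assms(5)] assms(3,4) concl by blast
  next
    assume "affine_case q T X \<tau> p Y \<sigma>"
    then show ?thesis using covered_building_affine(1)[OF assms(2,5)] concl by blast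
  qed
  then show ?thesis using spherical affine by blast
qed

end
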